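(* Let $k$ be an algebraically closed field of characteristic zero and let $B$ be an affine $k$-domain of dimension three which is a UFD. If $ML(B)=ML^{*}(B)$, then $ML(B)$ is a rigid UFD and $B$ is a polynomial ring over $ML(B)$.
   Context: An affine $k$-domain is an integral domain that is a finitely generated (commutative, unital) $k$-algebra; dimension means Krull dimension. "$B$ is a polynomial ring over $ML(B)$" means that $B$ is isomorphic, as an $ML(B)$-algebra, to a polynomial ring over $ML(B)$ in some finite number $n\ge 0$ of variables ($n=0$, i.e. $B=ML(B)$, is allowed). For an affine $k$-domain $B$, $LND(B)$ denotes the set of locally nilpotent $k$-derivations of $B$, i.e. $k$-derivations $D:B\to B$ such that for every $b\in B$ there is $m\ge 1$ with $D^m(b)=0$. The Makar-Limanov invariant is $ML(B):=\bigcap_{D\in LND(B)}\operatorname{Ker} D$. Let $LND^{*}(B):=\{D\in LND(B)\mid Ds=1 \text{ for some } s\in B\}$. The Makar-Limanov--Freudenburg invariant is $ML^{*}(B):=\bigcap_{D\in LND^{*}(B)}\operatorname{Ker} D$, with the convention $ML^{*}(B):=B$ if $LND^{*}(B)=\emptyset$. An affine $k$-domain is rigid if it has no non-zero locally nilpotent $k$-derivation. *)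

theory Defs
  imports
    "HOL-Algebra.Module"
    "HOL-Algebra.Generated_Rings"
    "HOL-Algebra.Ring_Divisibility"
    "HOL-Algebra.Indexed_Polynomials"
    "HOL-Algebra.Algebraic_Closure"
    "HOL-Library.Extended_Nat"
begin

definition char_zero :: "('a, 'm) ring_scheme \<Rightarrow> bool"
  where "char_zero R \<longleftrightarrow> (\<forall>n::nat. n > 0 \<longrightarrow> [n] \<cdot>\<^bsub>R\<^esub> \<one>\<^bsub>R\<^esub> \<noteq> \<zero>\<^bsub>R\<^esub>)"

text \<open>A chain of \<open>n + 1\<close> primes \<open>P 0 \<subset> \<dots> \<subset> P n\<close> has length \<open>n\<close>.\<close>

definition krull_dim :: "('a, 'm) ring_scheme \<Rightarrow> enat"
  where "krull_dim R = Sup {enat n | n. \<exists>P :: nat \<Rightarrow> 'a set.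
           (\<forall>i\<le>n. primeideal (P i) R) \<and> (\<forall>i<n. P i \<subset> P (Suc i))}"

locale affine_domain = K?: field K + B?: algebra K B + B?: domain B
  for K (structure) and B (structure) +
  assumes finitely_generated:
    "\<exists>S. finite S \<and> S \<subseteq> carrier B \<and>
       generate_ring B ((\<lambda>c. c \<odot>\<^bsub>B\<^esub> \<one>\<^bsub>B\<^esub>) ` carrier K \<union> S) = carrier B"

text \<open>Only the values of a derivation on the carrier matter; two derivations agreeing there
  may still differ as HOL functions.\<close>

definition derivations :: "('k, 'n) ring_scheme \<Rightarrow> ('k, 'b, 'm) module_scheme \<Rightarrow> ('b \<Rightarrow> 'b) set"
  where "derivations K B = {D \<in> carrier B \<rightarrow> carrier B.
      (\<forall>a\<in>carrier B. \<forall>b\<in>carrier B. D (a \<oplus>\<^bsub>B\<^esub> b) = D a \<oplus>\<^bsub>B\<^esub> D b) \<and>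
      (\<forall>c\<in>carrier K. \<forall>b\<in>carrier B. D (c \<odot>\<^bsub>B\<^esub> b) = c \<odot>\<^bsub>B\<^esub> D b) \<and>
      (\<forall>a\<in>carrier B. \<forall>b\<in>carrier B.
         D (a \<otimes>\<^bsub>B\<^esub> b) = (D a \<otimes>\<^bsub>B\<^esub> b) \<oplus>\<^bsub>B\<^esub> (a \<otimes>\<^bsub>B\<^esub> D b))}"

definition LND :: "('k, 'n) ring_scheme \<Rightarrow> ('k, 'b, 'm) module_scheme \<Rightarrow> ('b \<Rightarrow> 'b) set"
  where "LND K B = {D \<in> derivations K B. \<forall>b\<in>carrier B. \<exists>m\<ge>1. (D ^^ m) b = \<zero>\<^bsub>B\<^esub>}"

definition LND_star :: "('k, 'n) ring_scheme \<Rightarrow> ('k, 'b, 'm) module_scheme \<Rightarrow> ('b \<Rightarrow> 'b) set"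
  where "LND_star K B = {D \<in> LND K B. \<exists>s\<in>carrier B. D s = \<one>\<^bsub>B\<^esub>}"

text \<open>The zero derivation is in \<open>LND K B\<close>, so \<open>makar_limanov\<close> intersects a
  nonempty family.\<close>

definition makar_limanov :: "('k, 'n) ring_scheme \<Rightarrow> ('k, 'b, 'm) module_scheme \<Rightarrow> 'b set"
  where "makar_limanov K B = (\<Inter>D\<in>LND K B. a_kernel B B D)"

definition makar_limanov_star :: "('k, 'n) ring_scheme \<Rightarrow> ('k, 'b, 'm) module_scheme \<Rightarrow> 'b set"
  where "makar_limanov_star K B =
    (if LND_star K B = {} then carrier B else (\<Inter>D\<in>LND_star K B. a_kernel B B D))"

definition rigid :: "('k, 'n) ring_scheme \<Rightarrow> ('k, 'b, 'm) module_scheme \<Rightarrow> bool"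
  where "rigid K B \<longleftrightarrow>
    affine_domain K B \<and> (\<forall>D\<in>LND K B. \<forall>b\<in>carrier B. D b = \<zero>\<^bsub>B\<^esub>)"

text \<open>The polynomial ring in the variables \<open>0, \<dots>, n - 1\<close>. As in
  \<^theory>\<open>HOL-Algebra.Indexed_Polynomials\<close>, a monomial is the multiset of its variables and a
  polynomial maps monomials to coefficients; that theory only multiplies polynomials by single
  variables.\<close>

definition (in ring) mpoly_ring :: "nat \<Rightarrow> (nat multiset \<Rightarrow> 'a) ring"
  where "mpoly_ring n =
    \<lparr> partial_object.carrier = indexed_pset {..<n} (carrier R),
      monoid.mult = (\<lambda>P Q m. \<Oplus>u\<in>{u. u \<subseteq># m}. P u \<otimes> Q (m - u)),
      monoid.one = indexed_const \<one>,
      ring.zero = indexed_const \<zero>,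
      ring.add = indexed_padd \<rparr>"

text \<open>Here \<open>A\<close> is a subring of \<open>B\<close>. A ring isomorphism is one of \<open>A\<close>-algebras
  iff it sends each constant polynomial to its value in \<open>A\<close>.\<close>

definition polynomial_ring_over :: "'b set \<Rightarrow> ('b, 'm) ring_scheme \<Rightarrow> bool"
  where "polynomial_ring_over A B \<longleftrightarrow>
    (\<exists>n. \<exists>h \<in> ring_iso (ring.mpoly_ring (B\<lparr>carrier := A\<rparr>) n) B.
       \<forall>a\<in>A. h (ring.indexed_const (B\<lparr>carrier := A\<rparr>) a) = a)"

end

theory Submission
  imports Defs
begin

text \<open>If no locally nilpotent derivation of \<open>B\<close> has a slice, then \<open>ML*(B) = B\<close>, so \<open>ML(B) = B\<close>: the ring
is rigid, and it is a polynomial ring in no variables over itself.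

Otherwise choose a derivation \<open>E\<close> with \<open>E s = 1\<close> and put \<open>C = ker E\<close>. Taylor expansion along \<open>s\<close> shows
\<open>B = C[s]\<close> with \<open>s\<close> transcendental over \<open>C\<close> (\<open>slice_generates\<close>, \<open>slice_transcendental\<close>), and
\<open>ML(B) \<subseteq> C\<close>. If \<open>C = ML(B)\<close>, we are done. If not, some locally nilpotent derivation of \<open>B\<close> moves
\<open>C\<close>; its part of highest degree in \<open>s\<close> is a non-zero locally nilpotent derivation of \<open>C\<close>
(\<open>homogenize_on_kernel\<close>). Now \<open>C\<close> is factorially closed in a UFD and has transcendence degree at
most two. There a non-zero derivation can be improved until it has a slice (\<open>slice_exists\<close>): take
\<open>\<delta> x \<noteq> 0\<close> in \<open>ker \<delta>\<close> minimal for divisibility, and suppose that a prime \<open>p\<close> divides it. If \<open>p\<close>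
divides all values of \<open>\<delta>\<close>, replace \<open>\<delta>\<close> by \<open>\<delta>/p\<close>. If not, \<open>x\<close> is a constant \<open>a\<close> modulo \<open>p\<close>, because
\<open>C/p\<close> has transcendence degree at most one and \<open>k\<close> is algebraically closed; replace \<open>x\<close> by
\<open>(x - a)/p\<close>. Both contradict minimality. So \<open>C = R[x]\<close>, where \<open>R\<close> has transcendence degree at most
one, and \<open>ML(B) \<subseteq> R\<close>. If \<open>R = ML(B)\<close>, we are done again. If not, some derivation \<open>D\<close> of \<open>B\<close> moves
\<open>R\<close>, and an element \<open>r\<close> of \<open>R\<close> of least positive \<open>D\<close>-degree generates it: \<open>r\<close> is prime, every
\<open>f \<in> R\<close> is \<open>a + r f'\<close> with \<open>a \<in> k\<close>, and \<open>f'\<close> has smaller degree (\<open>line_of_moving_lnd\<close>). Then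
\<open>R = k[r]\<close> and \<open>ML(B) = k\<close>.

In every case \<open>B\<close> arises from \<open>ML(B)\<close> by adjoining successively transcendental elements, which makes
it a polynomial ring (\<open>polynomial_ring_over_of_tower\<close>). Rigidity of \<open>ML(B)\<close> holds because
derivations of \<open>C\<close> extend to \<open>C[s]\<close>, and those of \<open>R\<close> to \<open>R[x]\<close> (\<open>extend_lnd\<close>), and because
derivations vanish on \<open>k\<close>; \<open>ML(B)\<close> is a UFD because it is an
intersection of factorially closed subrings; it is finitely generated because the kernel of a
derivation with slice is a retract (\<open>slice_kernel_finitely_generated\<close>).

The dimension enters through towers: lists of elements each of which is transcendental over the ring
generated by \<open>k\<close> and its predecessors. A tower of length \<open>n\<close> in a finitely generated algebra forces
a chain of \<open>n + 1\<close> primes (\<open>prime_chain_of_tower\<close>), so in Krull dimension three every tower has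
length at most three.

All rings that occur are subsets of one ambient ring, and the field is identified with its image, so
that passing to kernels and polynomial subrings does not change the operations.\<close>

section \<open>Polynomial values, generated subrings and towers\<close>

text \<open>The value at \<open>x\<close> of the polynomial with the \<open>n\<close> coefficients \<open>c 0, \<dots>, c (n - 1)\<close>. Coefficients form a
total function on the naturals, so that no normal form has to be maintained.\<close>
fun (in ring) poly_val :: "(nat \<Rightarrow> 'a) \<Rightarrow> nat \<Rightarrow> 'a \<Rightarrow> 'a"
  where "poly_val c 0 x = \<zero>"
  | "poly_val c (Suc n) x = c 0 \<oplus> x \<otimes> poly_val (\<lambda>i. c (Suc i)) n x"

text \<open>For a subring \<open>A\<close> this is the subring \<open>A[x]\<close>. It is also used for an ideal \<open>p\<close> of \<open>A\<close>, where it is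
the ideal \<open>p A[x]\<close>.\<close>
definition (in ring) adjoin :: "'a set \<Rightarrow> 'a \<Rightarrow> 'a set"
  where "adjoin A x = {poly_val c n x | c n. \<forall>i. c i \<in> A}"

definition (in ring) adjoins :: "'a set \<Rightarrow> 'a list \<Rightarrow> 'a set"
  where "adjoins A xs = foldl adjoin A xs"

text \<open>For a prime ideal \<open>Q\<close>: the residue class of \<open>x\<close> is transcendental over the image of \<open>A\<close>. Working
modulo \<open>Q\<close> inside one ring avoids residue class rings, whose elements have another type.\<close>
definition (in ring) transc_mod :: "'a set \<Rightarrow> 'a set \<Rightarrow> 'a \<Rightarrow> bool"
  where "transc_mod Q A x \<longleftrightarrow> (\<forall>c n. (\<forall>i. c i \<in> A) \<longrightarrow> poly_val c n x \<in> Q \<longrightarrow> (\<forall>i<n. c i \<in> Q))"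

fun (in ring) tower :: "'a set \<Rightarrow> 'a set \<Rightarrow> 'a list \<Rightarrow> bool"
  where "tower Q A [] \<longleftrightarrow> True"
  | "tower Q A (x # xs) \<longleftrightarrow> x \<in> carrier R \<and> transc_mod Q A x \<and> tower Q (adjoin A x) xs"

context cring
begin

lemma poly_val_closed [intro, simp]:
  "\<lbrakk>\<And>i. c i \<in> carrier R; x \<in> carrier R\<rbrakk> \<Longrightarrow> poly_val c n x \<in> carrier R"
  by (induction n arbitrary: c) auto

lemma poly_val_cong: "(\<And>i. i < n \<Longrightarrow> c i = d i) \<Longrightarrow> poly_val c n x = poly_val d n x"
proof (induction n arbitrary: c d)
  case (Suc n)
  have "poly_val (\<lambda>i. c (Suc i)) n x = poly_val (\<lambda>i. d (Suc i)) n x"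
    by (rule Suc.IH) (simp add: Suc.prems)
  then show ?case using Suc.prems[of 0] by simp
qed simp

lemma poly_val_zero [simp]: "x \<in> carrier R \<Longrightarrow> poly_val (\<lambda>i. \<zero>) n x = \<zero>"
  by (induction n) auto

lemma poly_val_add:
  assumes "\<And>i. c i \<in> carrier R" "\<And>i. d i \<in> carrier R" and x: "x \<in> carrier R"
  shows "poly_val (\<lambda>i. c i \<oplus> d i) n x = poly_val c n x \<oplus> poly_val d n x"
  using assms(1,2)
proof (induction n arbitrary: c d)
  case (Suc n)
  have IH: "poly_val (\<lambda>i. c (Suc i) \<oplus> d (Suc i)) n x
      = poly_val (\<lambda>i. c (Suc i)) n x \<oplus> poly_val (\<lambda>i. d (Suc i)) n x"
    by (rule Suc.IH) (simp_all add: Suc.prems)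
  have cl: "c 0 \<in> carrier R" "d 0 \<in> carrier R" "poly_val (\<lambda>i. c (Suc i)) n x \<in> carrier R"
      "poly_val (\<lambda>i. d (Suc i)) n x \<in> carrier R"
    using Suc.prems x by auto
  have ring: "(c0 \<oplus> d0) \<oplus> x \<otimes> (p \<oplus> q) = (c0 \<oplus> x \<otimes> p) \<oplus> (d0 \<oplus> x \<otimes> q)"
    if "c0 \<in> carrier R" "d0 \<in> carrier R" "p \<in> carrier R" "q \<in> carrier R" for c0 d0 p q
    using that x by algebra
  show ?case unfolding poly_val.simps IH by (rule ring[OF cl])
qed simp

lemma poly_val_smult:
  assumes "\<And>i. c i \<in> carrier R" "a \<in> carrier R" and x: "x \<in> carrier R"
  shows "poly_val (\<lambda>i. a \<otimes> c i) n x = a \<otimes> poly_val c n x"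
  using assms(1)
proof (induction n arbitrary: c)
  case 0 then show ?case using assms by simp
next
  case (Suc n)
  have IH: "poly_val (\<lambda>i. a \<otimes> c (Suc i)) n x = a \<otimes> poly_val (\<lambda>i. c (Suc i)) n x"
    by (rule Suc.IH) (simp_all add: Suc.prems)
  have cl: "c 0 \<in> carrier R" "poly_val (\<lambda>i. c (Suc i)) n x \<in> carrier R"
    using Suc.prems x by auto
  have ring: "a \<otimes> c0 \<oplus> x \<otimes> (a \<otimes> p) = a \<otimes> (c0 \<oplus> x \<otimes> p)"
    if "c0 \<in> carrier R" "p \<in> carrier R" for c0 p
    using that x assms(2) by algebra
  show ?case unfolding poly_val.simps IH by (rule ring[OF cl])
qed

lemma poly_val_Suc_top:
  assumes "\<And>i. c i \<in> carrier R" and x: "x \<in> carrier R"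
  shows "poly_val c (Suc n) x = poly_val c n x \<oplus> c n \<otimes> x [^] n"
  using assms(1)
proof (induction n arbitrary: c)
  case 0 then show ?case using x by simp
next
  case (Suc n)
  have IH: "poly_val (\<lambda>i. c (Suc i)) (Suc n) x
      = poly_val (\<lambda>i. c (Suc i)) n x \<oplus> c (Suc n) \<otimes> x [^] n"
    by (rule Suc.IH) (simp_all add: Suc.prems)
  have cl: "c 0 \<in> carrier R" "poly_val (\<lambda>i. c (Suc i)) n x \<in> carrier R" "c (Suc n) \<in> carrier R"
      "x [^] n \<in> carrier R"
    using Suc.prems x by auto
  have ring: "c0 \<oplus> x \<otimes> (p \<oplus> cn \<otimes> y) = (c0 \<oplus> x \<otimes> p) \<oplus> cn \<otimes> (y \<otimes> x)"
    if "c0 \<in> carrier R" "p \<in> carrier R" "cn \<in> carrier R" "y \<in> carrier R" for c0 p cn y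
    using that x by algebra
  have "poly_val c (Suc (Suc n)) x = c 0 \<oplus> x \<otimes> poly_val (\<lambda>i. c (Suc i)) (Suc n) x"
    by simp
  also have "\<dots> = (c 0 \<oplus> x \<otimes> poly_val (\<lambda>i. c (Suc i)) n x) \<oplus> c (Suc n) \<otimes> (x [^] n \<otimes> x)"
    unfolding IH by (rule ring[OF cl])
  finally show ?case by simp
qed

lemma poly_val_extend:
  assumes "n \<le> m" "\<And>i. c i \<in> carrier R" "x \<in> carrier R"
    and "\<And>i. \<lbrakk>n \<le> i; i < m\<rbrakk> \<Longrightarrow> c i = \<zero>"
  shows "poly_val c m x = poly_val c n x"
  using assms(1,4)
proof (induction m rule: dec_induct)
  case (step m)
  have "poly_val c (Suc m) x = poly_val c m x \<oplus> c m \<otimes> x [^] m"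
    using assms by (intro poly_val_Suc_top) auto
  also have "\<dots> = poly_val c m x" using step assms by simp
  finally show ?case using step by simp
qed simp

definition trunc :: "nat \<Rightarrow> (nat \<Rightarrow> 'a) \<Rightarrow> nat \<Rightarrow> 'a"
  where "trunc n c i = (if i < n then c i else \<zero>)"

lemma poly_val_trunc:
  assumes "n \<le> m" "\<And>i. c i \<in> carrier R" "x \<in> carrier R"
  shows "poly_val (trunc n c) m x = poly_val c n x"
proof -
  have "poly_val (trunc n c) m x = poly_val (trunc n c) n x"
    using assms by (intro poly_val_extend) (auto simp: trunc_def)
  also have "\<dots> = poly_val c n x" by (rule poly_val_cong) (simp add: trunc_def)
  finally show ?thesis .
qed

lemma poly_val_shift:
  assumes "\<And>i. c i \<in> carrier R" and x: "x \<in> carrier R"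
  shows "poly_val (\<lambda>i. if i < m then \<zero> else c (i - m)) (m + n) x = x [^] m \<otimes> poly_val c n x"
proof (induction m)
  case 0 then show ?case using assms by simp
next
  case (Suc m)
  have "poly_val (\<lambda>i. if i < Suc m then \<zero> else c (i - Suc m)) (Suc m + n) x
      = \<zero> \<oplus> x \<otimes> poly_val (\<lambda>i. if i < m then \<zero> else c (i - m)) (m + n) x"
    by (simp only: add_Suc poly_val.simps Suc_less_eq diff_Suc_Suc zero_less_Suc if_True)
  also have "\<dots> = x \<otimes> (x [^] m \<otimes> poly_val c n x)" unfolding Suc using assms by simp
  also have "\<dots> = x [^] Suc m \<otimes> poly_val c n x"
    using assms poly_val_closed[of c x n] by (simp add: m_ac)
  finally show ?case .
qed

lemma poly_val_in_subring:
  assumes "subring A R" "\<And>i. c i \<in> A" "x \<in> A" shows "poly_val c n x \<in> A"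
  using assms(2) by (induction n arbitrary: c) (auto intro!: subringE[OF assms(1)] assms(3))

lemma pow_in_subring:
  assumes "subring A R" "x \<in> A" shows "x [^] (n::nat) \<in> A"
  by (induction n) (auto intro!: subringE[OF assms(1)] assms(2))

lemma minus_in_subring:
  assumes "subring A R" "x \<in> A" "y \<in> A" shows "x \<ominus> y \<in> A"
  using assms by (simp add: a_minus_def subringE)

lemma poly_val_in_ideal:
  assumes "ideal Q R" "\<And>i. i < n \<Longrightarrow> c i \<in> Q" "x \<in> carrier R" shows "poly_val c n x \<in> Q"
proof -
  interpret Q: ideal Q R by (rule assms(1))
  show ?thesis using assms(2)
  proof (induction n arbitrary: c)
    case 0 then show ?case by (simp add: Q.zero_closed)
  next
    case (Suc n)
    have "poly_val (\<lambda>i. c (Suc i)) n x \<in> Q" by (rule Suc.IH) (simp add: Suc.prems)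
    then show ?case using Suc.prems[of 0] by (auto intro!: Q.a_closed Q.I_l_closed assms(3))
  qed
qed

lemma adjoinI: "(\<And>i. c i \<in> A) \<Longrightarrow> poly_val c n x \<in> adjoin A x"
  unfolding adjoin_def by auto

lemma adjoinE:
  assumes "y \<in> adjoin A x" obtains c n where "\<And>i. c i \<in> A" "y = poly_val c n x"
  using assms unfolding adjoin_def by auto

lemma mono_adjoin: "A \<subseteq> A' \<Longrightarrow> adjoin A x \<subseteq> adjoin A' x"
  unfolding adjoin_def by blast

lemma adjoin_carrier: "\<lbrakk>A \<subseteq> carrier R; x \<in> carrier R\<rbrakk> \<Longrightarrow> adjoin A x \<subseteq> carrier R"
  by (auto simp: adjoin_def)

context
  fixes A B x
  assumes A: "A \<subseteq> carrier R" and B: "B \<subseteq> carrier R" "\<zero> \<in> B"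
    and B_add: "\<And>a b. \<lbrakk>a \<in> B; b \<in> B\<rbrakk> \<Longrightarrow> a \<oplus> b \<in> B"
    and AB: "\<And>a b. \<lbrakk>a \<in> A; b \<in> B\<rbrakk> \<Longrightarrow> a \<otimes> b \<in> B"
    and x: "x \<in> carrier R"
begin

private lemma inR: "a \<in> A \<Longrightarrow> a \<in> carrier R" "b \<in> B \<Longrightarrow> b \<in> carrier R"
  using A B by auto

lemma adjoin_base: "B \<subseteq> adjoin B x"
proof
  fix a assume "a \<in> B"
  then have "poly_val (\<lambda>_. a) 1 x \<in> adjoin B x" by (intro adjoinI)
  then show "a \<in> adjoin B x" using \<open>a \<in> B\<close> inR x by simp
qed

lemma adjoin_add:
  assumes "y \<in> adjoin B x" "z \<in> adjoin B x" shows "y \<oplus> z \<in> adjoin B x"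
proof -
  obtain c n d m where c: "\<And>i. c i \<in> B" "y = poly_val c n x" and d: "\<And>i. d i \<in> B" "z = poly_val d m x"
    using assms by (metis adjoinE)
  let ?N = "max n m"
  have t: "trunc k c i \<in> B" "trunc k d i \<in> B" for k i
    using c d B by (auto simp: trunc_def)
  have "y = poly_val (trunc n c) ?N x" "z = poly_val (trunc m d) ?N x"
    using c d inR x by (simp_all add: poly_val_trunc)
  then have "y \<oplus> z = poly_val (\<lambda>i. trunc n c i \<oplus> trunc m d i) ?N x"
    using t inR x by (simp add: poly_val_add)
  then show ?thesis using t B_add by (auto intro: adjoinI)
qed

lemma adjoin_smult:
  assumes "a \<in> A" "y \<in> adjoin B x" shows "a \<otimes> y \<in> adjoin B x"
proof -
  obtain c n where c: "\<And>i. c i \<in> B" "y = poly_val c n x" using assms by (metis adjoinE)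
  have "a \<otimes> y = poly_val (\<lambda>i. a \<otimes> c i) n x" using c inR x assms(1) by (simp add: poly_val_smult)
  then show ?thesis using c assms(1) AB by (auto intro: adjoinI)
qed

lemma adjoin_shift:
  assumes "y \<in> adjoin B x" shows "x \<otimes> y \<in> adjoin B x"
proof -
  obtain c n where c: "\<And>i. c i \<in> B" "y = poly_val c n x" using assms by (metis adjoinE)
  have "poly_val (case_nat \<zero> c) (Suc n) x \<in> adjoin B x"
    using c B by (intro adjoinI) (auto split: nat.split)
  then show ?thesis using c inR x by simp
qed

lemma adjoin_mult:
  assumes "y \<in> adjoin A x" "z \<in> adjoin B x" shows "y \<otimes> z \<in> adjoin B x"
proof -
  obtain c n where c: "\<And>i. c i \<in> A" and y: "y = poly_val c n x" using assms by (metis adjoinE)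
  have z: "z \<in> carrier R" using assms adjoin_carrier[OF B(1) x] by auto
  have "poly_val c n x \<otimes> z \<in> adjoin B x" using c
  proof (induction n arbitrary: c)
    case 0
    then show ?case using z adjoin_base B by auto
  next
    case (Suc n)
    let ?r = "poly_val (\<lambda>i. c (Suc i)) n x"
    have "?r \<otimes> z \<in> adjoin B x" by (rule Suc.IH) (rule Suc.prems)
    then have "c 0 \<otimes> z \<oplus> x \<otimes> (?r \<otimes> z) \<in> adjoin B x"
      by (intro adjoin_add adjoin_smult[OF Suc.prems] adjoin_shift assms(2))
    moreover have "c 0 \<in> carrier R" "?r \<in> carrier R"
      using Suc.prems inR x by (auto intro: poly_val_closed)
    ultimately show ?case using x z by (simp add: l_distr m_assoc)
  qed
  then show ?thesis using y by simp
qed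

end

context
  fixes A x assumes A: "subring A R" and x: "x \<in> carrier R"
begin

private lemma AR: "A \<subseteq> carrier R" "\<zero> \<in> A" "\<one> \<in> A"
  using subringE[OF A] by auto

lemma subring_adjoin_base: "A \<subseteq> adjoin A x"
  by (rule adjoin_base) (use AR x subringE(6,7)[OF A] in auto)

lemma adjoin_gen: "x \<in> adjoin A x"
proof -
  have "poly_val (\<lambda>i. if i = 1 then \<one> else \<zero>) 2 x \<in> adjoin A x"
    using AR by (intro adjoinI) auto
  then show ?thesis using x by (simp add: numeral_2_eq_2)
qed

lemma adjoin_subring: "subring (adjoin A x) R"
proof (rule subringI)
  have closed: "\<lbrakk>y \<in> adjoin A x; z \<in> adjoin A x\<rbrakk> \<Longrightarrow> y \<oplus> z \<in> adjoin A x"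
      "\<lbrakk>y \<in> adjoin A x; z \<in> adjoin A x\<rbrakk> \<Longrightarrow> y \<otimes> z \<in> adjoin A x" for y z
    by (rule adjoin_add[of A] adjoin_mult[of A]; use AR subringE(6,7)[OF A] x in simp)+
  show carr: "adjoin A x \<subseteq> carrier R" by (rule adjoin_carrier[OF AR(1) x])
  show "\<one> \<in> adjoin A x" using subring_adjoin_base AR by auto
  fix y assume y: "y \<in> adjoin A x"
  have "\<ominus> \<one> \<in> adjoin A x" using subringE(5)[OF A] AR subring_adjoin_base by auto
  then have "(\<ominus> \<one>) \<otimes> y \<in> adjoin A x" using y by (rule closed)
  then show "\<ominus> y \<in> adjoin A x" using y carr by (auto simp: l_minus)
  fix z assume z: "z \<in> adjoin A x"
  show "y \<oplus> z \<in> adjoin A x" "y \<otimes> z \<in> adjoin A x" by (rule closed[OF y z])+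
qed

end

lemma adjoin_least:
  assumes "subring E R" "A \<subseteq> E" "x \<in> E" shows "adjoin A x \<subseteq> E"
  using assms by (auto simp: adjoin_def intro!: poly_val_in_subring)

lemma adjoins_simps [simp]:
  "adjoins A [] = A" "adjoins A (x # xs) = adjoins (adjoin A x) xs"
  "adjoins A (xs @ ys) = adjoins (adjoins A xs) ys"
  by (simp_all add: adjoins_def)

lemma mono_adjoins: "A \<subseteq> A' \<Longrightarrow> adjoins A xs \<subseteq> adjoins A' xs"
  by (induction xs arbitrary: A A') (auto dest: mono_adjoin)

lemma adjoins_subring:
  assumes "subring A R" "set xs \<subseteq> carrier R"
  shows "subring (adjoins A xs) R" and "A \<subseteq> adjoins A xs"
  using assms
proof (induction xs arbitrary: A)
  case (Cons x xs)
  { case 1 then show ?case using Cons(1)[of "adjoin A x"] adjoin_subring by auto }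
  { case 2 then show ?case using Cons(2)[of "adjoin A x"] adjoin_subring subring_adjoin_base[of A x] by auto }
qed auto

lemma adjoins_gens:
  assumes "subring A R" "set xs \<subseteq> carrier R" shows "set xs \<subseteq> adjoins A xs"
  using assms
proof (induction xs arbitrary: A)
  case (Cons x xs)
  have s: "subring (adjoin A x) R" using Cons.prems adjoin_subring by auto
  show ?case using Cons.IH[OF s] adjoins_subring(2)[OF s, of xs] adjoin_gen[of A x] Cons.prems
    by auto
qed simp

lemma adjoins_least:
  assumes "subring E R" "A \<subseteq> E" "set xs \<subseteq> E" shows "adjoins A xs \<subseteq> E"
  using assms(2,3)
proof (induction xs arbitrary: A)
  case (Cons x xs)
  show ?case using Cons.IH[of "adjoin A x"] adjoin_least[OF assms(1) Cons.prems(1), of x] Cons.prems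
    by auto
qed simp

lemma transc_modD:
  "\<lbrakk>transc_mod Q A x; poly_val c n x \<in> Q; \<And>i. c i \<in> A; i < n\<rbrakk> \<Longrightarrow> c i \<in> Q"
  unfolding transc_mod_def by blast

lemma transc_modI:
  "(\<And>c n. \<lbrakk>\<And>i. c i \<in> A; poly_val c n x \<in> Q\<rbrakk> \<Longrightarrow> \<forall>i<n. c i \<in> Q) \<Longrightarrow> transc_mod Q A x"
  unfolding transc_mod_def by blast

lemma transc_mod_antimono: "\<lbrakk>transc_mod Q A' x; A \<subseteq> A'\<rbrakk> \<Longrightarrow> transc_mod Q A x"
  unfolding transc_mod_def by (meson subsetD)

lemma tower_append:
  "tower Q A (xs @ ys) \<longleftrightarrow> tower Q A xs \<and> tower Q (adjoins A xs) ys"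
  by (induction xs arbitrary: A) auto

lemma tower_carrier: "tower Q A xs \<Longrightarrow> set xs \<subseteq> carrier R"
  by (induction xs arbitrary: A) auto

text \<open>An ideal larger than \<open>Q\<close> that meets \<open>A[x]\<close> only in \<open>Q\<close> sees the same relations of \<open>x\<close>.\<close>
lemma transc_mod_change:
  assumes "transc_mod Q A x" "subring A R" "x \<in> carrier R" "Q \<subseteq> P" "P \<inter> adjoin A x \<subseteq> Q"
  shows "transc_mod P A x"
proof (rule transc_modI)
  fix c n assume c: "\<And>i. c i \<in> A" "poly_val c n x \<in> P"
  then have "poly_val c n x \<in> Q" using assms(5) adjoinI by blast
  then have "c i \<in> Q" if "i < n" for i
    by (rule transc_modD[where c = c, OF assms(1) _ c(1) that])
  then show "\<forall>i<n. c i \<in> P" using assms(4) by blast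
qed

lemma tower_change:
  assumes "tower Q A xs" "subring A R" "Q \<subseteq> P" "P \<inter> adjoins A xs \<subseteq> Q"
  shows "tower P A xs"
  using assms(1,2,4)
proof (induction xs arbitrary: A)
  case (Cons x xs)
  have x: "x \<in> carrier R" "set xs \<subseteq> carrier R" using Cons.prems tower_carrier[of Q _ xs] by auto
  have s: "subring (adjoin A x) R" using Cons.prems x adjoin_subring by auto
  have "P \<inter> adjoin A x \<subseteq> Q" using adjoins_subring(2)[OF s x(2)] Cons.prems by auto
  then show ?case
    using Cons.prems Cons.IH[OF _ s] transc_mod_change[of Q A x P] x assms(3) by auto
qed simp

lemma add_minus_cancel: "\<lbrakk>a \<in> carrier R; b \<in> carrier R\<rbrakk> \<Longrightarrow> (a \<oplus> b) \<ominus> b = a"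
  by algebra

lemma horner_step:
  "\<lbrakk>c0 \<in> carrier R; v \<in> carrier R; a \<in> carrier R; p \<in> carrier R; x \<in> carrier R\<rbrakk> \<Longrightarrow>
    c0 \<oplus> x \<otimes> ((x \<ominus> a) \<otimes> p \<oplus> v) = (x \<ominus> a) \<otimes> (v \<oplus> x \<otimes> p) \<oplus> (c0 \<oplus> a \<otimes> v)"
  by algebra

text \<open>Horner's scheme; the quotient does not depend on the point \<open>x\<close>. Coefficients of positive index are
combinations of those of the quotient, hence the last clause.\<close>
lemma synthetic_division:
  assumes "subring A R" "a \<in> A" "\<forall>i. c i \<in> A"
  shows "\<exists>d. (\<forall>i. d i \<in> A) \<and>
      (\<forall>x \<in> carrier R. poly_val c (Suc n) x = (x \<ominus> a) \<otimes> poly_val d n x \<oplus> poly_val c (Suc n) a) \<and>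
      (\<forall>Q. ideal Q R \<longrightarrow> (\<forall>i<n. d i \<in> Q) \<longrightarrow> (\<forall>i. 0 < i \<and> i \<le> n \<longrightarrow> c i \<in> Q))"
proof -
  have inR: "y \<in> A \<Longrightarrow> y \<in> carrier R" for y using subringE(1)[OF assms(1)] by auto
  show ?thesis
    using assms(3)
  proof (induction n arbitrary: c)
    case 0
    then show ?case using inR assms(2) by (intro exI[of _ c]) auto
  next
    case (Suc n)
    let ?c = "\<lambda>i. c (Suc i)"
    let ?v = "poly_val ?c (Suc n) a"
    have "\<forall>i. ?c i \<in> A" using Suc.prems by simp
    from Suc.IH[OF this] obtain d where d: "\<forall>i. d i \<in> A"
      "\<forall>x\<in>carrier R. poly_val ?c (Suc n) x = (x \<ominus> a) \<otimes> poly_val d n x \<oplus> ?v"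
      "\<forall>Q. ideal Q R \<longrightarrow> (\<forall>i<n. d i \<in> Q) \<longrightarrow> (\<forall>i. 0 < i \<and> i \<le> n \<longrightarrow> ?c i \<in> Q)"
      by (elim exE conjE)
    have vA: "?v \<in> A" using Suc.prems assms by (intro poly_val_in_subring) auto
    let ?d = "case_nat ?v d"
    show ?case
    proof (intro exI[of _ ?d] conjI allI ballI impI)
      show "?d i \<in> A" for i using vA d(1) by (auto split: nat.split)
    next
      fix x assume x: "x \<in> carrier R"
      have cl: "c 0 \<in> carrier R" "?v \<in> carrier R" "a \<in> carrier R" "poly_val d n x \<in> carrier R"
        using Suc.prems vA assms(2) inR d(1) x by auto
      have "poly_val c (Suc (Suc n)) x = c 0 \<oplus> x \<otimes> ((x \<ominus> a) \<otimes> poly_val d n x \<oplus> ?v)"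
        unfolding d(2)[rule_format, OF x, symmetric] by simp
      also have "\<dots> = (x \<ominus> a) \<otimes> (?v \<oplus> x \<otimes> poly_val d n x) \<oplus> (c 0 \<oplus> a \<otimes> ?v)"
        by (rule horner_step[OF cl x])
      finally show "poly_val c (Suc (Suc n)) x = (x \<ominus> a) \<otimes> poly_val ?d (Suc n) x \<oplus> poly_val c (Suc (Suc n)) a"
        by simp
    next
      fix Q i assume Q: "ideal Q R" and dQ: "\<forall>i<Suc n. ?d i \<in> Q" and i: "0 < i \<and> i \<le> Suc n"
      interpret Q: ideal Q R by (rule Q)
      have vQ: "?v \<in> Q" using dQ[rule_format, of 0] by simp
      have "d i \<in> Q" if "i < n" for i using dQ[rule_format, of "Suc i"] that by simp
      then have *: "?c i \<in> Q" if "0 < i" "i \<le> n" for i using d(3) Q that by blast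
      show "c i \<in> Q"
      proof (cases "i = 1")
        case True
        have "poly_val (\<lambda>i. ?c (Suc i)) n a \<in> Q"
          using * by (intro poly_val_in_ideal[OF Q]) (auto intro: inR assms(2))
        then have r: "a \<otimes> poly_val (\<lambda>i. ?c (Suc i)) n a \<in> Q"
          using Q.I_l_closed inR assms(2) by auto
        have cl: "c 1 \<in> carrier R" "a \<otimes> poly_val (\<lambda>i. ?c (Suc i)) n a \<in> carrier R"
          using Suc.prems inR assms(2) by (auto intro!: m_closed)
        have "?v \<ominus> a \<otimes> poly_val (\<lambda>i. ?c (Suc i)) n a \<in> Q"
          using vQ r by (simp add: a_minus_def del: poly_val.simps)
        moreover have "?v \<ominus> a \<otimes> poly_val (\<lambda>i. ?c (Suc i)) n a = c 1"
          using add_minus_cancel[OF cl] by simp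
        ultimately show ?thesis using True by simp
      next
        case False
        then show ?thesis using *[of "i - 1"] i by (cases i) auto
      qed
    qed
  qed
qed

end

section \<open>Lying over for primes\<close>

context cring
begin

definition cong_mod :: "'a set \<Rightarrow> 'a \<Rightarrow> 'a \<Rightarrow> bool"
  where "cong_mod Q y z \<longleftrightarrow> y \<in> carrier R \<and> z \<in> carrier R \<and> y \<ominus> z \<in> Q"

context
  fixes Q assumes Q: "ideal Q R"
begin

interpretation Q: ideal Q R by (rule Q)

lemma cong_refl: "y \<in> carrier R \<Longrightarrow> cong_mod Q y y"
  by (simp add: cong_mod_def Q.zero_closed a_minus_def r_neg)

lemma cong_sym: assumes "cong_mod Q y z" shows "cong_mod Q z y"
proof -
  have yz: "y \<in> carrier R" "z \<in> carrier R" "y \<ominus> z \<in> Q" using assms by (auto simp: cong_mod_def)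
  have "z \<ominus> y = \<ominus> (y \<ominus> z)" using yz(1,2) by algebra
  then show ?thesis using yz Q.a_inv_closed by (simp add: cong_mod_def)
qed

lemma cong_trans:
  assumes "cong_mod Q x y" "cong_mod Q y z" shows "cong_mod Q x z"
proof -
  have c: "x \<in> carrier R" "y \<in> carrier R" "z \<in> carrier R" using assms by (auto simp: cong_mod_def)
  have "x \<ominus> z = (x \<ominus> y) \<oplus> (y \<ominus> z)" using c by algebra
  then show ?thesis using assms Q.a_closed by (simp add: cong_mod_def)
qed

lemma cong_add:
  assumes "cong_mod Q x y" "cong_mod Q x' y'" shows "cong_mod Q (x \<oplus> x') (y \<oplus> y')"
proof -
  have c: "x \<in> carrier R" "y \<in> carrier R" "x' \<in> carrier R" "y' \<in> carrier R"
    using assms by (auto simp: cong_mod_def)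
  have "(x \<oplus> x') \<ominus> (y \<oplus> y') = (x \<ominus> y) \<oplus> (x' \<ominus> y')" using c by algebra
  then show ?thesis using assms Q.a_closed by (simp add: cong_mod_def)
qed

lemma cong_mult_left:
  assumes "cong_mod Q x y" "a \<in> carrier R" shows "cong_mod Q (a \<otimes> x) (a \<otimes> y)"
proof -
  have c: "x \<in> carrier R" "y \<in> carrier R" using assms by (auto simp: cong_mod_def)
  have "(a \<otimes> x) \<ominus> (a \<otimes> y) = a \<otimes> (x \<ominus> y)" using c assms(2) by algebra
  then show ?thesis using assms Q.I_l_closed by (simp add: cong_mod_def)
qed

lemma cong_mem: assumes "cong_mod Q x y" shows "x \<in> Q \<longleftrightarrow> y \<in> Q"
proof -
  have c: "x \<in> carrier R" "y \<in> carrier R" "x \<ominus> y \<in> Q" using assms by (auto simp: cong_mod_def)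
  have "x = (x \<ominus> y) \<oplus> y" "y = \<ominus> (x \<ominus> y) \<oplus> x" using c(1,2) by algebra+
  then show ?thesis using c(3) Q.a_closed Q.a_inv_closed by metis
qed

lemma cong_zeroD: "cong_mod Q x \<zero> \<Longrightarrow> x \<in> Q"
  using cong_mem Q.zero_closed by blast

lemma cong_zeroI: "x \<in> Q \<Longrightarrow> cong_mod Q x \<zero>"
  using Q.Icarr by (simp add: cong_mod_def a_minus_def)

end

lemma sub_cring: "subring A R \<Longrightarrow> cring (R\<lparr>carrier := A\<rparr>)"
  using subcring_iff[OF subringE(1)] subcringI'[of A] by auto

lemma a_inv_as_mult: "a \<in> carrier R \<Longrightarrow> (\<ominus> \<one>) \<otimes> a = \<ominus> a"
  by (simp add: l_minus)

lemma sub_idealI: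
  assumes A: "subring A R" and I: "I \<subseteq> A" "\<zero> \<in> I"
    and add: "\<And>a b. \<lbrakk>a \<in> I; b \<in> I\<rbrakk> \<Longrightarrow> a \<oplus> b \<in> I"
    and mult: "\<And>a b. \<lbrakk>a \<in> A; b \<in> I\<rbrakk> \<Longrightarrow> a \<otimes> b \<in> I"
  shows "ideal I (R\<lparr>carrier := A\<rparr>)"
proof -
  let ?S = "R\<lparr>carrier := A\<rparr>"
  interpret S: cring ?S by (rule sub_cring[OF A])
  show ?thesis
  proof (rule idealI)
    show "ring ?S" by (rule S.ring_axioms)
    show "subgroup I (add_monoid ?S)"
    proof (rule S.add.subgroupI)
      fix a assume a: "a \<in> I"
      have "\<ominus>\<^bsub>?S\<^esub> \<one>\<^bsub>?S\<^esub> \<in> A" using S.a_inv_closed[OF S.one_closed] by simp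
      then have "(\<ominus>\<^bsub>?S\<^esub> \<one>\<^bsub>?S\<^esub>) \<otimes> a \<in> I" using mult a by blast
      moreover have "(\<ominus>\<^bsub>?S\<^esub> \<one>\<^bsub>?S\<^esub>) \<otimes>\<^bsub>?S\<^esub> a = \<ominus>\<^bsub>?S\<^esub> a" using a I by (intro S.a_inv_as_mult) auto
      ultimately show "\<ominus>\<^bsub>?S\<^esub> a \<in> I" by simp
    qed (use I add in auto)
    fix a x assume ax: "a \<in> I" "x \<in> carrier ?S"
    show "x \<otimes>\<^bsub>?S\<^esub> a \<in> I" using mult ax by simp
    then show "a \<otimes>\<^bsub>?S\<^esub> x \<in> I" using S.m_comm[of a x] ax I by auto
  qed
qed

lemma sub_idealD:
  assumes A: "subring A R" and p: "ideal p (R\<lparr>carrier := A\<rparr>)"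
  shows "p \<subseteq> A" "\<zero> \<in> p" "\<And>a b. \<lbrakk>a \<in> p; b \<in> p\<rbrakk> \<Longrightarrow> a \<oplus> b \<in> p"
    "\<And>a b. \<lbrakk>a \<in> A; b \<in> p\<rbrakk> \<Longrightarrow> a \<otimes> b \<in> p" "\<And>a b. \<lbrakk>a \<in> p; b \<in> A\<rbrakk> \<Longrightarrow> a \<otimes> b \<in> p"
    "\<And>a. a \<in> p \<Longrightarrow> \<ominus> a \<in> p"
proof -
  interpret p: ideal p "R\<lparr>carrier := A\<rparr>" by (rule p)
  show pA: "p \<subseteq> A" using p.a_subset by simp
  show "\<zero> \<in> p" using additive_subgroup.zero_closed[OF ideal.axioms(1)[OF p]] by simp
  show "\<And>a b. \<lbrakk>a \<in> p; b \<in> p\<rbrakk> \<Longrightarrow> a \<oplus> b \<in> p" using additive_subgroup.a_closed[OF ideal.axioms(1)[OF p]] by simp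
  show *: "\<And>a b. \<lbrakk>a \<in> A; b \<in> p\<rbrakk> \<Longrightarrow> a \<otimes> b \<in> p" using p.I_l_closed by simp
  show "\<And>a b. \<lbrakk>a \<in> p; b \<in> A\<rbrakk> \<Longrightarrow> a \<otimes> b \<in> p" using p.I_r_closed by simp
  show "\<ominus> a \<in> p" if "a \<in> p" for a
  proof -
    have "(\<ominus> \<one>) \<otimes> a \<in> p" by (rule *[OF subringE(5)[OF A subringE(3)[OF A]] that])
    moreover have "a \<in> carrier R" using that pA subringE(1)[OF A] by blast
    ultimately show ?thesis using a_inv_as_mult by simp
  qed
qed

lemma sub_primeidealD:
  assumes A: "subring A R" and p: "primeideal p (R\<lparr>carrier := A\<rparr>)"
  shows "ideal p (R\<lparr>carrier := A\<rparr>)" "\<one> \<notin> p"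
    "\<And>a b. \<lbrakk>a \<in> A; b \<in> A; a \<otimes> b \<in> p\<rbrakk> \<Longrightarrow> a \<in> p \<or> b \<in> p"
proof -
  interpret p: primeideal p "R\<lparr>carrier := A\<rparr>" by (rule p)
  show "ideal p (R\<lparr>carrier := A\<rparr>)" by (rule p.ideal_axioms)
  show "\<one> \<notin> p" using p.one_imp_carrier p.I_notcarr by auto
  show "\<And>a b. \<lbrakk>a \<in> A; b \<in> A; a \<otimes> b \<in> p\<rbrakk> \<Longrightarrow> a \<in> p \<or> b \<in> p" using p.I_prime by simp
qed

text \<open>An ideal maximal among those that contain \<open>I\<close> and avoid \<open>T\<close> is prime: if neither \<open>a\<close> nor \<open>b\<close> lies in
it, adding either produces an element of \<open>T\<close>, and the product of the two shows that \<open>a b\<close> is outside.\<close>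
lemma prime_avoiding:
  assumes I: "ideal I R" and T: "T \<subseteq> carrier R" "\<one> \<in> T" "\<And>a b. \<lbrakk>a \<in> T; b \<in> T\<rbrakk> \<Longrightarrow> a \<otimes> b \<in> T"
    and disj: "I \<inter> T = {}"
  shows "\<exists>P. primeideal P R \<and> I \<subseteq> P \<and> P \<inter> T = {}"
proof -
  let ?S = "{J. ideal J R \<and> I \<subseteq> J \<and> J \<inter> T = {}}"
  have "\<exists>M\<in>(?S). \<forall>J\<in>(?S). M \<subseteq> J \<longrightarrow> J = M"
  proof (rule subset_Zorn)
    fix C assume C: "subset.chain ?S C"
    show "\<exists>U\<in>(?S). \<forall>J\<in>C. J \<subseteq> U"
    proof (cases "C = {}")
      case True
      then show ?thesis using I disj by auto
    next
      case False
      have "subset.chain {J. ideal J R} C" using C by (auto simp: pred_on.chain_def)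
      then have "ideal (\<Union>C) R" using chain_Union_is_ideal[of C] False by simp
      moreover have "I \<subseteq> \<Union>C" "\<Union>C \<inter> T = {}" using C False by (fastforce simp: pred_on.chain_def)+
      ultimately show ?thesis by (intro bexI[of _ "\<Union>C"]) auto
    qed
  qed
  then obtain M where M: "ideal M R" "I \<subseteq> M" "M \<inter> T = {}"
    and max: "\<And>J. \<lbrakk>ideal J R; J \<inter> T = {}; M \<subseteq> J\<rbrakk> \<Longrightarrow> J = M"
    by (smt (verit) mem_Collect_eq subset_trans)
  interpret M: ideal M R by (rule M)
  have meet: "\<exists>m\<in>M. \<exists>r\<in>carrier R. m \<oplus> r \<otimes> a \<in> T" if a: "a \<in> carrier R" "a \<notin> M" for a
  proof (rule ccontr)
    assume no: "\<not> ?thesis"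
    let ?MA = "M <+>\<^bsub>R\<^esub> (PIdl a)"
    have MA: "?MA = {m \<oplus> r \<otimes> a | m r. m \<in> M \<and> r \<in> carrier R}"
      by (auto simp: set_add_def' cgenideal_def)
    have "ideal ?MA R" using add_ideals[OF M(1) cgenideal_ideal[OF a(1)]] .
    moreover have "?MA \<inter> T = {}" using no MA by auto
    moreover have "m \<in> ?MA" if "m \<in> M" for m
    proof -
      have "m \<oplus> \<zero> \<otimes> a \<in> ?MA" unfolding MA using that by blast
      then show ?thesis using a(1) M.Icarr[OF that] by simp
    qed
    ultimately have "?MA = M" using max by blast
    moreover have "\<zero> \<oplus> \<one> \<otimes> a \<in> ?MA" unfolding MA using M.zero_closed by blast
    ultimately show False using a by simp
  qed
  have "primeideal M R"
  proof (rule primeidealI[OF M(1) is_cring])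
    show "carrier R \<noteq> M" using M(3) T by auto
    fix a b assume ab: "a \<in> carrier R" "b \<in> carrier R" "a \<otimes> b \<in> M"
    show "a \<in> M \<or> b \<in> M"
    proof (rule ccontr)
      assume "\<not> ?thesis"
      then obtain m r n s where mr: "m \<in> M" "r \<in> carrier R" "m \<oplus> r \<otimes> a \<in> T"
        and ns: "n \<in> M" "s \<in> carrier R" "n \<oplus> s \<otimes> b \<in> T"
        using meet ab by metis
      have cl: "m \<in> carrier R" "n \<in> carrier R" using M.Icarr mr ns by auto
      have "(m \<oplus> r \<otimes> a) \<otimes> (n \<oplus> s \<otimes> b)
          = m \<otimes> (n \<oplus> s \<otimes> b) \<oplus> ((r \<otimes> a) \<otimes> n \<oplus> (r \<otimes> s) \<otimes> (a \<otimes> b))"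
        using cl ab(1,2) mr(2) ns(2) by algebra
      also have "\<dots> \<in> M"
        using ab cl mr(1,2) ns(1,2)
        by (intro M.a_closed M.I_r_closed[OF mr(1)] M.I_l_closed[OF ns(1)] M.I_l_closed[OF ab(3)]) auto
      finally show False using T(3)[OF mr(3) ns(3)] M(3) by auto
    qed
  qed
  then show ?thesis using M by auto
qed

text \<open>Lying over for one new element \<open>x\<close> that satisfies, modulo \<open>Q\<close>, an equation with coefficients in \<open>A\<close>
whose leading coefficient is outside the prime \<open>p\<close>. Such an equation makes \<open>A[x]\<close> integral over \<open>A\<close>
after localizing at \<open>p\<close>. The localization is replaced by multipliers in \<open>A - p\<close>, and the
determinant trick by elimination.\<close>
context
  fixes Q A p x f d
  assumes Q: "ideal Q R" and A: "subring A R" and p: "primeideal p (R\<lparr>carrier := A\<rparr>)"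
    and QA: "Q \<inter> A \<subseteq> p" and x: "x \<in> carrier R"
    and f: "\<And>i. f i \<in> A" "poly_val f (Suc d) x \<in> Q" "f d \<notin> p"
begin

private lemma pI: "ideal p (R\<lparr>carrier := A\<rparr>)" and p1: "\<one> \<notin> p"
  and pprime: "\<And>a b. \<lbrakk>a \<in> A; b \<in> A; a \<otimes> b \<in> p\<rbrakk> \<Longrightarrow> a \<in> p \<or> b \<in> p"
  using sub_primeidealD[OF A p] by auto

private lemmas pD = sub_idealD[OF A pI]

private lemma in_carrier: "a \<in> A \<Longrightarrow> a \<in> carrier R" "a \<in> p \<Longrightarrow> a \<in> carrier R" "a \<in> p \<Longrightarrow> a \<in> A"
  using subringE(1)[OF A] pD(1) by auto

text \<open>Division by \<open>f\<close> with a multiplier in place of a monic leading coefficient; the coefficients stay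
in \<open>p\<close>.\<close>
private lemma reduce_degree:
  "(\<And>i. g i \<in> p) \<Longrightarrow> \<exists>s h. s \<in> A - p \<and> (\<forall>i. h i \<in> p) \<and> cong_mod Q (s \<otimes> poly_val g n x) (poly_val h d x)"
proof (induction n arbitrary: g)
  case 0
  have "cong_mod Q (\<one> \<otimes> poly_val g 0 x) (poly_val (\<lambda>_. \<zero>) d x)"
    using x cong_refl[OF Q] by simp
  then show ?case using p1 subringE(3)[OF A] pD(2) by (intro exI[of _ \<one>] exI[of _ "\<lambda>_. \<zero>"]) simp
next
  case (Suc m)
  show ?case
  proof (cases "Suc m \<le> d")
    case True
    have "poly_val (trunc (Suc m) g) d x = poly_val g (Suc m) x"
      using True Suc.prems in_carrier x by (intro poly_val_trunc) auto
    moreover have "poly_val g (Suc m) x \<in> carrier R" using Suc.prems in_carrier x by (intro poly_val_closed) auto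
    ultimately have "cong_mod Q (\<one> \<otimes> poly_val g (Suc m) x) (poly_val (trunc (Suc m) g) d x)"
      using cong_refl[OF Q] by (simp del: poly_val.simps)
    moreover have "trunc (Suc m) g i \<in> p" for i using Suc.prems pD(2) by (simp add: trunc_def)
    ultimately show ?thesis using p1 subringE(3)[OF A]
      by (intro exI[of _ \<one>] exI[of _ "trunc (Suc m) g"]) simp
  next
    case False
    \<comment> \<open>the polynomial \<open>X^(m - d) f\<close>, which vanishes modulo \<open>Q\<close> and has the same degree as \<open>g\<close>\<close>
    define F where "F i = (if i < m - d then \<zero> else f (i - (m - d)))" for i
    have FA: "F i \<in> A" for i using f(1) subringE(2)[OF A] by (simp add: F_def)
    have "poly_val F ((m - d) + Suc d) x = x [^] (m - d) \<otimes> poly_val f (Suc d) x"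
      unfolding F_def using f(1) in_carrier x by (intro poly_val_shift) auto
    then have FQ: "poly_val F (Suc m) x \<in> Q"
      using False f(2) x ideal.I_l_closed[OF Q] by (simp del: poly_val.simps)
    define h where "h i = f d \<otimes> g i \<oplus> (\<ominus> g m) \<otimes> F i" for i
    have hp: "h i \<in> p" for i
      unfolding h_def using Suc.prems f(1) FA by (intro pD(3) pD(4) pD(5) pD(6))
    let ?G = "poly_val g (Suc m) x"
    have cl: "?G \<in> carrier R" "poly_val F (Suc m) x \<in> carrier R" "f d \<in> carrier R" "g m \<in> carrier R"
      using Suc.prems FA f(1) in_carrier x by (auto simp del: poly_val.simps)
    have "poly_val h (Suc m) x = f d \<otimes> ?G \<oplus> (\<ominus> g m) \<otimes> poly_val F (Suc m) x"
      unfolding h_def using Suc.prems FA f(1) in_carrier x by (simp add: poly_val_add poly_val_smult del: poly_val.simps)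
    moreover have "cong_mod Q ((\<ominus> g m) \<otimes> poly_val F (Suc m) x) \<zero>"
      using cl FQ ideal.I_l_closed[OF Q] by (intro cong_zeroI[OF Q]) auto
    then have "cong_mod Q (f d \<otimes> ?G \<oplus> (\<ominus> g m) \<otimes> poly_val F (Suc m) x) (f d \<otimes> ?G \<oplus> \<zero>)"
      using cl by (intro cong_add[OF Q] cong_refl[OF Q]) auto
    moreover have "h m = \<zero>"
    proof -
      have "F m = f d" using False by (auto simp: F_def)
      then show ?thesis using cl by (simp add: h_def l_minus m_comm[of "g m"] r_neg del: poly_val.simps)
    qed
    then have "poly_val h (Suc m) x = poly_val h m x"
      using hp in_carrier x by (intro poly_val_extend) (auto simp: less_Suc_eq_le dest: antisym)
    ultimately have hG: "cong_mod Q (poly_val h m x) (f d \<otimes> ?G)" using cl by (simp del: poly_val.simps)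
    obtain s h' where s: "s \<in> A - p" "\<forall>i. h' i \<in> p" "cong_mod Q (s \<otimes> poly_val h m x) (poly_val h' d x)"
      using Suc.IH[of h] hp by blast
    have "cong_mod Q (s \<otimes> (f d \<otimes> ?G)) (poly_val h' d x)"
      using cong_trans[OF Q cong_sym[OF Q cong_mult_left[OF Q hG]] s(3)] s(1) in_carrier by auto
    then have "cong_mod Q ((s \<otimes> f d) \<otimes> ?G) (poly_val h' d x)"
      using cl s(1) in_carrier by (simp add: m_assoc del: poly_val.simps)
    moreover have "s \<otimes> f d \<in> A - p"
      using s(1) f(1,3) pprime[of s "f d"] subringE(6)[OF A] by auto
    ultimately show ?thesis using s(2) by (intro exI[of _ "s \<otimes> f d"] exI[of _ h']) simp
  qed
qed

text \<open>Modulo \<open>p\<close> the system reads \<open>v i * x^i = 0\<close>, which is absurd for \<open>i = 0\<close>. The unknown \<open>x^(r - 1)\<close> is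
eliminated with the last row, whose diagonal entry \<open>v (r - 1) - G (r - 1) (r - 1)\<close> is outside \<open>p\<close>.\<close>
private lemma no_singular_system:
  assumes "0 < r" "\<And>i. v i \<in> A - p" "\<And>i j. G i j \<in> p"
    and "\<And>i. i < r \<Longrightarrow> cong_mod Q (v i \<otimes> x [^] i) (poly_val (G i) r x)"
  shows False
  using assms
proof (induction r arbitrary: v G)
  case (Suc q)
  have vR: "v i \<in> carrier R" "v i \<in> A" "v i \<notin> p" and GR: "G i j \<in> carrier R" "G i j \<in> A" for i j
    using Suc.prems(2)[of i] Suc.prems(3)[of i j] in_carrier by auto
  have GG: "poly_val (G i) (Suc q) x = poly_val (G i) q x \<oplus> G i q \<otimes> x [^] q" for i
    using GR x by (intro poly_val_Suc_top) auto
  define w where "w = v q \<ominus> G q q"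
  have vw: "v q = w \<oplus> G q q" unfolding w_def using vR(1) GR(1) by algebra
  have w: "w \<in> A" "w \<notin> p" "w \<in> carrier R"
  proof -
    show "w \<in> A" unfolding w_def using vR GR by (intro minus_in_subring[OF A])
    then show "w \<in> carrier R" using in_carrier by simp
    show "w \<notin> p" using vw pD(3)[OF _ Suc.prems(3)[of q q]] vR(3)[of q] by auto
  qed
  have P: "poly_val (G i) q x \<in> carrier R" for i using GR x by auto
  \<comment> \<open>the last row, solved for \<open>x^q\<close>\<close>
  have row: "cong_mod Q (w \<otimes> x [^] q) (poly_val (G q) q x)"
  proof -
    have "cong_mod Q (v q \<otimes> x [^] q \<oplus> (\<ominus> (G q q \<otimes> x [^] q)))
        ((poly_val (G q) q x \<oplus> G q q \<otimes> x [^] q) \<oplus> (\<ominus> (G q q \<otimes> x [^] q)))"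
      using Suc.prems(4)[of q] GR x unfolding GG by (intro cong_add[OF Q] cong_refl[OF Q]) auto
    moreover have "(a \<otimes> y) \<oplus> (\<ominus> (b \<otimes> y)) = (a \<ominus> b) \<otimes> y" "(c \<oplus> b \<otimes> y) \<oplus> (\<ominus> (b \<otimes> y)) = c"
      if "a \<in> carrier R" "b \<in> carrier R" "c \<in> carrier R" "y \<in> carrier R" for a b c y
      using that by algebra+
    ultimately show ?thesis using vR GR x P by (simp add: w_def)
  qed
  show False
  proof (cases "q = 0")
    case True
    have "cong_mod Q w \<zero>" using row True w x by simp
    then show False using cong_zeroD[OF Q] w QA by blast
  next
    case False
    let ?v = "\<lambda>i. w \<otimes> v i" and ?G = "\<lambda>i j. w \<otimes> G i j \<oplus> G i q \<otimes> G q j"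
    show False
    proof (rule Suc.IH[of ?v ?G])
      show "0 < q" using False by simp
      show "?v i \<in> A - p" for i using w vR(2,3)[of i] pprime[of w "v i"] subringE(6)[OF A] by auto
      show "?G i j \<in> p" for i j using w GR(2) Suc.prems(3) by (intro pD(3) pD(4))
      fix i assume i: "i < q"
      have "cong_mod Q (v i \<otimes> x [^] i) (poly_val (G i) q x \<oplus> G i q \<otimes> x [^] q)"
        using Suc.prems(4)[of i] i unfolding GG by simp
      then have "cong_mod Q (w \<otimes> (v i \<otimes> x [^] i)) (w \<otimes> (poly_val (G i) q x \<oplus> G i q \<otimes> x [^] q))"
        using w by (intro cong_mult_left[OF Q])
      moreover have "cong_mod Q (w \<otimes> poly_val (G i) q x \<oplus> G i q \<otimes> (w \<otimes> x [^] q))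
          (w \<otimes> poly_val (G i) q x \<oplus> G i q \<otimes> poly_val (G q) q x)"
        using w P GR row by (intro cong_add[OF Q] cong_refl[OF Q] cong_mult_left[OF Q]) auto
      moreover have "w \<otimes> (a \<oplus> b \<otimes> y) = w \<otimes> a \<oplus> b \<otimes> (w \<otimes> y)"
        if "a \<in> carrier R" "b \<in> carrier R" "y \<in> carrier R" for a b y
        using that w(3) by algebra
      moreover have "poly_val (?G i) q x = w \<otimes> poly_val (G i) q x \<oplus> G i q \<otimes> poly_val (G q) q x"
        using w GR x by (simp add: poly_val_add poly_val_smult)
      ultimately show "cong_mod Q (w \<otimes> v i \<otimes> x [^] i) (poly_val (?G i) q x)"
        using cong_trans[OF Q] w vR GR P x by (simp add: m_assoc)
    qed
  qed
qed simp

text \<open>If \<open>u\<close> were outside \<open>p\<close>, reducing \<open>u x^i\<close> for all \<open>i < d\<close> would give a system that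
\<open>no_singular_system\<close> excludes.\<close>
lemma extension_meets_in_prime:
  assumes u: "u \<in> A" and g: "\<And>i. g i \<in> p" and ug: "cong_mod Q u (poly_val g n x)"
  shows "u \<in> p"
proof (rule ccontr)
  assume "u \<notin> p"
  have "d \<noteq> 0"
  proof
    assume "d = 0"
    then have "f 0 \<in> Q" using f in_carrier x by simp
    then show False using QA f(1,3) \<open>d = 0\<close> by auto
  qed
  have "\<forall>i::nat. \<exists>sh. fst sh \<in> A - p \<and> (\<forall>j. snd sh j \<in> p) \<and>
      cong_mod Q (fst sh \<otimes> (x [^] i \<otimes> poly_val g n x)) (poly_val (snd sh) d x)"
  proof
    fix i :: nat
    define g' where "g' j = (if j < i then \<zero> else g (j - i))" for j
    have "g' j \<in> p" for j using g pD(2) by (simp add: g'_def)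
    moreover have "poly_val g' (i + n) x = x [^] i \<otimes> poly_val g n x"
      unfolding g'_def using g in_carrier x by (intro poly_val_shift) auto
    ultimately show "\<exists>sh. fst sh \<in> A - p \<and> (\<forall>j. snd sh j \<in> p) \<and>
        cong_mod Q (fst sh \<otimes> (x [^] i \<otimes> poly_val g n x)) (poly_val (snd sh) d x)"
      using reduce_degree[of g' "i + n"] by simp
  qed
  from choice[OF this] obtain sh where sh: "\<forall>i::nat. fst (sh i) \<in> A - p \<and> (\<forall>j. snd (sh i) j \<in> p) \<and>
      cong_mod Q (fst (sh i) \<otimes> (x [^] i \<otimes> poly_val g n x)) (poly_val (snd (sh i)) d x)"
    by (elim exE)
  define s h where "s i = fst (sh i)" and "h i = snd (sh i)" for i
  have s: "\<And>i. s i \<in> A - p" and h: "\<And>i j. h i j \<in> p"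
    and c: "\<And>i. cong_mod Q (s i \<otimes> (x [^] i \<otimes> poly_val g n x)) (poly_val (h i) d x)"
    using sh by (simp_all add: s_def h_def)
  have uR: "u \<in> carrier R" and sR: "s i \<in> carrier R" for i using u s[of i] in_carrier by auto
  have "cong_mod Q ((s i \<otimes> u) \<otimes> x [^] i) (poly_val (h i) d x)" for i
  proof -
    have "cong_mod Q ((s i \<otimes> x [^] i) \<otimes> u) ((s i \<otimes> x [^] i) \<otimes> poly_val g n x)"
      using ug sR x by (intro cong_mult_left[OF Q]) auto
    moreover have "poly_val g n x \<in> carrier R" using g in_carrier x by auto
    ultimately show ?thesis using cong_trans[OF Q _ c[of i]] sR uR x by (simp add: m_ac)
  qed
  moreover have "s i \<otimes> u \<in> A - p" for i
    using s[of i] u \<open>u \<notin> p\<close> pprime[of "s i" u] subringE(6)[OF A] by auto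
  ultimately show False using no_singular_system[of d "\<lambda>i. s i \<otimes> u" h] h \<open>d \<noteq> 0\<close> by blast
qed

lemma lying_over:
  "\<exists>P. primeideal P (R\<lparr>carrier := adjoin A x\<rparr>) \<and> P \<inter> A = p \<and> Q \<inter> adjoin A x \<subseteq> P"
proof -
  let ?A = "adjoin A x"
  have S: "subring ?A R" by (rule adjoin_subring[OF A x])
  interpret S: cring "R\<lparr>carrier := ?A\<rparr>" by (rule sub_cring[OF S])
  have AA: "A \<subseteq> ?A" by (rule subring_adjoin_base[OF A x])
  note SR = subringE(1)[OF S]
  have pR: "p \<subseteq> carrier R" using pD(1) subringE(1)[OF A] by auto
  have pA_add: "\<lbrakk>y \<in> adjoin p x; z \<in> adjoin p x\<rbrakk> \<Longrightarrow> y \<oplus> z \<in> adjoin p x"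
    and pA_mult: "\<lbrakk>y \<in> ?A; z \<in> adjoin p x\<rbrakk> \<Longrightarrow> y \<otimes> z \<in> adjoin p x"
    and p_pA: "p \<subseteq> adjoin p x" for y z
    by (rule adjoin_add[of A] adjoin_mult[of A] adjoin_base[of A];
        use subringE(1)[OF A] pR pD x in simp)+
  have pA: "adjoin p x \<subseteq> ?A" by (rule mono_adjoin[OF pD(1)])
  let ?I = "{y \<in> ?A. \<exists>z\<in>adjoin p x. cong_mod Q y z}"
  have I: "ideal ?I (R\<lparr>carrier := ?A\<rparr>)"
  proof (rule sub_idealI[OF S])
    have "cong_mod Q \<zero> \<zero>" by (rule cong_refl[OF Q zero_closed])
    then show "\<zero> \<in> ?I" using subringE(2)[OF S] p_pA pD(2) by auto
  next
    fix a b assume "a \<in> ?I" "b \<in> ?I"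
    then show "a \<oplus> b \<in> ?I"
      using subringE(7)[OF S] pA_add cong_add[OF Q] by (smt (verit) mem_Collect_eq)
  next
    fix a b assume "a \<in> ?A" "b \<in> ?I"
    then show "a \<otimes> b \<in> ?I"
      using subringE(6)[OF S] pA_mult cong_mult_left[OF Q] SR
      by (smt (verit) mem_Collect_eq subsetD)
  qed auto
  have disj: "?I \<inter> (A - p) = {}"
  proof (rule ccontr)
    assume "?I \<inter> (A - p) \<noteq> {}"
    then obtain u z where u: "u \<in> A" "u \<notin> p" "z \<in> adjoin p x" "cong_mod Q u z" by auto
    obtain g n where g: "\<forall>i. g i \<in> p" "z = poly_val g n x" using u(3) unfolding adjoin_def by auto
    show False using extension_meets_in_prime[OF u(1), of g n] u g by simp
  qed
  have "\<exists>P. primeideal P (R\<lparr>carrier := ?A\<rparr>) \<and> ?I \<subseteq> P \<and> P \<inter> (A - p) = {}"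
  proof (rule S.prime_avoiding[OF I])
    show "a \<otimes>\<^bsub>R\<lparr>carrier := ?A\<rparr>\<^esub> b \<in> A - p" if "a \<in> A - p" "b \<in> A - p" for a b
      using that pprime subringE(6)[OF A] by auto
  qed (use AA p1 subringE(3)[OF A] disj in auto)
  then obtain P where P: "primeideal P (R\<lparr>carrier := ?A\<rparr>)" "?I \<subseteq> P" "P \<inter> (A - p) = {}" by blast
  have "y \<in> ?I" if "y \<in> p" for y
  proof -
    have "cong_mod Q y y" "y \<in> ?A" "y \<in> adjoin p x"
      using cong_refl[OF Q] in_carrier(2)[OF that] AA pD(1) p_pA that by auto
    then show ?thesis by blast
  qed
  then have "p \<subseteq> ?I" by blast
  moreover have "y \<in> ?I" if "y \<in> Q" "y \<in> ?A" for y
  proof -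
    have "cong_mod Q y \<zero>" "\<zero> \<in> adjoin p x" using cong_zeroI[OF Q] that p_pA pD(2) by auto
    then show ?thesis using that by blast
  qed
  then have "Q \<inter> ?A \<subseteq> ?I" by blast
  ultimately show ?thesis using P pD(1) by blast
qed

end

text \<open>The equations have coefficients in the bottom ring \<open>A\<close>, so their leading coefficients remain outside
every prime that lies over \<open>p\<close>, and the generators can be adjoined one at a time.\<close>
lemma lying_over_list:
  assumes Q: "ideal Q R" and "subring A R" "primeideal p (R\<lparr>carrier := A\<rparr>)" "Q \<inter> A \<subseteq> p"
    and "set gs \<subseteq> carrier R"
    and "\<And>g. g \<in> set gs \<Longrightarrow> \<exists>f d. (\<forall>i. f i \<in> A) \<and> poly_val f (Suc d) g \<in> Q \<and> f d \<notin> p"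
  shows "\<exists>P. primeideal P (R\<lparr>carrier := adjoins A gs\<rparr>) \<and> P \<inter> A = p \<and> Q \<inter> adjoins A gs \<subseteq> P"
  using assms(2-)
proof (induction gs arbitrary: A p)
  case Nil
  have "p \<subseteq> A" using sub_idealD(1)[OF Nil(1)] sub_primeidealD[OF Nil(1,2)] by auto
  then show ?case using Nil by auto
next
  case (Cons g gs)
  have g: "g \<in> carrier R" using Cons.prems by simp
  obtain f d where f: "\<And>i. f i \<in> A" "poly_val f (Suc d) g \<in> Q" "f d \<notin> p"
    using Cons.prems(5)[of g] by auto
  obtain p' where p': "primeideal p' (R\<lparr>carrier := adjoin A g\<rparr>)" "p' \<inter> A = p" "Q \<inter> adjoin A g \<subseteq> p'"
    using lying_over[OF Q Cons.prems(1-3) g f] by blast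
  have AA: "A \<subseteq> adjoin A g" by (rule subring_adjoin_base[OF Cons.prems(1) g])
  have "\<exists>P. primeideal P (R\<lparr>carrier := adjoins (adjoin A g) gs\<rparr>) \<and> P \<inter> adjoin A g = p' \<and>
      Q \<inter> adjoins (adjoin A g) gs \<subseteq> P"
  proof (rule Cons.IH[OF adjoin_subring[OF Cons.prems(1) g] p'(1,3)])
    show "set gs \<subseteq> carrier R" using Cons.prems by simp
    fix y assume "y \<in> set gs"
    then obtain f d where "\<forall>i. f i \<in> A" "poly_val f (Suc d) y \<in> Q" "f d \<notin> p"
      using Cons.prems(5)[of y] by auto
    then show "\<exists>f d. (\<forall>i. f i \<in> adjoin A g) \<and> poly_val f (Suc d) y \<in> Q \<and> f d \<notin> p'"
      using AA p'(2) by (intro exI[of _ f] exI[of _ d]) auto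
  qed
  then show ?case using AA p'(2) by auto
qed

end

section \<open>Transcendence degree and chains of primes\<close>

context cring
begin

lemma subfield_unit_notin:
  assumes "primeideal Q R" "subfield k R" "a \<in> k" "a \<noteq> \<zero>" shows "a \<notin> Q"
proof
  interpret Q: primeideal Q R by (rule assms(1))
  assume a: "a \<in> Q"
  have "inv a \<in> k" "inv a \<otimes> a = \<one>" using subfield_m_inv[OF assms(2), of a] assms(3,4) by auto
  then have "\<one> \<in> Q" using Q.I_l_closed[OF a, of "inv a"] subfieldE(3)[OF assms(2)] by auto
  then show False using Q.one_imp_carrier Q.I_notcarr by auto
qed

text \<open>Differences of elements of the field are units, so dividing by a linear factor leaves a polynomial that
vanishes modulo \<open>Q\<close> at all remaining points of \<open>S\<close>.\<close>
lemma finite_roots_mod: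
  assumes Q: "primeideal Q R" and k: "subfield k R" and A: "subring A R" "k \<subseteq> A"
    and "infinite S" "S \<subseteq> k" "\<And>i. c i \<in> A" "\<And>a. a \<in> S \<Longrightarrow> poly_val c n a \<in> Q"
  shows "\<forall>i<n. c i \<in> Q"
  using assms(5-)
proof (induction n arbitrary: c S)
  case (Suc m)
  interpret Q: primeideal Q R by (rule Q)
  have inR: "a \<in> A \<Longrightarrow> a \<in> carrier R" for a using subringE(1)[OF A(1)] by auto
  obtain a where a: "a \<in> S" using Suc.prems(1) by fastforce
  then have aA: "a \<in> A" "a \<in> carrier R" using Suc.prems(2) A inR by auto
  have cA: "\<forall>i. c i \<in> A" using Suc.prems(3) by blast
  from synthetic_division[OF A(1) aA(1) cA, of m] obtain d where d: "\<forall>i. d i \<in> A"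
    and eq: "\<forall>x\<in>carrier R. poly_val c (Suc m) x = (x \<ominus> a) \<otimes> poly_val d m x \<oplus> poly_val c (Suc m) a"
    and cQ: "\<forall>Q. ideal Q R \<longrightarrow> (\<forall>i<m. d i \<in> Q) \<longrightarrow> (\<forall>i. 0 < i \<and> i \<le> m \<longrightarrow> c i \<in> Q)"
    by (elim exE conjE)
  have "\<forall>i<m. d i \<in> Q"
  proof (rule Suc.IH[of "S - {a}"])
    show "infinite (S - {a})" using Suc.prems by simp
    show "S - {a} \<subseteq> k" using Suc.prems by auto
    show "d i \<in> A" for i using d by blast
    fix b assume b: "b \<in> S - {a}"
    then have bk: "b \<in> k" "a \<in> k" "b \<in> carrier R" using Suc.prems(2) a A inR by auto
    have "(b \<ominus> a) \<otimes> poly_val d m b \<oplus> poly_val c (Suc m) a \<in> Q" "poly_val c (Suc m) a \<in> Q"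
      unfolding eq[rule_format, OF bk(3), symmetric] using Suc.prems(4) a b by auto
    then have "((b \<ominus> a) \<otimes> poly_val d m b \<oplus> poly_val c (Suc m) a) \<ominus> poly_val c (Suc m) a \<in> Q"
      by (simp add: a_minus_def Q.a_closed Q.a_inv_closed del: poly_val.simps)
    moreover have cl: "poly_val d m b \<in> carrier R" "poly_val c (Suc m) a \<in> carrier R"
      using d Suc.prems(3) inR bk aA by auto
    ultimately have "(b \<ominus> a) \<otimes> poly_val d m b \<in> Q"
      using add_minus_cancel[of "(b \<ominus> a) \<otimes> poly_val d m b" "poly_val c (Suc m) a"] bk aA
      by (simp del: poly_val.simps)
    then have "b \<ominus> a \<in> Q \<or> poly_val d m b \<in> Q" using Q.I_prime bk aA cl by auto
    moreover have "b \<ominus> a \<in> k" using minus_in_subring[OF subfieldE(1)[OF k] bk(1,2)] .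
    moreover have "b \<ominus> a \<noteq> \<zero>" using b bk aA r_right_minus_eq by auto
    ultimately show "poly_val d m b \<in> Q" using subfield_unit_notin[OF Q k] by auto
  qed
  then have *: "c i \<in> Q" if "0 < i" "i \<le> m" for i using cQ Q.ideal_axioms that by blast
  have "poly_val (\<lambda>i. c (Suc i)) m a \<in> Q"
    using * aA by (intro poly_val_in_ideal[OF Q.ideal_axioms]) auto
  then have r: "a \<otimes> poly_val (\<lambda>i. c (Suc i)) m a \<in> Q" using Q.I_l_closed aA by auto
  have "c 0 \<oplus> a \<otimes> poly_val (\<lambda>i. c (Suc i)) m a \<in> Q" using Suc.prems(4)[OF a] by simp
  then have "(c 0 \<oplus> a \<otimes> poly_val (\<lambda>i. c (Suc i)) m a) \<ominus> a \<otimes> poly_val (\<lambda>i. c (Suc i)) m a \<in> Q"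
    using r by (simp add: a_minus_def Q.a_closed Q.a_inv_closed)
  then have "c 0 \<in> Q"
    using add_minus_cancel[of "c 0" "a \<otimes> poly_val (\<lambda>i. c (Suc i)) m a"] Suc.prems(3) inR aA
    by (simp add: poly_val_closed)
  then show ?case using * by (metis less_Suc_eq_le not_gr_zero)
qed simp

text \<open>The top coefficient of \<open>w + (t - a) c(t)\<close> is that of \<open>c\<close>. As \<open>t\<close> is transcendental modulo \<open>Q\<close>,
the coefficients of \<open>c\<close> lie in \<open>Q\<close> one after the other from the top down, until \<open>w\<close> is left.\<close>
lemma linear_factor_constant:
  assumes Q: "ideal Q R" and A: "subring A R" and t: "t \<in> carrier R" "transc_mod Q A t"
    and a: "a \<in> A" and w: "w \<in> A" and c: "\<And>i. c i \<in> A"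
    and "w \<oplus> (t \<ominus> a) \<otimes> poly_val c n t \<in> Q"
  shows "w \<in> Q"
  using assms(8)
proof (induction n)
  case 0 then show ?case using w t a subringE(1)[OF A] by (simp add: subset_iff)
next
  case (Suc m)
  interpret Q: ideal Q R by (rule Q)
  have inR: "b \<in> A \<Longrightarrow> b \<in> carrier R" for b using subringE(1)[OF A] by auto
  let ?n = "Suc m"
  \<comment> \<open>the coefficients of \<open>w + (t - a) c(t)\<close>; the top one is \<open>c m\<close>\<close>
  let ?e = "\<lambda>i. (case_nat w c) i \<oplus> (\<ominus> a) \<otimes> trunc ?n c i"
  have cA: "case_nat w c i \<in> A" "trunc ?n c i \<in> A" for i
    using w c subringE(2)[OF A] by (auto simp: trunc_def split: nat.split)
  have e: "?e i \<in> A" for i using cA a by (intro subringE[OF A])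
  have P: "poly_val c ?n t \<in> carrier R" using c inR t by (intro poly_val_closed) auto
  have "poly_val ?e (Suc ?n) t = poly_val (case_nat w c) (Suc ?n) t \<oplus> (\<ominus> a) \<otimes> poly_val (trunc ?n c) (Suc ?n) t"
    using cA inR a t by (simp add: poly_val_add poly_val_smult del: poly_val.simps)
  also have "poly_val (trunc ?n c) (Suc ?n) t = poly_val c ?n t"
    using c inR t by (intro poly_val_trunc) auto
  also have "poly_val (case_nat w c) (Suc ?n) t = w \<oplus> t \<otimes> poly_val c ?n t" by simp
  also have "(w \<oplus> t \<otimes> y) \<oplus> (\<ominus> a) \<otimes> y = w \<oplus> (t \<ominus> a) \<otimes> y" if "y \<in> carrier R" for y
    using that w t a inR by (simp add: a_minus_def l_distr a_assoc)
  then have "(w \<oplus> t \<otimes> poly_val c ?n t) \<oplus> (\<ominus> a) \<otimes> poly_val c ?n t = w \<oplus> (t \<ominus> a) \<otimes> poly_val c ?n t"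
    using P by blast
  finally have "poly_val ?e (Suc ?n) t \<in> Q" using Suc.prems by simp
  then have "?e ?n \<in> Q" using transc_modD[OF t(2), where c = ?e and i = ?n] e by blast
  then have cm: "c m \<in> Q" using c inR a by (simp add: trunc_def)
  have top: "poly_val c ?n t = poly_val c m t \<oplus> c m \<otimes> t [^] m"
    using c inR t by (intro poly_val_Suc_top) auto
  have "(t \<ominus> a) \<otimes> (c m \<otimes> t [^] m) \<in> Q"
    using cm t a inR by (intro Q.I_l_closed Q.I_r_closed) auto
  moreover have "w \<oplus> s \<otimes> (y \<oplus> z) \<ominus> s \<otimes> z = w \<oplus> s \<otimes> y"
    if "s \<in> carrier R" "y \<in> carrier R" "z \<in> carrier R" for s y z
    using that inR[OF w] by algebra
  then have "w \<oplus> (t \<ominus> a) \<otimes> (poly_val c m t \<oplus> c m \<otimes> t [^] m) \<ominus> (t \<ominus> a) \<otimes> (c m \<otimes> t [^] m)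
      = w \<oplus> (t \<ominus> a) \<otimes> poly_val c m t"
    using t a c inR by (simp add: poly_val_closed)
  ultimately have "w \<oplus> (t \<ominus> a) \<otimes> poly_val c m t \<in> Q"
    using Suc.prems unfolding top by (metis a_minus_def Q.a_closed Q.a_inv_closed)
  then show ?case by (rule Suc.IH)
qed

text \<open>Geometrically: on \<open>Spec A[t]\<close> over \<open>Spec A\<close>, the section \<open>t = a\<close> at a point \<open>a\<close> of the field where the
polynomial \<open>h\<close> does not vanish. The prime is obtained from the multiplicative set \<open>A - Q\<close>, which the ideal
generated by \<open>t - a\<close> and \<open>Q\<close> avoids by \<open>linear_factor_constant\<close>.\<close>
lemma prime_at_point:
  assumes Q: "primeideal Q R" and k: "subfield k R" "infinite k" and A: "subring A R" "k \<subseteq> A"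
    and t: "t \<in> carrier R" "transc_mod Q A t" and h: "h \<in> adjoin A t" "h \<notin> Q"
  shows "\<exists>p a. a \<in> k \<and> primeideal p (R\<lparr>carrier := adjoin A t\<rparr>) \<and> Q \<inter> adjoin A t \<subseteq> p \<and>
    p \<inter> A \<subseteq> Q \<and> t \<ominus> a \<in> p \<and> h \<notin> p"
proof -
  interpret Q: primeideal Q R by (rule Q)
  note QI = Q.ideal_axioms
  have inR: "a \<in> A \<Longrightarrow> a \<in> carrier R" for a using subringE(1)[OF A(1)] by auto
  obtain c n where c: "\<forall>i. c i \<in> A" "h = poly_val c n t" using h(1) unfolding adjoin_def by auto
  \<comment> \<open>a point \<open>a\<close> where \<open>h\<close>, as a polynomial in \<open>t\<close>, does not vanish modulo \<open>Q\<close>\<close>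
  have "\<exists>a\<in>k. poly_val c n a \<notin> Q"
  proof (rule ccontr)
    assume "\<not> ?thesis"
    then have "\<forall>i<n. c i \<in> Q"
      using finite_roots_mod[OF Q k(1) A k(2) subset_refl, of c n] c(1) by blast
    then have "h \<in> Q" unfolding c(2) by (intro poly_val_in_ideal[OF QI] t) auto
    then show False using h by simp
  qed
  then obtain a where a: "a \<in> k" "poly_val c n a \<notin> Q" by auto
  have aA: "a \<in> A" "a \<in> carrier R" using a A inR by auto
  let ?A = "adjoin A t"
  let ?S = "R\<lparr>carrier := ?A\<rparr>"
  have S: "subring ?A R" by (rule adjoin_subring[OF A(1) t(1)])
  have AA: "A \<subseteq> ?A" by (rule subring_adjoin_base[OF A(1) t(1)])
  interpret S: cring ?S by (rule sub_cring[OF S])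
  have SR: "y \<in> ?A \<Longrightarrow> y \<in> carrier R" for y using subringE(1)[OF S] by auto
  have ta: "t \<ominus> a \<in> ?A"
    using minus_in_subring[OF S adjoin_gen[OF A(1) t(1)]] aA AA by auto
  let ?I = "{y \<in> ?A. \<exists>z\<in>?A. cong_mod Q y ((t \<ominus> a) \<otimes> z)}"
  have mem_I: "y \<in> ?I" if "y \<in> ?A" "z \<in> ?A" "cong_mod Q y ((t \<ominus> a) \<otimes> z)" for y z
    using that by blast
  have I: "ideal ?I ?S"
  proof (rule sub_idealI[OF S])
    have z: "cong_mod Q \<zero> ((t \<ominus> a) \<otimes> \<zero>)" using cong_refl[OF QI] SR[OF ta] by simp
    show "\<zero> \<in> ?I" by (rule mem_I[OF _ _ z]) (use subringE(2)[OF S] in auto)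
  next
    fix y y' assume "y \<in> ?I" "y' \<in> ?I"
    then obtain z z' where z: "y \<in> ?A" "y' \<in> ?A" "z \<in> ?A" "z' \<in> ?A"
      "cong_mod Q y ((t \<ominus> a) \<otimes> z)" "cong_mod Q y' ((t \<ominus> a) \<otimes> z')" by auto
    have "cong_mod Q (y \<oplus> y') ((t \<ominus> a) \<otimes> (z \<oplus> z'))"
      using cong_add[OF QI z(5,6)] z(3,4) SR ta by (simp add: r_distr)
    then show "y \<oplus> y' \<in> ?I"
      using mem_I[of "y \<oplus> y'" "z \<oplus> z'"] subringE(7)[OF S] z by blast
  next
    fix b y assume "b \<in> ?A" "y \<in> ?I"
    then obtain z where z: "b \<in> ?A" "y \<in> ?A" "z \<in> ?A" "cong_mod Q y ((t \<ominus> a) \<otimes> z)" by auto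
    have "cong_mod Q (b \<otimes> y) ((t \<ominus> a) \<otimes> (b \<otimes> z))"
      using cong_mult_left[OF QI z(4), of b] z(1,3) SR ta by (simp add: m_lcomm)
    then show "b \<otimes> y \<in> ?I"
      using mem_I[of "b \<otimes> y" "b \<otimes> z"] subringE(6)[OF S] z by blast
  qed auto
  have disj: "?I \<inter> (A - Q) = {}"
  proof (rule ccontr)
    assume "?I \<inter> (A - Q) \<noteq> {}"
    then obtain u z where u: "u \<in> A" "u \<notin> Q" "z \<in> ?A" "cong_mod Q u ((t \<ominus> a) \<otimes> z)" by auto
    obtain e m where e: "\<forall>i. e i \<in> A" "z = poly_val e m t" using u(3) unfolding adjoin_def by auto
    have "u \<ominus> (t \<ominus> a) \<otimes> z \<in> Q" using u(4) by (simp add: cong_mod_def)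
    then have "\<ominus> (u \<ominus> (t \<ominus> a) \<otimes> z) \<in> Q" by (rule Q.a_inv_closed)
    moreover have "\<ominus> (u \<ominus> (t \<ominus> a) \<otimes> z) = \<ominus> u \<oplus> (t \<ominus> a) \<otimes> z"
      using u(1,3) inR SR t(1) aA by algebra
    ultimately have "\<ominus> u \<oplus> (t \<ominus> a) \<otimes> poly_val e m t \<in> Q" unfolding e(2) by simp
    then have "\<ominus> u \<in> Q"
      using linear_factor_constant[OF QI A(1) t aA(1) subringE(5)[OF A(1) u(1)], of e m] e(1) by blast
    then show False using Q.a_inv_closed[of "\<ominus> u"] u(1,2) inR by simp
  qed
  have "\<exists>P. primeideal P ?S \<and> ?I \<subseteq> P \<and> P \<inter> (A - Q) = {}"
  proof (rule S.prime_avoiding[OF I])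
    show "b \<otimes>\<^bsub>?S\<^esub> b' \<in> A - Q" if "b \<in> A - Q" "b' \<in> A - Q" for b b'
      using that Q.I_prime[of b b'] inR subringE(6)[OF A(1)] by auto
    have "\<one> \<notin> Q" using Q.one_imp_carrier Q.I_notcarr by auto
    then show "\<one>\<^bsub>?S\<^esub> \<in> A - Q" using subringE(3)[OF A(1)] by simp
  qed (use AA disj in auto)
  then obtain p where p: "primeideal p ?S" "?I \<subseteq> p" "p \<inter> (A - Q) = {}" by blast
  note pD = sub_idealD[OF S sub_primeidealD(1)[OF S p(1)]]
  have tap: "t \<ominus> a \<in> p"
  proof -
    have "cong_mod Q (t \<ominus> a) ((t \<ominus> a) \<otimes> \<one>)" using cong_refl[OF QI] SR[OF ta] by simp
    then have "t \<ominus> a \<in> ?I" by (rule mem_I[OF ta subringE(3)[OF S]])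
    then show ?thesis using p(2) by blast
  qed
  have QA: "Q \<inter> ?A \<subseteq> p"
  proof
    fix y assume y: "y \<in> Q \<inter> ?A"
    have "cong_mod Q y ((t \<ominus> a) \<otimes> \<zero>)" using cong_zeroI[OF QI] y SR[OF ta] by simp
    then have "y \<in> ?I" using mem_I[of y \<zero>] subringE(2)[OF S] y by blast
    then show "y \<in> p" using p(2) by blast
  qed
  have "h \<notin> p"
  proof
    assume hp: "h \<in> p"
    show False
    proof (cases n)
      case 0
      then show False using h(2) c(2) Q.zero_closed by simp
    next
      case (Suc m)
      from synthetic_division[OF A(1) aA(1) c(1), of m] obtain d where d: "\<forall>i. d i \<in> A"
        and eq: "\<forall>x\<in>carrier R. poly_val c (Suc m) x = (x \<ominus> a) \<otimes> poly_val d m x \<oplus> poly_val c (Suc m) a"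
        by (elim exE conjE)
      have P: "poly_val d m t \<in> ?A" using d by (intro adjoinI) blast
      have va: "poly_val c n a \<in> A" using c(1) aA by (intro poly_val_in_subring[OF A(1)]) auto
      have s: "(t \<ominus> a) \<otimes> poly_val d m t \<in> p" using pD(5)[OF tap P] .
      have "h = (t \<ominus> a) \<otimes> poly_val d m t \<oplus> poly_val c n a" using eq[rule_format, OF t(1)] c(2) Suc by (simp del: poly_val.simps)
      then have "\<ominus> ((t \<ominus> a) \<otimes> poly_val d m t) \<oplus> h = poly_val c n a"
        using P va ta SR inR by (simp add: a_assoc[symmetric] l_neg)
      then have "poly_val c n a \<in> p" using pD(3)[OF pD(6)[OF s] hp] by simp
      then show False using p(3) va a(2) by blast
    qed
  qed
  then show ?thesis using p(1,3) a(1) QA tap by (intro exI[of _ p] exI[of _ a]) auto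
qed

text \<open>A relation modulo \<open>Q\<close> is cut off at its highest coefficient outside \<open>Q\<close>.\<close>
lemma not_transc_modE:
  assumes "\<not> transc_mod Q A x" "ideal Q R" "subring A R" "x \<in> carrier R"
  obtains f d where "\<And>i. f i \<in> A" "poly_val f (Suc d) x \<in> Q" "f d \<notin> Q"
proof -
  interpret Q: ideal Q R by (rule assms(2))
  obtain c n where c: "\<forall>i. c i \<in> A" "poly_val c n x \<in> Q" "\<exists>i<n. c i \<notin> Q"
    using assms(1) unfolding transc_mod_def by auto
  have "\<exists>d. poly_val c (Suc d) x \<in> Q \<and> c d \<notin> Q" using c(2,3)
  proof (induction n)
    case (Suc n)
    show ?case
    proof (cases "c n \<in> Q")
      case True
      have cl: "poly_val c n x \<in> carrier R" "c n \<otimes> x [^] n \<in> carrier R"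
        using c(1) subringE(1)[OF assms(3)] assms(4) by auto
      have "poly_val c (Suc n) x = poly_val c n x \<oplus> c n \<otimes> x [^] n"
        using c(1) subringE(1)[OF assms(3)] assms(4) by (intro poly_val_Suc_top) auto
      moreover have "c n \<otimes> x [^] n \<in> Q" using True assms(4) Q.I_r_closed by auto
      ultimately have "poly_val c n x \<in> Q"
        using Suc.prems(1) add_minus_cancel[OF cl]
        by (metis a_minus_def Q.a_closed Q.a_inv_closed)
      then show ?thesis using Suc True by (metis less_Suc_eq)
    next
      case False then show ?thesis using Suc.prems by auto
    qed
  qed simp
  then show ?thesis using that c(1) by blast
qed

text \<open>Generators are appended to the tower one after the other, whenever they are transcendental over
what has been collected before.\<close>
lemma tower_extend_algebraic:
  assumes "primeideal Q R" "subring k R" "tower Q k xs" "set gs \<subseteq> carrier R"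
  shows "\<exists>ys. tower Q k (xs @ ys) \<and> (\<forall>g\<in>set gs. \<not> transc_mod Q (adjoins k (xs @ ys)) g)"
proof -
  interpret Q: primeideal Q R by (rule assms(1))
  show ?thesis using assms(4)
  proof (induction gs)
    case Nil then show ?case using assms(3) by (intro exI[of _ "[]"]) simp
  next
    case (Cons g gs)
    then obtain ys where ys: "tower Q k (xs @ ys)" "\<forall>g\<in>set gs. \<not> transc_mod Q (adjoins k (xs @ ys)) g"
      by auto
    show ?case
    proof (cases "transc_mod Q (adjoins k (xs @ ys)) g")
      case False
      then show ?thesis using ys by (intro exI[of _ ys]) auto
    next
      case True
      have g: "g \<in> carrier R" using Cons.prems by simp
      have S: "subring (adjoins k (xs @ ys)) R"
        using adjoins_subring(1)[OF assms(2) tower_carrier[OF ys(1)]] .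
      let ?A = "adjoin (adjoins k (xs @ ys)) g"
      have A: "adjoins k (xs @ ys @ [g]) = ?A" by simp
      have le: "adjoins k (xs @ ys) \<subseteq> ?A" by (rule subring_adjoin_base[OF S g])
      have "tower Q k ((xs @ ys) @ [g])" using ys(1) True g by (simp only: tower_append) simp
      then have "tower Q k (xs @ ys @ [g])" by simp
      moreover have "\<not> transc_mod Q ?A g"
      proof
        assume tr: "transc_mod Q ?A g"
        define c where "c i = (if i = 0 then \<ominus> g else if i = 1 then \<one> else \<zero>)" for i :: nat
        have SA: "subring ?A R" by (rule adjoin_subring[OF S g])
        have "c i \<in> ?A" for i
          using subringE(2,3,5)[OF SA] adjoin_gen[OF S g] by (auto simp: c_def)
        moreover have "poly_val c 2 g = \<zero>" using g by (simp add: c_def numeral_2_eq_2 l_neg)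
        then have "poly_val c 2 g \<in> Q"
          using Q.zero_closed by simp
        ultimately have "c 1 \<in> Q" using transc_modD[OF tr, of c 2 1] by simp
        then have "\<one> \<in> Q" by (simp add: c_def)
        then show False
          using ideal.one_imp_carrier[OF Q.ideal_axioms] Q.I_notcarr by simp
      qed
      ultimately show ?thesis using ys(2) A le transc_mod_antimono
        by (intro exI[of _ "ys @ [g]"]) auto
    qed
  qed
qed

text \<open>The product \<open>h\<close> of the leading coefficients of equations for the generators. A prime that avoids \<open>h\<close>
avoids all of them.\<close>
lemma common_denominator:
  assumes Q: "primeideal Q R" and A: "subring A R" "set gs \<subseteq> carrier R"
    and "\<And>g. g \<in> set gs \<Longrightarrow> \<not> transc_mod Q A g"
  shows "\<exists>h\<in>A - Q. \<forall>g\<in>set gs. \<exists>f d z. (\<forall>i. f i \<in> A) \<and> poly_val f (Suc d) g \<in> Q \<and> z \<in> A \<and> h = z \<otimes> f d"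
  using assms(3,4)
proof (induction gs)
  interpret Q: primeideal Q R by (rule Q)
  case Nil
  have "\<one> \<notin> Q" using ideal.one_imp_carrier[OF Q.ideal_axioms] Q.I_notcarr by auto
  then show ?case using subringE(3)[OF A(1)] by (intro bexI[of _ \<one>]) auto
next
  interpret Q: primeideal Q R by (rule Q)
  case (Cons g gs)
  have inR: "a \<in> A \<Longrightarrow> a \<in> carrier R" for a using subringE(1)[OF A(1)] by auto
  obtain h where h: "h \<in> A" "h \<notin> Q"
    "\<forall>g\<in>set gs. \<exists>f d z. (\<forall>i. f i \<in> A) \<and> poly_val f (Suc d) g \<in> Q \<and> z \<in> A \<and> h = z \<otimes> f d"
    using Cons by auto
  have "\<not> transc_mod Q A g" "g \<in> carrier R" using Cons.prems by auto
  from not_transc_modE[OF this(1) Q.ideal_axioms A(1) this(2)]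
  obtain f d where f: "\<forall>i. f i \<in> A" "poly_val f (Suc d) g \<in> Q" "f d \<notin> Q" by metis
  have fd: "f d \<in> A" using f by blast
  show ?case
  proof (intro bexI[of _ "h \<otimes> f d"] ballI)
    show "h \<otimes> f d \<in> A - Q"
      using h(1,2) fd f(3) Q.I_prime[of h "f d"] inR subringE(6)[OF A(1)] by auto
    fix g' assume "g' \<in> set (g # gs)"
    then consider "g' = g" | "g' \<in> set gs" by auto
    then show "\<exists>f' d' z. (\<forall>i. f' i \<in> A) \<and> poly_val f' (Suc d') g' \<in> Q \<and> z \<in> A \<and> h \<otimes> f d = z \<otimes> f' d'"
    proof cases
      case 1
      then show ?thesis using f h by blast
    next
      case 2
      then obtain f' d' z where z: "\<forall>i. f' i \<in> A" "poly_val f' (Suc d') g' \<in> Q" "z \<in> A" "h = z \<otimes> f' d'"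
        using h(3) by blast
      have "f' d' \<in> carrier R" using z(1) inR by blast
      then have "h \<otimes> f d = (f d \<otimes> z) \<otimes> f' d'" using z(3,4) fd inR by (simp add: m_ac)
      then show ?thesis using z subringE(6)[OF A(1) fd z(3)] by blast
    qed
  qed
qed

text \<open>Extend the tower until all generators are algebraic over \<open>k[ts, t]\<close>, where \<open>t\<close> is the last member.
A prime of \<open>k[ts, t]\<close> that contains some \<open>t - a\<close>, meets \<open>k[ts]\<close> only in \<open>Q\<close> and avoids a common denominator, lifts to the whole ring. Modulo the lift \<open>ts\<close> is still a tower.\<close>
lemma larger_prime:
  assumes Q: "primeideal Q R" and k: "subfield k R" "infinite k"
    and gs: "set gs \<subseteq> carrier R" "adjoins k gs = carrier R"
    and xs: "tower Q k xs" "length xs = Suc n"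
  shows "\<exists>P ys. primeideal P R \<and> Q \<subset> P \<and> tower P k ys \<and> n \<le> length ys"
proof -
  interpret Q: primeideal Q R by (rule Q)
  note QI = Q.ideal_axioms
  note kR = subfieldE(1)[OF k(1)]
  obtain ys where ys: "tower Q k (xs @ ys)" "\<forall>g\<in>set gs. \<not> transc_mod Q (adjoins k (xs @ ys)) g"
    using tower_extend_algebraic[OF Q kR xs(1) gs(1)] by blast
  have "xs @ ys \<noteq> []" using xs(2) by auto
  then obtain ts t where tst: "xs @ ys = ts @ [t]" by (metis rev_exhaust)
  have len: "n \<le> length ts" using xs(2) arg_cong[OF tst, of length] by simp
  have t: "tower Q k ts" "t \<in> carrier R" "transc_mod Q (adjoins k ts) t"
    using ys(1) unfolding tst by (simp_all add: tower_append)
  let ?A = "adjoins k ts"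
  let ?B = "adjoin ?A t"
  note ts = tower_carrier[OF t(1)]
  note A = adjoins_subring[OF kR ts]
  note B = adjoin_subring[OF A(1) t(2)]
  have AB: "?A \<subseteq> ?B" by (rule subring_adjoin_base[OF A(1) t(2)])
  have "\<not> transc_mod Q ?B g" if "g \<in> set gs" for g using ys(2) that unfolding tst by simp
  from common_denominator[OF Q B gs(1) this] obtain h where h: "h \<in> ?B" "h \<notin> Q"
    "\<forall>g\<in>set gs. \<exists>f d z. (\<forall>i. f i \<in> ?B) \<and> poly_val f (Suc d) g \<in> Q \<and> z \<in> ?B \<and> h = z \<otimes> f d"
    by auto
  obtain p a where p: "a \<in> k" "primeideal p (R\<lparr>carrier := ?B\<rparr>)" "Q \<inter> ?B \<subseteq> p"
    "p \<inter> ?A \<subseteq> Q" "t \<ominus> a \<in> p" "h \<notin> p"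
    using prime_at_point[OF Q k A t(2,3) h(1,2)] by blast
  have "\<exists>f d. (\<forall>i. f i \<in> ?B) \<and> poly_val f (Suc d) g \<in> Q \<and> f d \<notin> p" if "g \<in> set gs" for g
    using h(3) that p(6) sub_idealD(4)[OF B sub_primeidealD(1)[OF B p(2)]] by metis
  from lying_over_list[OF QI B p(2,3) gs(1) this] obtain P
    where P: "primeideal P (R\<lparr>carrier := adjoins ?B gs\<rparr>)" "P \<inter> ?B = p" "Q \<inter> adjoins ?B gs \<subseteq> P"
    by blast
  have "k \<subseteq> ?B" using A(2) AB by auto
  then have full: "adjoins ?B gs = carrier R"
    using mono_adjoins[of k ?B gs] gs(2) subringE(1)[OF adjoins_subring(1)[OF B gs(1)]] by auto
  have PR: "primeideal P R" using P(1) unfolding full by simp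
  have QP: "Q \<subseteq> P" using P(3) Q.a_subset unfolding full by auto
  have taP: "t \<ominus> a \<in> P" using p(5) P(2) by auto
  have "t \<ominus> a \<notin> Q"
  proof
    assume taQ: "t \<ominus> a \<in> Q"
    define c where "c i = (if i = 0 then \<ominus> a else if i = 1 then \<one> else \<zero>)" for i :: nat
    have aA: "a \<in> ?A" "a \<in> carrier R" using p(1) A(2) subringE(1)[OF A(1)] by auto
    have "c i \<in> ?A" for i using subringE(2,3)[OF A(1)] subringE(5)[OF A(1) aA(1)] by (auto simp: c_def)
    moreover have "poly_val c 2 t = t \<ominus> a"
      using t(2) aA(2) by (simp add: c_def numeral_2_eq_2 a_minus_def a_comm)
    then have "poly_val c 2 t \<in> Q" using taQ by simp
    ultimately have "c 1 \<in> Q" using transc_modD[OF t(3), of c 2 1] by simp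
    then show False using ideal.one_imp_carrier[OF QI] Q.I_notcarr by (simp add: c_def)
  qed
  then have "Q \<subset> P" using QP taP by auto
  moreover have "P \<inter> ?A \<subseteq> Q" using P(2) p(4) AB by auto
  then have "tower P k ts" by (rule tower_change[OF t(1) kR QP])
  ultimately show ?thesis using PR len by blast
qed

text \<open>Iterate \<open>larger_prime\<close>; each step costs one member of the tower. This is the inequality between the
transcendence degree of a finitely generated algebra and its Krull dimension.\<close>
theorem prime_chain_of_tower:
  assumes Q: "primeideal Q R" and k: "subfield k R" "infinite k"
    and gs: "set gs \<subseteq> carrier R" "adjoins k gs = carrier R"
    and xs: "tower Q k xs" "n \<le> length xs"
  shows "\<exists>P. P 0 = Q \<and> (\<forall>i\<le>n. primeideal (P i) R) \<and> (\<forall>i<n. P i \<subset> P (Suc i))"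
  using Q xs
proof (induction n arbitrary: Q xs)
  case 0
  then show ?case by (intro exI[of _ "\<lambda>_. Q"]) auto
next
  case (Suc n)
  let ?xs = "take (Suc n) xs"
  have "tower Q k (?xs @ drop (Suc n) xs)" using Suc.prems(2) by simp
  then have "tower Q k ?xs" unfolding tower_append by simp
  moreover have "length ?xs = Suc n" using Suc.prems(3) by simp
  ultimately obtain P ys where P: "primeideal P R" "Q \<subset> P" "tower P k ys" "n \<le> length ys"
    using larger_prime[OF Suc.prems(1) k gs] by blast
  obtain F where F: "F 0 = P" "\<forall>i\<le>n. primeideal (F i) R" "\<forall>i<n. F i \<subset> F (Suc i)"
    using Suc.IH[OF P(1,3,4)] by blast
  show ?case
  proof (intro exI[of _ "case_nat Q F"] conjI allI impI)
    show "primeideal (case_nat Q F i) R" if "i \<le> Suc n" for i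
      using that Suc.prems(1) F(2) by (cases i) auto
    show "case_nat Q F i \<subset> case_nat Q F (Suc i)" if "i < Suc n" for i
      using that P(2) F(1,3) by (cases i) auto
  qed simp
qed

end

section \<open>Locally nilpotent derivations and their degree functions\<close>

locale char0_domain = domain R for R (structure) +
  fixes k :: "'a set"
  assumes subfield_k: "subfield k R"
    and char0: "\<And>n::nat. 0 < n \<Longrightarrow> [n] \<cdot> \<one> \<noteq> \<zero>"

definition (in ring) nat_elem :: "nat \<Rightarrow> 'a" where "nat_elem n = [n] \<cdot> \<one>"

text \<open>The \<open>n\<close>-th iterate of a homogeneous operator of degree \<open>N\<close> on \<open>A[s]\<close>, applied to \<open>a s^j\<close> and read off
at its coefficient in \<open>A\<close>; \<open>T j\<close> is the effect of the operator in degree \<open>j\<close>.\<close>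
primrec iterate_graded :: "(nat \<Rightarrow> 'a \<Rightarrow> 'a) \<Rightarrow> nat \<Rightarrow> nat \<Rightarrow> nat \<Rightarrow> 'a \<Rightarrow> 'a"
  where "iterate_graded T N 0 j a = a"
  | "iterate_graded T N (Suc n) j a = T (j + n * N) (iterate_graded T N n j a)"

lemma iterate_graded_front:
  "iterate_graded T N (Suc n) j a = iterate_graded T N n (j + N) (T j a)"
proof (induction n)
  case (Suc n)
  have "iterate_graded T N (Suc (Suc n)) j a = T (j + Suc n * N) (iterate_graded T N (Suc n) j a)"
    by simp
  also have "\<dots> = T (j + Suc n * N) (iterate_graded T N n (j + N) (T j a))" unfolding Suc ..
  finally show ?case by (simp add: ac_simps)
qed simp

lemma iterate_graded_const: "iterate_graded (\<lambda>_. D) N n j a = (D ^^ n) a"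
  by (induction n) auto

text \<open>Derivations of a subring \<open>A\<close> are functions on the ambient type whose values matter only on \<open>A\<close>.\<close>
definition (in ring) derivation_on :: "'a set \<Rightarrow> 'a set \<Rightarrow> ('a \<Rightarrow> 'a) \<Rightarrow> bool"
  where "derivation_on k A D \<longleftrightarrow> (\<forall>a\<in>A. D a \<in> A) \<and> (\<forall>a\<in>A. \<forall>b\<in>A. D (a \<oplus> b) = D a \<oplus> D b) \<and>
    (\<forall>a\<in>A. \<forall>b\<in>A. D (a \<otimes> b) = D a \<otimes> b \<oplus> a \<otimes> D b) \<and> (\<forall>c\<in>k. D c = \<zero>)"

definition (in ring) lnd_on :: "'a set \<Rightarrow> 'a set \<Rightarrow> ('a \<Rightarrow> 'a) \<Rightarrow> bool"
  where "lnd_on k A D \<longleftrightarrow> derivation_on k A D \<and> (\<forall>a\<in>A. \<exists>n. (D ^^ n) a = \<zero>)"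

context ring
begin

lemma nat_elem_closed [simp, intro]: "nat_elem n \<in> carrier R"
  by (simp add: nat_elem_def)

lemma nat_elem_0 [simp]: "nat_elem 0 = \<zero>" and nat_elem_Suc: "nat_elem (Suc n) = nat_elem n \<oplus> \<one>"
  by (simp_all add: nat_elem_def add.nat_pow_Suc)

lemma nat_elem_1 [simp]: "nat_elem (Suc 0) = \<one>" by (simp add: nat_elem_Suc)

lemma nat_elem_add: "nat_elem (m + n) = nat_elem m \<oplus> nat_elem n"
  by (simp add: nat_elem_def add.nat_pow_mult)

lemma nat_elem_mult: "nat_elem (m * n) = nat_elem m \<otimes> nat_elem n"
  by (induction m) (simp_all add: nat_elem_Suc nat_elem_add l_distr a_comm)

lemma nat_elem_in_subring: "subring A R \<Longrightarrow> nat_elem n \<in> A"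
  by (induction n) (auto simp: nat_elem_Suc subringE)

end

context char0_domain
begin

definition subalg :: "'a set \<Rightarrow> bool" where "subalg A \<longleftrightarrow> subring A R \<and> k \<subseteq> A"

lemma subalgD: "subalg A \<Longrightarrow> subring A R" "subalg A \<Longrightarrow> k \<subseteq> A"
  "subalg A \<Longrightarrow> a \<in> A \<Longrightarrow> a \<in> carrier R"
  using subringE(1) by (auto simp: subalg_def)

lemma k_subring: "subring k R" by (rule subfieldE(1)[OF subfield_k])

lemma subalg_carrier: "subalg (carrier R)"
  using subfieldE(3)[OF subfield_k] carrier_is_subring by (simp add: subalg_def)

lemma nat_elem_nonzero: "0 < n \<Longrightarrow> nat_elem n \<noteq> \<zero>" using char0 by (simp add: nat_elem_def)

lemma nat_elem_inverse:
  assumes "0 < n" obtains c where "c \<in> k" "c \<otimes> nat_elem n = \<one>"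
proof -
  have "nat_elem n \<in> k - {\<zero>}" using nat_elem_in_subring[OF k_subring] nat_elem_nonzero[OF assms] by auto
  then show ?thesis using that[of "inv (nat_elem n)"] subfield_m_inv[OF subfield_k] by blast
qed

lemma infinite_k: "infinite k"
proof
  assume "finite k"
  moreover have "range nat_elem \<subseteq> k" using nat_elem_in_subring[OF k_subring] by auto
  ultimately have "finite (range nat_elem)" using finite_subset by blast
  then have "\<not> inj nat_elem" using finite_imageD infinite_UNIV_nat by blast
  then obtain m n where "nat_elem m = nat_elem n" "m < n" by (metis injI linorder_neqE_nat)
  then obtain d where d: "n = m + d" "0 < d" using less_imp_add_positive by blast
  have "nat_elem m \<oplus> nat_elem d = nat_elem m" using \<open>nat_elem m = nat_elem n\<close> d nat_elem_add by simp
  then have "nat_elem d = \<zero>" by (metis nat_elem_closed r_zero add.l_cancel zero_closed)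
  then show False using nat_elem_nonzero d by simp
qed

text \<open>A family \<open>T\<close> with the Leibniz rule \<open>T_mult\<close> is a homogeneous derivation of \<open>A[s]\<close> in disguise. For
\<open>T j = D\<close> and \<open>N = 0\<close> it is a derivation of \<open>A\<close>, so that the two cases share one proof.\<close>
context
  fixes A and T :: "nat \<Rightarrow> 'a \<Rightarrow> 'a" and N :: nat
  assumes A: "subring A R"
    and T_closed: "\<And>j a. a \<in> A \<Longrightarrow> T j a \<in> A"
    and T_add: "\<And>j a b. \<lbrakk>a \<in> A; b \<in> A\<rbrakk> \<Longrightarrow> T j (a \<oplus> b) = T j a \<oplus> T j b"
    and T_mult: "\<And>j l a b. \<lbrakk>a \<in> A; b \<in> A\<rbrakk> \<Longrightarrow> T (j + l) (a \<otimes> b) = T j a \<otimes> b \<oplus> a \<otimes> T l b"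
begin

private abbreviation "It \<equiv> iterate_graded T N"

private lemma mem_carrier: "a \<in> A \<Longrightarrow> a \<in> carrier R" using subringE(1)[OF A] by auto

lemma iterate_graded_closed: "a \<in> A \<Longrightarrow> It n j a \<in> A"
  by (induction n) (auto intro: T_closed)

lemma graded_zero: "T j \<zero> = \<zero>"
proof -
  have z: "\<zero> \<in> A" using subringE(2)[OF A] .
  have "T j \<zero> \<oplus> T j \<zero> = T j \<zero>" using T_add[OF z z, of j] by simp
  moreover have "T j \<zero> \<in> carrier R" using T_closed[OF z] mem_carrier by auto
  ultimately show ?thesis by (metis add.l_cancel r_zero zero_closed)
qed

lemma iterate_graded_zero: "It n j \<zero> = \<zero>"
  by (induction n) (auto simp: graded_zero)

lemma iterate_graded_stays_zero: "n \<le> m \<Longrightarrow> It n j a = \<zero> \<Longrightarrow> It m j a = \<zero>"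
  by (induction m rule: dec_induct) (auto simp: graded_zero)

lemma iterate_graded_add:
  "\<lbrakk>a \<in> A; b \<in> A\<rbrakk> \<Longrightarrow> It n j (a \<oplus> b) = It n j a \<oplus> It n j b"
  by (induction n) (auto simp: T_add iterate_graded_closed)

text \<open>The extreme term of the Leibniz formula for the iterate of order \<open>p + q\<close>; all other terms contain a
vanishing factor. Induction on \<open>p + q\<close> with Pascal's rule.\<close>
lemma iterate_graded_top:
  "\<lbrakk>a \<in> A; b \<in> A; It (Suc p) j a = \<zero>; It (Suc q) l b = \<zero>\<rbrakk> \<Longrightarrow>
    It (p + q) (j + l) (a \<otimes> b) = nat_elem ((p + q) choose p) \<otimes> (It p j a \<otimes> It q l b)"
proof (induction "p + q" arbitrary: p q j l a b)
  case 0
  then show ?case using mem_carrier by simp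
next
  case (Suc m)
  note ab = Suc.prems(1,2)
  have cl: "T j a \<in> A" "T l b \<in> A" using ab T_closed by auto
  have abc: "T j a \<otimes> b \<in> A" "a \<otimes> T l b \<in> A" using cl ab by (auto intro: subringE(6)[OF A])
  let ?y = "It p j a \<otimes> It q l b"
  have y: "?y \<in> carrier R" using ab iterate_graded_closed mem_carrier by auto
  have "It (p + q) (j + l) (a \<otimes> b) = It m (j + l + N) (T (j + l) (a \<otimes> b))"
    using Suc.hyps(2) iterate_graded_front[of T N m] by simp
  also have "\<dots> = It m (j + l + N) (T j a \<otimes> b) \<oplus> It m (j + l + N) (a \<otimes> T l b)"
    using abc by (simp add: T_mult ab iterate_graded_add)
  finally have split: "It (p + q) (j + l) (a \<otimes> b)
      = It m (j + l + N) (T j a \<otimes> b) \<oplus> It m (j + l + N) (a \<otimes> T l b)" .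
  have left: "It m (j + l + N) (T j a \<otimes> b) = (if p = 0 then \<zero> else nat_elem (m choose (p - 1)) \<otimes> ?y)"
  proof (cases p)
    case 0
    then have "T j a = \<zero>" using Suc.prems(3) by simp
    then show ?thesis using 0 mem_carrier[OF ab(2)] by (simp add: iterate_graded_zero)
  next
    case (Suc p')
    have "It (Suc p') (j + N) (T j a) = \<zero>"
      using Suc.prems(3) Suc iterate_graded_front[of T N "Suc p'" j a] by simp
    then have "It (p' + q) ((j + N) + l) (T j a \<otimes> b)
        = nat_elem ((p' + q) choose p') \<otimes> (It p' (j + N) (T j a) \<otimes> It q l b)"
      using Suc.hyps(1)[of p' q "T j a" b "j + N" l] Suc.hyps(2) Suc cl ab Suc.prems(4) by simp
    moreover have "p' + q = m" "It p' (j + N) (T j a) = It p j a"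
      using Suc Suc.hyps(2) iterate_graded_front[of T N p' j a] by auto
    ultimately show ?thesis using Suc by (simp add: ac_simps)
  qed
  have right: "It m (j + l + N) (a \<otimes> T l b) = (if q = 0 then \<zero> else nat_elem (m choose p) \<otimes> ?y)"
  proof (cases q)
    case 0
    then have "T l b = \<zero>" using Suc.prems(4) by simp
    then show ?thesis using 0 mem_carrier[OF ab(1)] by (simp add: iterate_graded_zero)
  next
    case (Suc q')
    have "It (Suc q') (l + N) (T l b) = \<zero>"
      using Suc.prems(4) Suc iterate_graded_front[of T N "Suc q'" l b] by simp
    then have "It (p + q') (j + (l + N)) (a \<otimes> T l b)
        = nat_elem ((p + q') choose p) \<otimes> (It p j a \<otimes> It q' (l + N) (T l b))"
      using Suc.hyps(1)[of p q' a "T l b" j "l + N"] Suc.hyps(2) Suc cl ab Suc.prems(3) by simp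
    moreover have "p + q' = m" "It q' (l + N) (T l b) = It q l b"
      using Suc Suc.hyps(2) iterate_graded_front[of T N q' l b] by auto
    ultimately show ?thesis using Suc by (simp add: ac_simps)
  qed
  consider "p = 0" "q = Suc m" | "q = 0" "p = Suc m" | p' q' where "p = Suc p'" "q = Suc q'" "m = Suc (p' + q')"
    using Suc.hyps(2) by (cases p; cases q) auto
  then show ?case
  proof cases
    case 1
    then show ?thesis unfolding split left right using y by simp
  next
    case 2
    then show ?thesis unfolding split left right using y by simp
  next
    case 3
    have "(p + q) choose p = Suc m choose Suc p'" using 3(1) Suc.hyps(2) by simp
    then have "(p + q) choose p = (m choose p') + (m choose p)" using 3(1) by simp
    then show ?thesis unfolding split left right using y 3 by (simp add: nat_elem_add l_distr)
  qed
qed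

lemma iterate_graded_top_nonzero:
  assumes "a \<in> A" "b \<in> A" "It (Suc p) j a = \<zero>" "It (Suc q) l b = \<zero>"
    and "It p j a \<noteq> \<zero>" "It q l b \<noteq> \<zero>"
  shows "It (p + q) (j + l) (a \<otimes> b) \<noteq> \<zero>"
proof -
  have "nat_elem ((p + q) choose p) \<noteq> \<zero>" by (rule nat_elem_nonzero) simp
  then show ?thesis
    using iterate_graded_top[OF assms(1-4)] assms(1,2,5,6) iterate_graded_closed mem_carrier
    by (simp add: integral_iff)
qed

end

context
  fixes A D
  assumes A: "subalg A" and D: "derivation_on k A D"
begin

private lemmas A' = subalgD[OF A]

lemma derivD: "a \<in> A \<Longrightarrow> D a \<in> A" "\<lbrakk>a \<in> A; b \<in> A\<rbrakk> \<Longrightarrow> D (a \<oplus> b) = D a \<oplus> D b"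
  "\<lbrakk>a \<in> A; b \<in> A\<rbrakk> \<Longrightarrow> D (a \<otimes> b) = D a \<otimes> b \<oplus> a \<otimes> D b" "c \<in> k \<Longrightarrow> D c = \<zero>"
  using D unfolding derivation_on_def by blast+

lemma deriv_iter_closed: "a \<in> A \<Longrightarrow> (D ^^ n) a \<in> A"
  by (induction n) (auto simp: derivD)

lemma deriv_zero: "D \<zero> = \<zero>" and deriv_one: "D \<one> = \<zero>"
  using subringE(2,3)[OF k_subring] derivD(4) by auto

lemma deriv_const_mult: "\<lbrakk>c \<in> A; D c = \<zero>; a \<in> A\<rbrakk> \<Longrightarrow> D (c \<otimes> a) = c \<otimes> D a"
  using derivD A' by simp

lemma deriv_iter_zero: "(D ^^ n) \<zero> = \<zero>" by (induction n) (auto simp: deriv_zero)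

lemma deriv_iter_stays_zero: "n \<le> m \<Longrightarrow> (D ^^ n) a = \<zero> \<Longrightarrow> (D ^^ m) a = \<zero>"
  by (induction m rule: dec_induct) (auto simp: deriv_zero)

lemma deriv_iter_add: "\<lbrakk>a \<in> A; b \<in> A\<rbrakk> \<Longrightarrow> (D ^^ n) (a \<oplus> b) = (D ^^ n) a \<oplus> (D ^^ n) b"
  by (induction n) (auto simp: derivD deriv_iter_closed)

lemma deriv_iter_const_mult:
  "\<lbrakk>c \<in> A; D c = \<zero>; a \<in> A\<rbrakk> \<Longrightarrow> (D ^^ n) (c \<otimes> a) = c \<otimes> (D ^^ n) a"
  by (induction n) (auto simp: deriv_const_mult deriv_iter_closed)

lemma deriv_minus: assumes "a \<in> A" shows "D (\<ominus> a) = \<ominus> D a"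
proof -
  have m: "\<ominus> \<one> \<in> k" by (intro subringE(5)[OF k_subring] subringE(3)[OF k_subring])
  then have "D (\<ominus> \<one> \<otimes> a) = \<ominus> \<one> \<otimes> D a"
    using A'(2) derivD(4) assms by (intro deriv_const_mult) auto
  then show ?thesis using A'(3) derivD(1) assms a_inv_as_mult by simp
qed

lemma deriv_diff: "\<lbrakk>a \<in> A; b \<in> A\<rbrakk> \<Longrightarrow> D (a \<ominus> b) = D a \<ominus> D b"
  by (simp add: a_minus_def derivD(2) deriv_minus subringE(5)[OF A'(1)])

lemma deriv_iter_top:
  assumes "a \<in> A" "b \<in> A" "(D ^^ Suc p) a = \<zero>" "(D ^^ Suc q) b = \<zero>"
  shows "(D ^^ (p + q)) (a \<otimes> b) = nat_elem ((p + q) choose p) \<otimes> ((D ^^ p) a \<otimes> (D ^^ q) b)"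
  using iterate_graded_top[of A "\<lambda>_. D" a b 0 p 0 q 0] assms A' derivD
  by (simp add: iterate_graded_const del: funpow.simps)

lemma deriv_iter_top_nonzero:
  assumes "a \<in> A" "b \<in> A" "(D ^^ Suc p) a = \<zero>" "(D ^^ Suc q) b = \<zero>"
    and "(D ^^ p) a \<noteq> \<zero>" "(D ^^ q) b \<noteq> \<zero>"
  shows "(D ^^ (p + q)) (a \<otimes> b) \<noteq> \<zero>"
  using iterate_graded_top_nonzero[of A "\<lambda>_. D" a b 0 p 0 q 0] assms A' derivD
  by (simp add: iterate_graded_const del: funpow.simps)

lemma kernel_subalg: "subalg {a \<in> A. D a = \<zero>}"
  unfolding subalg_def
proof
  show "subring {a \<in> A. D a = \<zero>} R"
    using A' subringE[OF A'(1)]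
    by (intro subringI) (auto simp: deriv_one deriv_minus derivD)
  show "k \<subseteq> {a \<in> A. D a = \<zero>}" using A'(2) derivD(4) by auto
qed

end

text \<open>For a factorially closed subring \<open>A\<close>, units, irreducible elements and divisibility between non-zero
elements mean the same in \<open>A\<close> and in \<open>B\<close>.\<close>
definition factorially_closed :: "'a set \<Rightarrow> 'a set \<Rightarrow> bool"
  where "factorially_closed A B \<longleftrightarrow>
    A \<subseteq> B \<and> (\<forall>a\<in>B. \<forall>b\<in>B. a \<otimes> b \<in> A \<longrightarrow> a \<otimes> b \<noteq> \<zero> \<longrightarrow> a \<in> A \<and> b \<in> A)"

text \<open>The degree function of a locally nilpotent derivation; for a derivation with a slice it is the degree
in the slice. The value at zero is \<open>0\<close>.\<close>
definition lnd_degree :: "('a \<Rightarrow> 'a) \<Rightarrow> 'a \<Rightarrow> nat"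
  where "lnd_degree D a = (LEAST n. (D ^^ Suc n) a = \<zero>)"

context
  fixes A D
  assumes A: "subalg A" and D: "lnd_on k A D"
begin

private lemmas sA = subalgD[OF A]
private lemma dD: "derivation_on k A D" using D by (simp add: lnd_on_def)

lemma lnd_degree_unique: "\<lbrakk>(D ^^ p) a \<noteq> \<zero>; (D ^^ Suc p) a = \<zero>\<rbrakk> \<Longrightarrow> lnd_degree D a = p"
  unfolding lnd_degree_def
proof (rule Least_equality)
  fix y assume "(D ^^ p) a \<noteq> \<zero>" "(D ^^ Suc y) a = \<zero>"
  then show "p \<le> y" using deriv_iter_stays_zero[OF A dD, of "Suc y" p a] by (meson not_less_eq_eq)
qed

lemma lnd_degree_props:
  assumes "a \<in> A" "a \<noteq> \<zero>"
  shows "(D ^^ lnd_degree D a) a \<noteq> \<zero>" "(D ^^ Suc (lnd_degree D a)) a = \<zero>"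
proof -
  obtain n where n: "(D ^^ n) a = \<zero>" using D assms by (auto simp: lnd_on_def)
  then have "n \<noteq> 0" using assms by (cases n) auto
  then have "\<exists>m. (D ^^ Suc m) a = \<zero>" using n not0_implies_Suc by blast
  then show 1: "(D ^^ Suc (lnd_degree D a)) a = \<zero>" unfolding lnd_degree_def by (rule LeastI_ex)
  show "(D ^^ lnd_degree D a) a \<noteq> \<zero>"
  proof (cases "lnd_degree D a")
    case (Suc m)
    then show ?thesis using not_less_Least[of m "\<lambda>n. (D ^^ Suc n) a = \<zero>"]
      by (metis lnd_degree_def lessI)
  qed (use assms in simp)
qed

lemma lnd_degree_mult:
  assumes "a \<in> A" "b \<in> A" "a \<noteq> \<zero>" "b \<noteq> \<zero>" shows "lnd_degree D (a \<otimes> b) = lnd_degree D a + lnd_degree D b"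
proof -
  note a = lnd_degree_props[OF assms(1,3)] and b = lnd_degree_props[OF assms(2,4)]
  let ?p = "lnd_degree D a" and ?q = "lnd_degree D b"
  have a2: "(D ^^ Suc (Suc ?p)) a = \<zero>" using a(2) deriv_zero[OF A dD] by simp
  have cl: "(D ^^ ?q) b \<in> carrier R" using deriv_iter_closed[OF A dD assms(2)] sA by auto
  have "(D ^^ (Suc ?p + ?q)) (a \<otimes> b) = \<zero>"
    using deriv_iter_top[OF A dD assms(1,2) a2 b(2)] a(2) cl by (simp del: funpow.simps)
  then show ?thesis
    using lnd_degree_unique deriv_iter_top_nonzero[OF A dD assms(1,2) a(2) b(2) a(1) b(1)] by simp
qed

lemma lnd_degree_eq_0_iff:
  assumes "a \<in> A" "a \<noteq> \<zero>" shows "lnd_degree D a = 0 \<longleftrightarrow> D a = \<zero>"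
  using lnd_degree_props[OF assms] lnd_degree_unique[of 0 a] assms by auto

text \<open>The kernel is the set of elements of degree zero, and degrees add up in products.\<close>
lemma kernel_factorially_closed: "factorially_closed {a \<in> A. D a = \<zero>} A"
  unfolding factorially_closed_def
proof (intro conjI ballI impI)
  fix a b assume ab: "a \<in> A" "b \<in> A" "a \<otimes> b \<in> {a \<in> A. D a = \<zero>}" "a \<otimes> b \<noteq> \<zero>"
  then have n: "a \<noteq> \<zero>" "b \<noteq> \<zero>" using sA by auto
  have "lnd_degree D (a \<otimes> b) = 0" using lnd_degree_eq_0_iff[of "a \<otimes> b"] ab by auto
  then have "lnd_degree D a = 0" "lnd_degree D b = 0" using lnd_degree_mult ab n by auto
  then show "a \<in> {a \<in> A. D a = \<zero>}" "b \<in> {a \<in> A. D a = \<zero>}" using lnd_degree_eq_0_iff ab n by auto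
qed auto

end

lemma factorially_closed_trans:
  "\<lbrakk>factorially_closed A B; factorially_closed B C\<rbrakk> \<Longrightarrow> factorially_closed A C"
  unfolding factorially_closed_def by (meson subsetD subset_trans)

end

section \<open>Derivations with a slice\<close>

context char0_domain
begin

text \<open>If \<open>E\<close> has a slice \<open>s\<close>, this says that \<open>b\<close> is \<open>a s^d\<close> plus a polynomial in \<open>s\<close> of smaller degree with
coefficients in \<open>ker E\<close>. Leading coefficients can be computed with in this way before such an expansion is
known to exist; \<open>a = 0\<close> is allowed, so sums need no case distinction.\<close>
definition lead :: "'a set \<Rightarrow> ('a \<Rightarrow> 'a) \<Rightarrow> nat \<Rightarrow> 'a \<Rightarrow> 'a \<Rightarrow> bool"
  where "lead A E d a b \<longleftrightarrow> a \<in> A \<and> E a = \<zero> \<and> b \<in> A \<and> (E ^^ Suc d) b = \<zero> \<and>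
    (E ^^ d) b = nat_elem (fact d) \<otimes> a"

context
  fixes A E s
  assumes A: "subalg A" and E: "lnd_on k A E" and s: "s \<in> A" "E s = \<one>"
begin

private lemmas subA = subalgD[OF A]
private lemma dE: "derivation_on k A E" using E by (simp add: lnd_on_def)
private abbreviation "C \<equiv> {a \<in> A. E a = \<zero>}"
private lemmas C = kernel_subalg[OF A dE]
private lemmas sC = subalgD[OF C]

lemma lead_add:
  assumes "lead A E d a b" "lead A E d a' b'" shows "lead A E d (a \<oplus> a') (b \<oplus> b')"
  using assms subringE(7)[OF subA(1)] subA(3) deriv_iter_add[OF A dE] derivD[OF A dE]
  by (simp add: lead_def r_distr del: funpow.simps)

lemma lead_minus:
  assumes "lead A E d a b" shows "lead A E d (\<ominus> a) (\<ominus> b)"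
proof -
  have ab: "a \<in> A" "b \<in> A" "a \<in> carrier R" "b \<in> carrier R" using assms subA by (auto simp: lead_def)
  have m: "\<ominus> \<one> \<in> A" "E (\<ominus> \<one>) = \<zero>"
    using subringE(3,5)[OF subA(1)] deriv_minus[OF A dE] deriv_one[OF A dE] by auto
  have "(E ^^ n) (\<ominus> b) = \<ominus> ((E ^^ n) b)" for n
    using deriv_iter_const_mult[OF A dE m ab(2), of n] ab deriv_iter_closed[OF A dE ab(2), of n] subA
    by (simp add: a_inv_as_mult)
  then show ?thesis using assms ab subringE(5)[OF subA(1)] deriv_minus[OF A dE]
    by (simp add: lead_def r_minus del: funpow.simps)
qed

text \<open>The binomial coefficient of the Leibniz formula matches the factorials in \<open>lead\<close>.\<close>
lemma lead_mult:
  assumes "lead A E d a b" "lead A E e a' b'"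
  shows "lead A E (d + e) (a \<otimes> a') (b \<otimes> b')"
proof -
  have cl: "a \<in> A" "b \<in> A" "a' \<in> A" "b' \<in> A" using assms by (auto simp: lead_def)
  have cR: "a \<in> carrier R" "a' \<in> carrier R" using cl subA by auto
  have z: "(E ^^ Suc d) b = \<zero>" "(E ^^ Suc e) b' = \<zero>" using assms by (auto simp: lead_def)
  have z2: "(E ^^ Suc (Suc d)) b = \<zero>" using z(1) deriv_zero[OF A dE] by simp
  have "(E ^^ e) b' \<in> carrier R" using deriv_iter_closed[OF A dE] cl subA by auto
  then have 1: "(E ^^ (Suc d + e)) (b \<otimes> b') = \<zero>"
    using deriv_iter_top[OF A dE cl(2,4) z2 z(2)] z(1) by (simp del: funpow.simps)
  have f: "nat_elem ((d + e) choose d) \<otimes> (nat_elem (fact d) \<otimes> nat_elem (fact e)) = nat_elem (fact (d + e))"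
    using binomial_fact_lemma[of d "d + e"] by (simp add: nat_elem_mult[symmetric] ac_simps)
  have "(E ^^ (d + e)) (b \<otimes> b')
      = nat_elem ((d + e) choose d) \<otimes> ((nat_elem (fact d) \<otimes> a) \<otimes> (nat_elem (fact e) \<otimes> a'))"
    using deriv_iter_top[OF A dE cl(2,4) z] assms by (simp add: lead_def)
  also have "\<dots> = (nat_elem ((d + e) choose d) \<otimes> (nat_elem (fact d) \<otimes> nat_elem (fact e))) \<otimes> (a \<otimes> a')"
    using cR by (simp add: m_ac)
  finally have 2: "(E ^^ (d + e)) (b \<otimes> b') = nat_elem (fact (d + e)) \<otimes> (a \<otimes> a')"
    unfolding f .
  show ?thesis using 1 2 assms cl cR subringE(6)[OF subA(1)] derivD(3)[OF A dE]
    by (simp add: lead_def)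
qed

lemma lead_unique:
  assumes "lead A E d a b" "lead A E d a' b" shows "a = a'"
proof -
  have "nat_elem (fact d) \<otimes> a = nat_elem (fact d) \<otimes> a'" "a \<in> carrier R" "a' \<in> carrier R"
    using assms subA by (auto simp: lead_def)
  then show ?thesis using nat_elem_nonzero[of "fact d"] m_lcancel[of "nat_elem (fact d)"] by auto
qed

lemma lead_exists:
  assumes "b \<in> A" "(E ^^ Suc d) b = \<zero>" shows "\<exists>a. lead A E d a b"
proof -
  obtain u where u: "u \<in> k" "u \<otimes> nat_elem (fact d) = \<one>" by (rule nat_elem_inverse[of "fact d"]) auto
  have uA: "u \<in> A" "E u = \<zero>" "u \<in> carrier R" using u subA derivD(4)[OF A dE] by auto
  have y: "(E ^^ d) b \<in> A" "(E ^^ d) b \<in> carrier R" using deriv_iter_closed[OF A dE assms(1)] subA by auto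
  have "nat_elem (fact d) \<otimes> (u \<otimes> (E ^^ d) b) = (E ^^ d) b"
    using u(2) uA y by (simp add: m_assoc[symmetric] m_comm)
  moreover have "E (u \<otimes> (E ^^ d) b) = \<zero>"
    using deriv_const_mult[OF A dE uA(1,2) y(1)] assms(2) uA by simp
  ultimately have "lead A E d (u \<otimes> (E ^^ d) b) b"
    using assms y uA subringE(6)[OF subA(1)] by (simp add: lead_def)
  then show ?thesis ..
qed

lemma lead_step:
  assumes "lead A E d a b" shows "lead A E (Suc d) \<zero> b"
proof -
  have z: "(E ^^ Suc d) b = \<zero>" using assms unfolding lead_def by blast
  have "(E ^^ Suc (Suc d)) b = E ((E ^^ Suc d) b)" by simp
  then have "(E ^^ Suc (Suc d)) b = \<zero>" unfolding z deriv_zero[OF A dE] .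
  then show ?thesis
    using z assms subringE(2)[OF subA(1)] deriv_zero[OF A dE] by (simp add: lead_def del: funpow.simps)
qed

lemma lead_drop:
  assumes "lead A E (Suc d) \<zero> b" shows "\<exists>a. lead A E d a b"
  using assms by (intro lead_exists) (auto simp: lead_def)

lemma lead_const: "\<lbrakk>a \<in> A; E a = \<zero>\<rbrakk> \<Longrightarrow> lead A E 0 a a"
  using subA by (simp add: lead_def)

lemma lead_0D: "lead A E 0 a b \<Longrightarrow> b = a"
  using subA by (simp add: lead_def)

lemma lead_slice: "lead A E 1 \<one> s"
  using s subringE(3)[OF subA(1)] deriv_one[OF A dE] by (simp add: lead_def)

lemma lead_zero: "lead A E d \<zero> \<zero>"
  using subringE(2)[OF subA(1)] deriv_iter_zero[OF A dE] deriv_zero[OF A dE] by (simp add: lead_def)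

lemma lead_monom:
  assumes "a \<in> A" "E a = \<zero>" shows "lead A E d a (a \<otimes> s [^] d)"
proof (induction d)
  case 0 then show ?case using lead_const[OF assms] assms subA by simp
next
  case (Suc d)
  then show ?case using lead_mult[OF Suc lead_slice] assms s subA by (simp add: m_assoc)
qed

lemma lead_remainder:
  assumes "lead A E (Suc d) a b" shows "\<exists>a'. lead A E d a' (b \<ominus> a \<otimes> s [^] Suc d)"
proof (rule lead_drop)
  have a: "a \<in> A" "E a = \<zero>" "a \<in> carrier R" using assms subA by (auto simp: lead_def)
  show "lead A E (Suc d) \<zero> (b \<ominus> a \<otimes> s [^] Suc d)"
    using lead_add[OF assms lead_minus[OF lead_monom[OF a(1,2)]]] a(3) by (simp add: a_minus_def r_neg)
qed

text \<open>Subtract the leading term and induct: a finite Taylor expansion along \<open>s\<close>.\<close>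
lemma lead_in_adjoin: "lead A E d a b \<Longrightarrow> b \<in> adjoin C s"
proof (induction d arbitrary: a b)
  have sR: "s \<in> carrier R" using s subA by auto
  have base: "C \<subseteq> adjoin C s" by (rule subring_adjoin_base[OF sC(1) sR])
  case 0
  then have "b = a" "a \<in> C" using lead_0D[OF 0] 0 by (simp_all add: lead_def)
  then show ?case using base by blast
next
  have sR: "s \<in> carrier R" using s subA by auto
  note S = adjoin_subring[OF sC(1) sR]
  have base: "C \<subseteq> adjoin C s" by (rule subring_adjoin_base[OF sC(1) sR])
  case (Suc d)
  let ?m = "a \<otimes> s [^] Suc d"
  obtain a' where "lead A E d a' (b \<ominus> ?m)" using lead_remainder[OF Suc.prems] by blast
  then have r: "b \<ominus> ?m \<in> adjoin C s" by (rule Suc.IH)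
  have ab: "a \<in> C" "b \<in> carrier R" using Suc.prems subA by (auto simp: lead_def)
  have m: "?m \<in> adjoin C s"
    using base ab pow_in_subring[OF S adjoin_gen[OF sC(1) sR], of "Suc d"]
    by (intro subringE(6)[OF S]) auto
  have "y = (y \<ominus> z) \<oplus> z" if "y \<in> carrier R" "z \<in> carrier R" for y z using that by algebra
  then have "b = (b \<ominus> ?m) \<oplus> ?m" using ab(2) m subringE(1)[OF S] by blast
  then show ?case using subringE(7)[OF S r m] by simp
qed

lemma slice_generates: "adjoin C s = A"
proof
  show "adjoin C s \<subseteq> A" using adjoin_least[OF subA(1) _ s(1), of C] by auto
  show "A \<subseteq> adjoin C s"
  proof
    fix b assume b: "b \<in> A"
    then obtain n where "(E ^^ n) b = \<zero>" using E by (auto simp: lnd_on_def)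
    then have "(E ^^ Suc n) b = \<zero>" using deriv_zero[OF A dE] by simp
    then obtain a where "lead A E n a b" using lead_exists[OF b] by blast
    then show "b \<in> adjoin C s" by (rule lead_in_adjoin)
  qed
qed

lemma lead_poly_val:
  assumes "\<And>i. c i \<in> C" shows "lead A E n (c n) (poly_val c (Suc n) s)"
proof (induction n)
  have sR: "s \<in> carrier R" using s subA by auto
  have c: "c i \<in> A" "E (c i) = \<zero>" "c i \<in> carrier R" for i using assms[of i] subA by auto
  case 0 then show ?case using lead_const[OF c(1,2)] c sR by simp
next
  have sR: "s \<in> carrier R" using s subA by auto
  have c: "c i \<in> A" "E (c i) = \<zero>" "c i \<in> carrier R" for i using assms[of i] subA by auto
  case (Suc n)
  have "poly_val c (Suc (Suc n)) s = poly_val c (Suc n) s \<oplus> c (Suc n) \<otimes> s [^] Suc n"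
    using c sR by (intro poly_val_Suc_top) auto
  then show ?case using lead_add[OF lead_step[OF Suc] lead_monom[OF c(1,2), of "Suc n"]] c by simp
qed

text \<open>The leading coefficient of \<open>c 0 + \<dots> + c n s^n\<close> is \<open>c n\<close>, and leading coefficients are unique.\<close>
lemma slice_transcendental: "transc_mod {\<zero>} C s"
proof (rule transc_modI)
  have sR: "s \<in> carrier R" using s subA by auto
  fix c n assume cC: "\<And>i. c i \<in> C" and "poly_val c n s \<in> {\<zero>}"
  then have "poly_val c n s = \<zero>" by simp
  then show "\<forall>i<n. c i \<in> {\<zero>}"
  proof (induction n)
    case (Suc n)
    have "lead A E n (c n) (poly_val c (Suc n) s)" using cC by (rule lead_poly_val)
    then have "lead A E n (c n) \<zero>" unfolding Suc.prems .
    then have cn: "c n = \<zero>" using lead_unique lead_zero by blast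
    have "c i \<in> carrier R" for i using cC[of i] subA by auto
    then have "poly_val c (Suc n) s = poly_val c n s \<oplus> c n \<otimes> s [^] n" using sR by (intro poly_val_Suc_top)
    moreover have "poly_val c n s \<in> carrier R"
      using \<open>\<And>i. c i \<in> carrier R\<close> sR by (intro poly_val_closed)
    ultimately have "poly_val c n s = \<zero>" using Suc.prems cn sR by simp
    then show ?case using Suc.IH cn less_Suc_eq by auto
  qed simp
qed

text \<open>The slice has positive degree and the kernel has degree zero. Hence \<open>C\<close> is mapped isomorphically onto the
residues modulo \<open>s\<close>.\<close>
lemma slice_kernel_not_factor:
  assumes "a \<in> C" "b \<in> A" "a = s \<otimes> b" shows "a = \<zero>"
proof (rule ccontr)
  assume a: "a \<noteq> \<zero>"
  have n: "s \<noteq> \<zero>" "b \<noteq> \<zero>" using a assms s subA by auto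
  have "lnd_degree E (s \<otimes> b) = lnd_degree E s + lnd_degree E b" by (rule lnd_degree_mult[OF A E s(1) assms(2) n])
  moreover have "lnd_degree E (s \<otimes> b) = 0" using lnd_degree_eq_0_iff[OF A E, of a] assms a by auto
  ultimately have "E s = \<zero>" using lnd_degree_eq_0_iff[OF A E s(1) n(1)] by simp
  then show False using s(2) by simp
qed

end

lemma first_failure: "\<lbrakk>P (0::nat); \<not> P n\<rbrakk> \<Longrightarrow> \<exists>p. P p \<and> \<not> P (Suc p)"
  by (induction n) auto

text \<open>Write \<open>A = C[s]\<close> with \<open>C = ker E\<close>. As \<open>C\<close> is finitely generated, \<open>D\<close> raises degrees in \<open>s\<close> by a bounded
amount; let \<open>N\<close> be the least bound. The part of \<open>D\<close> of degree \<open>N\<close> is a locally nilpotent derivation of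
\<open>C[s]\<close> that maps \<open>a \<in> C\<close> to \<open>\<delta> a * s^N\<close> and \<open>s\<close> to \<open>c s^(N + 1)\<close>. A locally nilpotent derivation that
maps \<open>s\<close> to a multiple of \<open>s\<close> kills \<open>s\<close>, so \<open>c = 0\<close>. Then \<open>\<delta>\<close> is locally nilpotent on \<open>C\<close>, and it is
non-zero because \<open>N\<close> is least and \<open>D\<close> moves \<open>C\<close>.\<close>
lemma homogenize_on_kernel:
  assumes A: "subalg A" and E: "lnd_on k A E" and s: "s \<in> A" "E s = \<one>"
    and D: "lnd_on k A D" and moves: "a0 \<in> A" "E a0 = \<zero>" "D a0 \<noteq> \<zero>"
    and gs: "adjoins k gs = {a \<in> A. E a = \<zero>}"
    and gsR: "set gs \<subseteq> carrier R"
  shows "\<exists>\<delta>. lnd_on k {a \<in> A. E a = \<zero>} \<delta> \<and> (\<exists>a\<in>A. E a = \<zero> \<and> \<delta> a \<noteq> \<zero>)"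
proof -
  have dE: "derivation_on k A E" and dD: "derivation_on k A D" using E D by (auto simp: lnd_on_def)
  note subA = subalgD[OF A]
  let ?C = "{a \<in> A. E a = \<zero>}"
  note C = kernel_subalg[OF A dE]
  note sC = subalgD[OF C]
  note DD = derivD[OF A dD] and DE = derivD[OF A dE]
  note itE = deriv_iter_closed[OF A dE]
  note lead_unique = lead_unique[OF A E s] and lead_add = lead_add[OF A E s]
    and lead_mult = lead_mult[OF A E s] and lead_step = lead_step[OF A E s]
    and lead_monom = lead_monom[OF A E s] and lead_zero = lead_zero[OF A E s]
  have right: "(E ^^ n) (b \<otimes> a) = (E ^^ n) b \<otimes> a" if "a \<in> A" "E a = \<zero>" "b \<in> A" for n a b
    using deriv_iter_const_mult[OF A dE that, of n] itE[OF that(3), of n] that subA by (simp add: m_comm)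
  have iter_D_mult: "(E ^^ n) (D (a \<otimes> b)) = (E ^^ n) (D a) \<otimes> b \<oplus> a \<otimes> (E ^^ n) (D b)"
    if "a \<in> A" "E a = \<zero>" "b \<in> A" "E b = \<zero>" for n a b
    using that DD deriv_iter_add[OF A dE] right deriv_iter_const_mult[OF A dE] subringE(6)[OF subA(1)]
    by simp
  have "\<exists>n. \<forall>a\<in>?C. (E ^^ n) (D a) = \<zero>"
  proof -
    have "\<exists>n. \<forall>g\<in>set hs. (E ^^ n) (D g) = \<zero>" if "set hs \<subseteq> ?C" for hs
      using that
    proof (induction hs)
      case (Cons h hs)
      then obtain n where n: "\<forall>g\<in>set hs. (E ^^ n) (D g) = \<zero>" by auto
      have "D h \<in> A" using Cons.prems DD by auto
      then obtain m where m: "(E ^^ m) (D h) = \<zero>" using E by (auto simp: lnd_on_def)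
      show ?case
        using deriv_iter_stays_zero[OF A dE, of m "max m n" "D h"] m n
          deriv_iter_stays_zero[OF A dE, of n "max m n"]
        by (intro exI[of _ "max m n"]) auto
    qed simp
    moreover have "set gs \<subseteq> ?C" using adjoins_gens[OF k_subring gsR] gs by simp
    ultimately obtain n where n: "\<forall>g\<in>set gs. (E ^^ n) (D g) = \<zero>" by meson
    let ?F = "{a \<in> ?C. (E ^^ n) (D a) = \<zero>}"
    have "subring ?F R"
    proof (rule subringI)
      show "?F \<subseteq> carrier R" using subA by auto
      show "\<one> \<in> ?F"
        using subringE(3)[OF sC(1)] deriv_one[OF A dD] deriv_iter_zero[OF A dE] by simp
      fix a assume a: "a \<in> ?F"
      have m: "\<ominus> \<one> \<in> A" "E (\<ominus> \<one>) = \<zero>" using subringE(3,5)[OF sC(1)] by auto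
      have "\<ominus> a \<in> ?C" using subringE(5)[OF sC(1)] a by auto
      moreover have "D (\<ominus> a) = \<ominus> \<one> \<otimes> D a" using a deriv_minus[OF A dD] DD(1) subA a_inv_as_mult by simp
      then have "(E ^^ n) (D (\<ominus> a)) = \<zero>"
        using a m DD(1) deriv_iter_const_mult[OF A dE m] subA by simp
      ultimately show "\<ominus> a \<in> ?F" by simp
      fix b assume b: "b \<in> ?F"
      show "a \<otimes> b \<in> ?F" using a b subringE(6)[OF sC(1), of a b] iter_D_mult subA by simp
      show "a \<oplus> b \<in> ?F"
        using a b subringE(7)[OF sC(1), of a b] DD deriv_iter_add[OF A dE] by simp
    qed
    moreover have "k \<subseteq> ?F" using sC(2) DD(4) deriv_iter_zero[OF A dE] by auto
    moreover have "set gs \<subseteq> ?F" using n \<open>set gs \<subseteq> ?C\<close> by auto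
    ultimately have "adjoins k gs \<subseteq> ?F" by (rule adjoins_least)
    then show ?thesis using gs by auto
  qed
  then obtain n0 where n0: "\<forall>a\<in>?C. (E ^^ n0) (D a) = \<zero>" ..
  have "D s \<in> A" using s DD by auto
  then obtain n1 where n1: "(E ^^ n1) (D s) = \<zero>" using E by (auto simp: lnd_on_def)
  \<comment> \<open>\<open>D\<close> raises degrees by at most \<open>N\<close>: on \<open>C\<close>, which has degree zero, and on \<open>s\<close>, which has degree one\<close>
  define bound where "bound N \<longleftrightarrow> (\<forall>a\<in>?C. (E ^^ Suc N) (D a) = \<zero>) \<and> (E ^^ Suc (Suc N)) (D s) = \<zero>" for N
  have "bound (max n0 n1)"
    unfolding bound_def using n0 n1 deriv_iter_stays_zero[OF A dE]
    by (meson le_SucI max.cobounded1 max.cobounded2)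
  define N where "N = (LEAST N. bound N)"
  have N: "bound N" unfolding N_def using \<open>bound (max n0 n1)\<close> by (rule LeastI)
  have least: "\<not> bound M" if "M < N" for M using that not_less_Least unfolding N_def by blast
  obtain u where u: "u \<in> k" "u \<otimes> nat_elem (fact N) = \<one>" by (rule nat_elem_inverse[of "fact N"]) auto
  have uC: "u \<in> A" "E u = \<zero>" "u \<in> carrier R" using u subA DE(4) by auto
  define \<delta> where "\<delta> a = u \<otimes> (E ^^ N) (D a)" for a
  have \<delta>C: "\<delta> a \<in> ?C" and lead_\<delta>: "lead A E N (\<delta> a) (D a)" if a: "a \<in> ?C" for a
  proof -
    have Da: "D a \<in> A" "(E ^^ Suc N) (D a) = \<zero>" using a DD N by (auto simp: bound_def)
    note y = itE[OF Da(1), of N]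
    show dC: "\<delta> a \<in> ?C"
      using subringE(6)[OF subA(1) uC(1) y] deriv_const_mult[OF A dE uC(1,2) y] Da(2) uC(3)
      by (simp add: \<delta>_def)
    have "nat_elem (fact N) \<otimes> \<delta> a = (E ^^ N) (D a)"
      unfolding \<delta>_def using u(2) uC subA(3)[OF y] by (simp add: m_assoc[symmetric] m_comm)
    then show "lead A E N (\<delta> a) (D a)" using dC Da by (simp add: lead_def)
  qed
  obtain c where c: "lead A E (Suc N) c (D s)"
    using lead_exists[OF A E s \<open>D s \<in> A\<close>, of "Suc N"] N by (auto simp: bound_def)
  then have cC: "c \<in> ?C" "c \<in> carrier R" using subA by (auto simp: lead_def)
  have \<delta>_add: "\<delta> (a \<oplus> b) = \<delta> a \<oplus> \<delta> b" if "a \<in> ?C" "b \<in> ?C" for a b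
    unfolding \<delta>_def using that DD deriv_iter_add[OF A dE] itE uC subA by (simp add: r_distr)
  have \<delta>_mult: "\<delta> (a \<otimes> b) = \<delta> a \<otimes> b \<oplus> a \<otimes> \<delta> b" if "a \<in> ?C" "b \<in> ?C" for a b
  proof -
    have "\<delta> (a \<otimes> b) = u \<otimes> ((E ^^ N) (D a) \<otimes> b \<oplus> a \<otimes> (E ^^ N) (D b))"
      unfolding \<delta>_def using that iter_D_mult by simp
    also have "u \<otimes> (y \<otimes> b \<oplus> a \<otimes> z) = (u \<otimes> y) \<otimes> b \<oplus> a \<otimes> (u \<otimes> z)"
      if "y \<in> carrier R" "z \<in> carrier R" for y z
      using that \<open>a \<in> ?C\<close> \<open>b \<in> ?C\<close> subA uC(3) by (simp add: r_distr m_ac)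
    then have "u \<otimes> ((E ^^ N) (D a) \<otimes> b \<oplus> a \<otimes> (E ^^ N) (D b)) = \<delta> a \<otimes> b \<oplus> a \<otimes> \<delta> b"
      unfolding \<delta>_def using that itE DD(1) subA by simp
    finally show ?thesis .
  qed
  have \<delta>_k: "\<delta> x = \<zero>" if "x \<in> k" for x
    unfolding \<delta>_def using DD(4)[OF that] deriv_iter_zero[OF A dE] uC by simp
  \<comment> \<open>the coefficient of \<open>s^(d + N)\<close> in \<open>D (a s^d)\<close>\<close>
  define T where "T d a = \<delta> a \<oplus> nat_elem d \<otimes> (c \<otimes> a)" for d a
  have natC: "nat_elem d \<in> ?C" for d using nat_elem_in_subring[OF sC(1)] .
  have T_closed: "T d a \<in> ?C" if "a \<in> ?C" for d a
    unfolding T_def using \<delta>C[OF that] subringE(6)[OF sC(1) natC subringE(6)[OF sC(1) cC(1) that]]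
    by (intro subringE(7)[OF sC(1)])
  have T_add: "T d (a \<oplus> b) = T d a \<oplus> T d b" if "a \<in> ?C" "b \<in> ?C" for d a b
  proof -
    have "(p \<oplus> q) \<oplus> m \<otimes> (c \<otimes> (a \<oplus> b)) = (p \<oplus> m \<otimes> (c \<otimes> a)) \<oplus> (q \<oplus> m \<otimes> (c \<otimes> b))"
      if "a \<in> carrier R" "b \<in> carrier R" "p \<in> carrier R" "q \<in> carrier R" "m \<in> carrier R" for a b p q m
      using that cC(2) by algebra
    then show ?thesis unfolding T_def \<delta>_add[OF that]
      using that \<delta>C[OF that(1)] \<delta>C[OF that(2)] sC(3) by blast
  qed
  have T_mult: "T (j + l) (a \<otimes> b) = T j a \<otimes> b \<oplus> a \<otimes> T l b" if "a \<in> ?C" "b \<in> ?C" for j l a b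
  proof -
    have "(p \<otimes> b \<oplus> a \<otimes> q) \<oplus> (m \<oplus> n) \<otimes> (c \<otimes> (a \<otimes> b))
        = (p \<oplus> m \<otimes> (c \<otimes> a)) \<otimes> b \<oplus> a \<otimes> (q \<oplus> n \<otimes> (c \<otimes> b))"
      if "a \<in> carrier R" "b \<in> carrier R" "p \<in> carrier R" "q \<in> carrier R" "m \<in> carrier R" "n \<in> carrier R"
      for a b p q m n
      using that cC(2) by algebra
    note ring = this[OF sC(3)[OF that(1)] sC(3)[OF that(2)] sC(3)[OF \<delta>C[OF that(1)]]
        sC(3)[OF \<delta>C[OF that(2)]] nat_elem_closed nat_elem_closed]
    show ?thesis unfolding T_def \<delta>_mult[OF that] nat_elem_add by (rule ring)
  qed
  have lead_T: "lead A E (d + N) (T d a) (D b)" if "lead A E d a b" for d a b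
    using that
  proof (induction d arbitrary: a b)
    case 0
    then have "b = a" "a \<in> ?C" using lead_0D[OF A E s 0] 0 by (simp_all add: lead_def)
    then show ?case using lead_\<delta> \<delta>C sC(3) cC by (simp add: T_def)
  next
    case (Suc e)
    have a: "a \<in> A" "E a = \<zero>" "a \<in> ?C" "b \<in> A" using Suc.prems by (auto simp: lead_def)
    let ?m = "a \<otimes> s [^] e" and ?r = "b \<ominus> a \<otimes> s [^] Suc e"
    obtain a' where a': "lead A E e a' ?r" using lead_remainder[OF A E s Suc.prems] by blast
    have "lead A E (Suc e + N) \<zero> (D ?r)" using lead_step[OF Suc.IH[OF a']] by simp
    moreover have "lead A E (Suc e + N) (T (Suc e) a) (D (?m \<otimes> s))"
    proof -
      have m: "lead A E e a ?m" "?m \<in> A" using lead_monom[OF a(1,2), of e] by (auto simp: lead_def)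
      have 1: "lead A E (Suc e + N) (T e a) (D ?m \<otimes> s)"
        using lead_mult[OF Suc.IH[OF m(1)] lead_slice[OF A E s]] T_closed[OF a(3), of e] sC(3)
        by simp
      have 2: "lead A E (Suc e + N) (a \<otimes> c) (?m \<otimes> D s)" using lead_mult[OF m(1) c] by simp
      have "T e a \<oplus> a \<otimes> c = T (Suc e) a"
        unfolding T_def using \<delta>C[OF a(3)] sC(3) a cC
        by (simp add: nat_elem_Suc l_distr m_comm[of a c] a_assoc)
      then show ?thesis using lead_add[OF 1 2] DD(3)[OF m(2) s(1)] by simp
    qed
    ultimately have "lead A E (Suc e + N) (\<zero> \<oplus> T (Suc e) a) (D ?r \<oplus> D (?m \<otimes> s))" by (rule lead_add)
    moreover have "?m \<otimes> s = a \<otimes> s [^] Suc e" using a s subA by (simp add: m_assoc)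
    moreover have "?r \<in> A" using a' by (simp add: lead_def)
    moreover have "a \<otimes> s [^] Suc e \<in> A" using lead_monom[OF a(1,2), of "Suc e"] by (simp add: lead_def)
    moreover have "y = (y \<ominus> z) \<oplus> z" if "y \<in> carrier R" "z \<in> carrier R" for y z using that by algebra
    then have "b = ?r \<oplus> a \<otimes> s [^] Suc e" using a(4) \<open>a \<otimes> s [^] Suc e \<in> A\<close> subA(3) by blast
    ultimately show ?case using DD(2)[of ?r "a \<otimes> s [^] Suc e"] T_closed[OF a(3), of "Suc e"] sC(3)
      by simp
  qed
  let ?It = "iterate_graded T N"
  have lead_It: "lead A E (j + n * N) (?It n j a) ((D ^^ n) b)" if "lead A E j a b" for j a b n
  proof (induction n)
    case (Suc n)
    show ?case using lead_T[OF Suc] by (simp add: ac_simps)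
  qed (use that in simp)
  have It_nil: "\<exists>n. ?It n j a = \<zero>" if "a \<in> ?C" for j a
  proof -
    have m: "lead A E j a (a \<otimes> s [^] j)" using lead_monom that by simp
    then have "a \<otimes> s [^] j \<in> A" by (simp add: lead_def)
    then obtain n where "(D ^^ n) (a \<otimes> s [^] j) = \<zero>" using D by (auto simp: lnd_on_def)
    then have "lead A E (j + n * N) (?It n j a) \<zero>" using lead_It[OF m, of n] by simp
    then show ?thesis using lead_unique lead_zero by blast
  qed
  have It_last: "\<exists>p. ?It p j a \<noteq> \<zero> \<and> ?It (Suc p) j a = \<zero>" if a: "a \<in> ?C" "a \<noteq> \<zero>" for j a
  proof -
    obtain n where "?It n j a = \<zero>" using It_nil[OF a(1)] by blast
    then show ?thesis using first_failure[of "\<lambda>n. ?It n j a \<noteq> \<zero>" n] a(2) by auto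
  qed
  have oneC: "\<one> \<in> ?C" using subringE(3)[OF sC(1)] .
  \<comment> \<open>Let \<open>p\<close> and \<open>q\<close> be the degrees of \<open>s\<close> and \<open>c s^N\<close> with respect to the leading part of \<open>D\<close>. Then
    \<open>c s^(N + 1)\<close> has degree \<open>p + q\<close>, but it is the image of \<open>s\<close>, of degree \<open>p - 1\<close>.\<close>
  have c0: "c = \<zero>"
  proof (rule ccontr)
    assume "c \<noteq> \<zero>"
    obtain p where p: "?It p 1 \<one> \<noteq> \<zero>" "?It (Suc p) 1 \<one> = \<zero>" using It_last[OF oneC one_not_zero] by blast
    obtain q where q: "?It q N c \<noteq> \<zero>" "?It (Suc q) N c = \<zero>" using It_last[OF cC(1) \<open>c \<noteq> \<zero>\<close>] by blast
    have "?It (q + p) (N + 1) (c \<otimes> \<one>) \<noteq> \<zero>"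
      by (rule iterate_graded_top_nonzero[of ?C T])
        (use sC(1) T_closed T_add T_mult cC(1) oneC p q in blast)+
    moreover have "T 1 \<one> = c"
      using \<delta>_k subringE(3)[OF k_subring] cC by (simp add: T_def)
    ultimately have "?It (Suc (q + p)) 1 \<one> \<noteq> \<zero>"
      using cC(2) iterate_graded_front[of T N "q + p" 1 \<one>] by simp
    moreover have "?It (Suc (q + p)) 1 \<one> = \<zero>"
      by (rule iterate_graded_stays_zero[of ?C T "Suc p"])
        (use sC(1) T_closed T_add T_mult p in \<open>blast | simp\<close>)+
    ultimately show False by simp
  qed
  have T_eq: "T d a = \<delta> a" if "a \<in> ?C" for d a
    using \<delta>C[OF that] sC(3) that by (simp add: T_def c0)
  have "derivation_on k ?C \<delta>"
    unfolding derivation_on_def using \<delta>C \<delta>_add \<delta>_mult \<delta>_k by blast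
  moreover have "\<exists>n. (\<delta> ^^ n) a = \<zero>" if a: "a \<in> ?C" for a
  proof -
    have "(\<delta> ^^ n) a \<in> ?C \<and> ?It n 0 a = (\<delta> ^^ n) a" for n
    proof (induction n)
      case (Suc n)
      then have dn: "(\<delta> ^^ n) a \<in> ?C" and eq: "?It n 0 a = (\<delta> ^^ n) a" by blast+
      show ?case using \<delta>C[OF dn] T_eq[OF dn, of "n * N"] eq by simp
    qed (use a in simp)
    then show ?thesis using It_nil[OF a, of 0] by metis
  qed
  ultimately have "lnd_on k ?C \<delta>" by (auto simp: lnd_on_def)
  moreover have "\<exists>a\<in>?C. \<delta> a \<noteq> \<zero>"
  proof (rule ccontr)
    assume no: "\<not> ?thesis"
    have van: "(E ^^ N) (D a) = \<zero>" if "a \<in> ?C" for a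
      using lead_\<delta>[OF that] no that by (simp add: lead_def)
    have "(E ^^ Suc N) (D s) = \<zero>" using c c0 by (simp add: lead_def)
    show False
    proof (cases N)
      case 0
      then show False using van[of a0] moves by simp
    next
      case (Suc M)
      then have "bound M" unfolding bound_def using van \<open>(E ^^ Suc N) (D s) = \<zero>\<close> by simp
      then show False using least[of M] Suc by simp
    qed
  qed
  ultimately show ?thesis by blast
qed

text \<open>Let the derivation act on the coefficients of polynomials in \<open>s\<close>. As \<open>s\<close> is transcendental, the
coefficients of an element are determined, up to trailing zeros.\<close>
lemma extend_lnd:
  assumes C: "subalg C" and s: "s \<in> carrier R" "transc_mod {\<zero>} C s" and E: "lnd_on k C E"
  shows "\<exists>E'. lnd_on k (adjoin C s) E' \<and> (\<forall>a\<in>C. E' a = E a)"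
proof -
  note sC = subalgD[OF C]
  have dE: "derivation_on k C E" using E by (simp add: lnd_on_def)
  note DE = derivD[OF C dE]
  note zero = subringE(2)[OF sC(1)]
  \<comment> \<open>\<open>z\<close> arises from some expansion of \<open>y\<close> by applying \<open>E\<close> to the coefficients\<close>
  define rel where "rel y z \<longleftrightarrow> (\<exists>c n. (\<forall>i. c i \<in> C) \<and> y = poly_val c n s \<and> z = poly_val (\<lambda>i. E (c i)) n s)" for y z
  have Etrunc: "poly_val (\<lambda>i. E (trunc n c i)) m s = poly_val (\<lambda>i. E (c i)) n s"
    if "n \<le> m" "\<forall>i. c i \<in> C" for n m c
  proof -
    have "(\<lambda>i. E (trunc n c i)) = trunc n (\<lambda>i. E (c i))"
      using deriv_zero[OF C dE] by (auto simp: trunc_def)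
    then show ?thesis using poly_val_trunc[of n m "\<lambda>i. E (c i)" s] that s(1) sC(3) DE(1) by simp
  qed
  have common: "\<exists>c' d'. (\<forall>i. c' i \<in> C) \<and> (\<forall>i. d' i \<in> C) \<and> poly_val c n s = poly_val c' (max n m) s \<and>
      poly_val d m s = poly_val d' (max n m) s \<and> poly_val (\<lambda>i. E (c i)) n s = poly_val (\<lambda>i. E (c' i)) (max n m) s \<and>
      poly_val (\<lambda>i. E (d i)) m s = poly_val (\<lambda>i. E (d' i)) (max n m) s"
    if "\<forall>i. c i \<in> C" "\<forall>i. d i \<in> C" for c d n m
    using that s(1) sC(3) zero Etrunc
    by (intro exI[of _ "trunc n c"] exI[of _ "trunc m d"]) (auto simp: poly_val_trunc, auto simp: trunc_def)
  have unique: "z = z'" if r: "rel y z" "rel y z'" for y z z'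
  proof -
    obtain c n where c: "\<forall>i. c i \<in> C" "y = poly_val c n s" "z = poly_val (\<lambda>i. E (c i)) n s"
      using r(1) unfolding rel_def by blast
    obtain d m where d: "\<forall>i. d i \<in> C" "y = poly_val d m s" "z' = poly_val (\<lambda>i. E (d i)) m s"
      using r(2) unfolding rel_def by blast
    let ?N = "max n m"
    obtain c' d' where c': "\<forall>i. c' i \<in> C" "\<forall>i. d' i \<in> C" "y = poly_val c' ?N s" "y = poly_val d' ?N s"
      "z = poly_val (\<lambda>i. E (c' i)) ?N s" "z' = poly_val (\<lambda>i. E (d' i)) ?N s"
      using common[OF c(1) d(1), of n m] c d by auto
    have cR: "c' i \<in> carrier R" "d' i \<in> carrier R" for i using c' sC(3) by auto
    have "poly_val (\<lambda>i. c' i \<oplus> (\<ominus> \<one>) \<otimes> d' i) ?N s = y \<oplus> (\<ominus> \<one>) \<otimes> y"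
      using cR s(1) c'(3,4) by (simp add: poly_val_add poly_val_smult)
    also have "\<dots> = \<zero>" using c'(3) cR s(1) by (simp add: a_inv_as_mult r_neg)
    finally have "poly_val (\<lambda>i. c' i \<oplus> (\<ominus> \<one>) \<otimes> d' i) ?N s \<in> {\<zero>}" by simp
    moreover have "c' i \<oplus> (\<ominus> \<one>) \<otimes> d' i \<in> C" for i
    proof -
      have "\<ominus> \<one> \<otimes> d' i \<in> C"
        using c'(2) by (intro subringE(6)[OF sC(1) subringE(5)[OF sC(1) subringE(3)[OF sC(1)]]]) simp
      then show ?thesis using c'(1) by (intro subringE(7)[OF sC(1)]) auto
    qed
    ultimately have "c' i \<oplus> (\<ominus> \<one>) \<otimes> d' i = \<zero>" if "i < ?N" for i
      using transc_modD[OF s(2), of "\<lambda>i. c' i \<oplus> (\<ominus> \<one>) \<otimes> d' i" ?N i] that by simp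
    then have "c' i \<oplus> \<ominus> d' i = \<zero>" if "i < ?N" for i
      using that cR[of i] a_inv_as_mult by metis
    then have "c' i = d' i" if "i < ?N" for i
      using that cR[of i] r_right_minus_eq[OF cR(1)[of i] cR(2)[of i]]
      by (simp add: a_minus_def)
    then show ?thesis unfolding c'(5,6) by (intro poly_val_cong) simp
  qed
  define F where "F y = (THE z. rel y z)" for y
  have F_eq: "F y = z" if "rel y z" for y z
    unfolding F_def using that unique by (intro the_equality) auto
  have F_poly_val: "F (poly_val c n s) = poly_val (\<lambda>i. E (c i)) n s" if "\<forall>i. c i \<in> C" for c n
    using that by (intro F_eq) (auto simp: rel_def)
  let ?A = "adjoin C s"
  note S = adjoin_subring[OF sC(1) s(1)]
  have SR: "y \<in> ?A \<Longrightarrow> y \<in> carrier R" for y using subringE(1)[OF S] by auto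
  have F_closed: "F y \<in> ?A" if y: "y \<in> ?A" for y
  proof -
    obtain c n where c: "\<forall>i. c i \<in> C" "y = poly_val c n s" using y unfolding adjoin_def by blast
    show ?thesis unfolding c(2) F_poly_val[OF c(1)] using c(1) DE(1) by (intro adjoinI) simp
  qed
  have F_C: "F a = E a" if "a \<in> C" for a
    using F_poly_val[of "\<lambda>_. a" 1] that sC(3) DE(1) s(1) by simp
  have F_add: "F (y \<oplus> z) = F y \<oplus> F z" if yz: "y \<in> ?A" "z \<in> ?A" for y z
  proof -
    obtain c n where c: "\<forall>i. c i \<in> C" "y = poly_val c n s" using yz(1) unfolding adjoin_def by blast
    obtain d m where d: "\<forall>i. d i \<in> C" "z = poly_val d m s" using yz(2) unfolding adjoin_def by blast
    obtain c' d' where c': "\<forall>i. c' i \<in> C" "\<forall>i. d' i \<in> C" "y = poly_val c' (max n m) s" "z = poly_val d' (max n m) s"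
      using common[OF c(1) d(1), of n m] c d by auto
    have "y \<oplus> z = poly_val (\<lambda>i. c' i \<oplus> d' i) (max n m) s"
      using c' sC(3) s(1) by (simp add: poly_val_add)
    then have "F (y \<oplus> z) = poly_val (\<lambda>i. E (c' i \<oplus> d' i)) (max n m) s"
      using F_poly_val[of "\<lambda>i. c' i \<oplus> d' i"] c' subringE(7)[OF sC(1)] by simp
    also have "\<dots> = poly_val (\<lambda>i. E (c' i)) (max n m) s \<oplus> poly_val (\<lambda>i. E (d' i)) (max n m) s"
      using c' DE sC(3) s(1) by (simp add: poly_val_add)
    finally show ?thesis using F_poly_val c' by simp
  qed
  have F_s: "F (s \<otimes> y) = s \<otimes> F y" if y: "y \<in> ?A" for y
  proof -
    obtain c n where c: "\<forall>i. c i \<in> C" "y = poly_val c n s" using y unfolding adjoin_def by blast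
    have "\<forall>i. case_nat \<zero> c i \<in> C" using c zero by (auto split: nat.split)
    then have "F (poly_val (case_nat \<zero> c) (Suc n) s) = poly_val (\<lambda>i. E (case_nat \<zero> c i)) (Suc n) s"
      by (rule F_poly_val)
    moreover have "poly_val c n s \<in> carrier R" "poly_val (\<lambda>i. E (c i)) n s \<in> carrier R"
      using c DE(1) sC(3) s(1) by (auto intro!: poly_val_closed)
    ultimately show ?thesis using c F_poly_val[OF c(1)] deriv_zero[OF C dE] s(1) by simp
  qed
  have F_smult: "F (a \<otimes> y) = E a \<otimes> y \<oplus> a \<otimes> F y" if a: "a \<in> C" and y: "y \<in> ?A" for a y
  proof -
    obtain c n where c: "\<forall>i. c i \<in> C" "y = poly_val c n s" using y unfolding adjoin_def by blast
    have "a \<otimes> y = poly_val (\<lambda>i. a \<otimes> c i) n s" using c a sC(3) s(1) by (simp add: poly_val_smult)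
    then have "F (a \<otimes> y) = poly_val (\<lambda>i. E (a \<otimes> c i)) n s"
      using F_poly_val[of "\<lambda>i. a \<otimes> c i"] c a subringE(6)[OF sC(1)] by simp
    also have "\<dots> = poly_val (\<lambda>i. E a \<otimes> c i \<oplus> a \<otimes> E (c i)) n s" using c a DE by simp
    also have "\<dots> = E a \<otimes> y \<oplus> a \<otimes> poly_val (\<lambda>i. E (c i)) n s"
      using c a DE(1) sC(3) s(1) by (simp add: poly_val_add poly_val_smult)
    finally show ?thesis using F_poly_val[OF c(1)] c(2) by simp
  qed
  have F_mult: "F (y \<otimes> z) = F y \<otimes> z \<oplus> y \<otimes> F z" if y: "y \<in> ?A" and z: "z \<in> ?A" for y z
  proof -
    obtain c n where c: "\<forall>i. c i \<in> C" "y = poly_val c n s" using y unfolding adjoin_def by blast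
    have "F (poly_val c n s \<otimes> z) = F (poly_val c n s) \<otimes> z \<oplus> poly_val c n s \<otimes> F z" using c(1)
    proof (induction n arbitrary: c)
      case 0
      have "F \<zero> = \<zero>" using F_C[OF zero] deriv_zero[OF C dE] by simp
      then show ?case using z F_closed[OF z] SR by simp
    next
      case (Suc n)
      let ?y = "poly_val (\<lambda>i. c (Suc i)) n s"
      have "\<forall>i. c (Suc i) \<in> C" using Suc.prems by simp
      note IH = Suc.IH[OF this]
      have y: "?y \<in> ?A" using Suc.prems by (intro adjoinI) simp
      have c0: "c 0 \<in> C" using Suc.prems by simp
      have c0A: "c 0 \<in> ?A" using c0 subring_adjoin_base[OF sC(1) s(1)] by auto
      have subA: "s \<in> ?A" by (rule adjoin_gen[OF sC(1) s(1)])
      note mem = subringE(6)[OF S]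
      have 1: "F (poly_val c (Suc n) s) = E (c 0) \<oplus> s \<otimes> F ?y"
        using F_add[OF c0A mem[OF subA y]] F_C[OF c0] F_s[OF y] by simp
      have "poly_val c (Suc n) s \<otimes> z = c 0 \<otimes> z \<oplus> s \<otimes> (?y \<otimes> z)"
        using c0 sC(3) s(1) y z SR by (simp add: l_distr m_assoc)
      then have "F (poly_val c (Suc n) s \<otimes> z) = F (c 0 \<otimes> z) \<oplus> F (s \<otimes> (?y \<otimes> z))"
        using F_add[OF mem[OF c0A z] mem[OF subA mem[OF y z]]] by simp
      also have "\<dots> = (E (c 0) \<otimes> z \<oplus> c 0 \<otimes> F z) \<oplus> s \<otimes> (F ?y \<otimes> z \<oplus> ?y \<otimes> F z)"
        using F_smult[OF c0 z] F_s[OF mem[OF y z]] IH by simp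
      also have "(e \<otimes> z \<oplus> p \<otimes> w) \<oplus> s \<otimes> (q \<otimes> z \<oplus> r \<otimes> w) = (e \<oplus> s \<otimes> q) \<otimes> z \<oplus> (p \<oplus> s \<otimes> r) \<otimes> w"
        if "e \<in> carrier R" "p \<in> carrier R" "w \<in> carrier R" "q \<in> carrier R" "r \<in> carrier R" "z \<in> carrier R"
        for e p w q r z using that s(1) by algebra
      then have "(E (c 0) \<otimes> z \<oplus> c 0 \<otimes> F z) \<oplus> s \<otimes> (F ?y \<otimes> z \<oplus> ?y \<otimes> F z)
          = (E (c 0) \<oplus> s \<otimes> F ?y) \<otimes> z \<oplus> (c 0 \<oplus> s \<otimes> ?y) \<otimes> F z"
        using sC(3)[OF DE(1)[OF c0]] sC(3)[OF c0] SR[OF F_closed[OF z]] SR[OF F_closed[OF y]]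
          SR[OF y] SR[OF z] by simp
      finally show ?case unfolding 1 by simp
    qed
    then show ?thesis using c(2) by simp
  qed
  have "derivation_on k ?A F"
    unfolding derivation_on_def using F_closed F_add F_mult F_C DE(4) sC(2) by (auto simp: subset_iff)
  moreover have "\<exists>n. (F ^^ n) y = \<zero>" if y: "y \<in> ?A" for y
  proof -
    obtain c n where c: "\<forall>i. c i \<in> C" "y = poly_val c n s" using y unfolding adjoin_def by blast
    have iter: "(F ^^ m) y = poly_val (\<lambda>i. (E ^^ m) (c i)) n s" for m
      using c by (induction m) (auto simp: F_poly_val deriv_iter_closed[OF C dE])
    have "\<forall>i. \<exists>m. (E ^^ m) (c i) = \<zero>" using c E by (auto simp: lnd_on_def)
    then obtain m where m: "\<And>i. (E ^^ m i) (c i) = \<zero>" by metis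
    define M where "M = Max (insert 0 (m ` {..<n}))"
    have "m i \<le> M" if "i < n" for i unfolding M_def using that by (intro Max_ge) auto
    then have "(E ^^ M) (c i) = \<zero>" if "i < n" for i
      using deriv_iter_stays_zero[OF C dE _ m] that by blast
    then have "poly_val (\<lambda>i. (E ^^ M) (c i)) n s = poly_val (\<lambda>i. \<zero>) n s" by (intro poly_val_cong) simp
    then show ?thesis using iter[of M] s(1) by auto
  qed
  ultimately show ?thesis using F_C by (intro exI[of _ F]) (auto simp: lnd_on_def)
qed

end

section \<open>Residues modulo a prime element\<close>

lemma (in cring) transc_mod_drop:
  assumes "transc_mod Q A x" "A \<inter> Q \<subseteq> {\<zero>}" "\<zero> \<in> Q" shows "transc_mod {\<zero>} A x"
proof (rule transc_modI)
  fix c n assume c: "\<And>i. c i \<in> A" "poly_val c n x \<in> {\<zero>}"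
  then have "c i \<in> Q" if "i < n" for i
    using transc_modD[of Q A x c n i] assms that by auto
  then show "\<forall>i<n. c i \<in> {\<zero>}" using c(1) assms(2) by blast
qed

text \<open>A relation that holds exactly holds modulo \<open>Q\<close>, and coefficients from \<open>A\<close> that lie in \<open>Q\<close> vanish.
The second part carries the hypothesis on \<open>A\<close> up the tower.\<close>
lemma (in cring) tower_drop:
  assumes "tower Q A xs" "subring A R" "A \<inter> Q \<subseteq> {\<zero>}" "\<zero> \<in> Q"
  shows "tower {\<zero>} A xs \<and> adjoins A xs \<inter> Q \<subseteq> {\<zero>}"
  using assms(1-3)
proof (induction xs arbitrary: A)
  case (Cons x xs)
  have x: "x \<in> carrier R" "transc_mod Q A x" "tower Q (adjoin A x) xs" using Cons.prems by auto
  have "adjoin A x \<inter> Q \<subseteq> {\<zero>}"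
  proof
    fix y assume y: "y \<in> adjoin A x \<inter> Q"
    then obtain c n where c: "\<forall>i. c i \<in> A" "y = poly_val c n x" unfolding adjoin_def by blast
    have "c i = \<zero>" if "i < n" for i
      using transc_modD[OF x(2), of c n i] c y that Cons.prems(3) by blast
    then have "y = poly_val (\<lambda>_. \<zero>) n x" unfolding c(2) by (intro poly_val_cong) simp
    then show "y \<in> {\<zero>}" using x(1) by simp
  qed
  then show ?case
    using Cons.IH[OF x(3) adjoin_subring[OF Cons.prems(2) x(1)]] x transc_mod_drop Cons.prems assms(4)
    by simp
qed simp

text \<open>In a relation for \<open>p\<close> the constant coefficient is a multiple of \<open>p\<close>, hence in \<open>Q\<close>; since \<open>Q\<close> meets the
ring generated by the tower only in zero, it vanishes, and the relation can be divided by \<open>p\<close>.\<close>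
lemma (in domain) tower_add_prime:
  assumes k: "subring A R" "A \<inter> Q \<subseteq> {\<zero>}" and Q: "ideal Q R" and p: "p \<in> Q" "p \<noteq> \<zero>"
    and xs: "tower Q A xs"
  shows "tower {\<zero>} A (xs @ [p])"
proof -
  interpret Q: ideal Q R by (rule Q)
  have pR: "p \<in> carrier R" using p Q.Icarr by auto
  have d: "tower {\<zero>} A xs" "adjoins A xs \<inter> Q \<subseteq> {\<zero>}"
    using tower_drop[OF xs k] Q.zero_closed by auto
  let ?A = "adjoins A xs"
  have AR: "?A \<subseteq> carrier R"
    using subringE(1)[OF adjoins_subring(1)[OF k(1) tower_carrier[OF xs]]] .
  have "transc_mod {\<zero>} ?A p"
  proof (rule transc_modI)
    fix c n assume "\<And>i. c i \<in> ?A" "poly_val c n p \<in> {\<zero>}"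
    then show "\<forall>i<n. c i \<in> {\<zero>}"
    proof (induction n arbitrary: c)
      case (Suc n)
      let ?P = "poly_val (\<lambda>i. c (Suc i)) n p"
      have cl: "?P \<in> carrier R" "c 0 \<in> carrier R" using Suc.prems(1) AR pR by auto
      have z: "c 0 \<oplus> p \<otimes> ?P = \<zero>" using Suc.prems(2) by simp
      then have "c 0 = \<ominus> (p \<otimes> ?P)" using cl pR by (intro minus_equality[symmetric]) auto
      then have "c 0 \<in> Q" using Q.I_r_closed[OF p(1) cl(1)] Q.a_inv_closed by auto
      then have c0: "c 0 = \<zero>" using Suc.prems(1)[of 0] d(2) by blast
      then have "?P = \<zero>" using z cl pR p(2) integral_iff by auto
      then have "\<forall>i<n. c (Suc i) \<in> {\<zero>}" using Suc.IH[of "\<lambda>i. c (Suc i)"] Suc.prems(1) by simp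
      then show ?case using c0 less_Suc_eq_0_disj by auto
    qed simp
  qed
  then show ?thesis using d(1) pR by (simp add: tower_append)
qed

context char0_domain
begin

lemma k_inter_prime: "primeideal Q R \<Longrightarrow> k \<inter> Q \<subseteq> {\<zero>}"
  using subfield_unit_notin[OF _ subfield_k] by blast

lemma deriv_pow:
  assumes A: "subalg A" and D: "derivation_on k A D" and g: "g \<in> A"
  shows "D (g [^] Suc n) = nat_elem (Suc n) \<otimes> g [^] n \<otimes> D g"
proof (induction n)
  have gR: "g \<in> carrier R" "D g \<in> carrier R" using g derivD(1)[OF A D] subalgD(3)[OF A] by auto
  case 0 then show ?case using gR by simp
next
  have gR: "g \<in> carrier R" "D g \<in> carrier R" using g derivD(1)[OF A D] subalgD(3)[OF A] by auto
  case (Suc n)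
  have m: "g [^] Suc n \<in> A" by (rule pow_in_subring[OF subalgD(1)[OF A] g])
  have "D (g [^] Suc (Suc n)) = D (g [^] Suc n) \<otimes> g \<oplus> g [^] Suc n \<otimes> D g"
    using derivD(3)[OF A D m g] by simp
  also have "\<dots> = nat_elem (Suc n) \<otimes> g [^] n \<otimes> D g \<otimes> g \<oplus> g [^] Suc n \<otimes> D g" unfolding Suc ..
  also have "m \<otimes> y \<otimes> d \<otimes> g \<oplus> y \<otimes> g \<otimes> d = (m \<oplus> \<one>) \<otimes> (y \<otimes> g) \<otimes> d"
    if "m \<in> carrier R" "y \<in> carrier R" "d \<in> carrier R" for m y d
    using that gR(1) by algebra
  then have "nat_elem (Suc n) \<otimes> g [^] n \<otimes> D g \<otimes> g \<oplus> g [^] Suc n \<otimes> D g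
      = (nat_elem (Suc n) \<oplus> \<one>) \<otimes> g [^] Suc n \<otimes> D g"
    using gR by simp
  finally show ?case by (simp add: nat_elem_Suc)
qed

text \<open>Applying \<open>D\<close> to a relation for \<open>g\<close> over \<open>B\<close> gives, modulo \<open>Q\<close>, the product of \<open>D g\<close> with the formal
derivative: a relation of smaller degree.\<close>
lemma transc_mod_of_derivation:
  assumes A: "subalg A" and D: "derivation_on k A D" and Q: "primeideal Q R"
    and stable: "\<And>a. a \<in> A \<Longrightarrow> a \<in> Q \<Longrightarrow> D a \<in> Q"
    and B: "subalg B" "B \<subseteq> A" "\<And>b. b \<in> B \<Longrightarrow> D b \<in> Q"
    and g: "g \<in> A" "D g \<notin> Q"
  shows "transc_mod Q B g"
proof -
  interpret Q: primeideal Q R by (rule Q)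
  note QI = Q.ideal_axioms
  note sA = subalgD[OF A] and sB = subalgD[OF B(1)] and DD = derivD[OF A D]
  have gR: "g \<in> carrier R" "D g \<in> carrier R" using g DD(1) sA by auto
  \<comment> \<open>the chain rule modulo \<open>Q\<close>: the derivatives of the coefficients vanish there\<close>
  have deriv_poly_val: "cong_mod Q (D (poly_val c (Suc m) g)) (D g \<otimes> poly_val (\<lambda>i. nat_elem (Suc i) \<otimes> c (Suc i)) m g)"
    if c: "\<And>i. c i \<in> B" for c m
  proof (induction m)
    case 0
    have "cong_mod Q (D (c 0)) \<zero>" using B(3) c by (intro cong_zeroI[OF QI]) auto
    then show ?case using gR sB(3)[OF c] by simp
  next
    case (Suc m)
    let ?c = "\<lambda>i. nat_elem (Suc i) \<otimes> c (Suc i)" and ?e = "c (Suc m)" and ?y = "g [^] Suc m"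
    have e: "?e \<in> A" "?e \<in> carrier R" "D ?e \<in> Q" "D ?e \<in> carrier R"
      using c B(2,3) sB(3) sA(3) DD(1) by auto
    have y: "?y \<in> A" by (rule pow_in_subring[OF sA(1) g(1)])
    have cR: "c i \<in> carrier R" for i using c sB(3) by auto
    have P: "poly_val c (Suc m) g \<in> A" using c B(2) by (intro poly_val_in_subring[OF sA(1)] g(1)) auto
    have eq: "poly_val c (Suc (Suc m)) g = poly_val c (Suc m) g \<oplus> ?e \<otimes> ?y"
      using cR gR by (intro poly_val_Suc_top)
    have "D (poly_val c (Suc (Suc m)) g) = D (poly_val c (Suc m) g) \<oplus> (D ?e \<otimes> ?y \<oplus> ?e \<otimes> D ?y)"
      unfolding eq using DD(2)[OF P subringE(6)[OF sA(1) e(1) y]] DD(3)[OF e(1) y]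
      by simp
    moreover have "cong_mod Q (D ?e \<otimes> ?y) \<zero>"
      using e gR by (intro cong_zeroI[OF QI] Q.I_r_closed) auto
    then have "cong_mod Q (D (poly_val c (Suc m) g) \<oplus> (D ?e \<otimes> ?y \<oplus> ?e \<otimes> D ?y))
        (D g \<otimes> poly_val ?c m g \<oplus> (\<zero> \<oplus> ?e \<otimes> D ?y))"
      using e DD(1)[OF y] sA(3) by (intro cong_add[OF QI] Suc cong_refl[OF QI]) auto
    moreover have "D g \<otimes> poly_val ?c m g \<oplus> (\<zero> \<oplus> ?e \<otimes> D ?y) = D g \<otimes> poly_val ?c (Suc m) g"
    proof -
      have "d \<otimes> p \<oplus> (\<zero> \<oplus> x \<otimes> (n \<otimes> z \<otimes> d)) = d \<otimes> (p \<oplus> (n \<otimes> x) \<otimes> z)"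
        if "d \<in> carrier R" "p \<in> carrier R" "x \<in> carrier R" "n \<in> carrier R" "z \<in> carrier R"
        for d p x n z using that by algebra
      from this[OF gR(2) _ e(2) nat_elem_closed, of "poly_val ?c m g" "g [^] m" "Suc m"]
      have "D g \<otimes> poly_val ?c m g \<oplus> (\<zero> \<oplus> ?e \<otimes> (nat_elem (Suc m) \<otimes> g [^] m \<otimes> D g))
          = D g \<otimes> (poly_val ?c m g \<oplus> (nat_elem (Suc m) \<otimes> ?e) \<otimes> g [^] m)"
        using cR gR by (simp add: poly_val_closed)
      moreover have "poly_val ?c (Suc m) g = poly_val ?c m g \<oplus> (nat_elem (Suc m) \<otimes> ?e) \<otimes> g [^] m"
        using cR gR by (intro poly_val_Suc_top) auto
      ultimately show ?thesis using deriv_pow[OF A D g(1), of m] by simp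
    qed
    ultimately show ?case by simp
  qed
  have "\<forall>i<n. c i \<in> Q" if "\<And>i. c i \<in> B" "poly_val c n g \<in> Q" for c n
    using that
  proof (induction n arbitrary: c)
    case (Suc m)
    let ?c = "\<lambda>i. nat_elem (Suc i) \<otimes> c (Suc i)"
    have cR: "c i \<in> carrier R" for i using Suc.prems sB(3) by auto
    have P: "poly_val c (Suc m) g \<in> A" using Suc.prems(1) B(2) by (intro poly_val_in_subring[OF sA(1)] g(1)) auto
    have "D g \<otimes> poly_val ?c m g \<in> Q"
      using cong_mem[OF QI deriv_poly_val[of c m]] Suc.prems(1) stable[OF P Suc.prems(2)] by simp
    then have "poly_val ?c m g \<in> Q" using Q.I_prime[OF gR(2)] g(2) cR gR(1) by auto
    moreover have "?c i \<in> B" for i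
      using nat_elem_in_subring[OF sB(1)] Suc.prems(1) by (intro subringE(6)[OF sB(1)])
    ultimately have "\<forall>i<m. ?c i \<in> Q" using Suc.IH[of ?c] by simp
    moreover have "nat_elem (Suc i) \<notin> Q" for i
      using subfield_unit_notin[OF Q subfield_k nat_elem_in_subring[OF k_subring]] nat_elem_nonzero by simp
    ultimately have c: "c (Suc i) \<in> Q" if "i < m" for i
      using Q.I_prime[OF nat_elem_closed cR] that by blast
    have "poly_val (\<lambda>i. c (Suc i)) m g \<in> Q" using c by (intro poly_val_in_ideal[OF QI] gR(1)) auto
    then have r: "g \<otimes> poly_val (\<lambda>i. c (Suc i)) m g \<in> Q" using Q.I_l_closed gR by auto
    have "c 0 \<oplus> g \<otimes> poly_val (\<lambda>i. c (Suc i)) m g \<in> Q" using Suc.prems(2) by simp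
    then have "(c 0 \<oplus> g \<otimes> poly_val (\<lambda>i. c (Suc i)) m g) \<ominus> g \<otimes> poly_val (\<lambda>i. c (Suc i)) m g \<in> Q"
      using r by (simp add: a_minus_def Q.a_closed Q.a_inv_closed)
    then have "c 0 \<in> Q"
      using add_minus_cancel[of "c 0" "g \<otimes> poly_val (\<lambda>i. c (Suc i)) m g"] cR gR
      by (simp add: poly_val_closed)
    then show ?case using c less_Suc_eq_0_disj by auto
  qed simp
  then show ?thesis by (rule transc_modI) blast
qed

end

text \<open>The polynomial with \<open>Suc (Suc n)\<close> coefficients has degree \<open>Suc n\<close>, so \<open>roots\<close> speaks of all non-constant
polynomials over \<open>k\<close>.\<close>
locale alg_closed_domain = char0_domain +
  assumes roots: "\<And>c n. \<lbrakk>\<And>i. c i \<in> k; c (Suc n) \<noteq> \<zero>\<rbrakk> \<Longrightarrow> \<exists>a\<in>k. poly_val c (Suc (Suc n)) a = \<zero>"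
begin

text \<open>A relation over \<open>k\<close> splits into linear factors, and \<open>Q\<close> contains one of them.\<close>
lemma algebraic_mod_constant:
  assumes Q: "primeideal Q R" and f: "f \<in> carrier R" "\<not> transc_mod Q k f"
  shows "\<exists>a\<in>k. f \<ominus> a \<in> Q"
proof -
  interpret Q: primeideal Q R by (rule Q)
  note QI = Q.ideal_axioms
  have kR: "a \<in> k \<Longrightarrow> a \<in> carrier R" for a using subringE(1)[OF k_subring] by auto
  obtain c n where "\<forall>i. c i \<in> k" "poly_val c n f \<in> Q" "\<exists>i<n. c i \<notin> Q"
    using f(2) unfolding transc_mod_def by blast
  then show ?thesis
  proof (induction n arbitrary: c)
    case (Suc m)
    have cR: "c i \<in> carrier R" for i using Suc.prems kR by auto
    show ?case
    proof (cases "c m = \<zero>")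
      case True
      have "poly_val c (Suc m) f = poly_val c m f"
        using cR f True by (intro poly_val_extend) (auto simp: less_Suc_eq_le dest: antisym)
      moreover have "\<exists>i<m. c i \<notin> Q"
        using Suc.prems(3) True Q.zero_closed less_Suc_eq by metis
      ultimately show ?thesis using Suc by simp
    next
      case top: False
      show ?thesis
      proof (cases m)
        case 0
        then have "c 0 \<in> Q" using Suc.prems(2) cR f by simp
        then show ?thesis using Suc.prems(3) 0 by auto
      next
        case (Suc e)
        obtain a where a: "a \<in> k" "poly_val c (Suc m) a = \<zero>"
          using roots[of c e] Suc.prems(1) top Suc by auto
        from synthetic_division[OF k_subring a(1) Suc.prems(1), of m]
        obtain d where d: "\<forall>i. d i \<in> k"
          and eq: "\<forall>x\<in>carrier R. poly_val c (Suc m) x = (x \<ominus> a) \<otimes> poly_val d m x \<oplus> poly_val c (Suc m) a"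
          and dQ: "\<forall>Q. ideal Q R \<longrightarrow> (\<forall>i<m. d i \<in> Q) \<longrightarrow> (\<forall>i. 0 < i \<and> i \<le> m \<longrightarrow> c i \<in> Q)"
          by (elim exE conjE)
        have P: "poly_val d m f \<in> carrier R" using d kR f by auto
        have aR: "a \<in> carrier R" using a kR by auto
        have "poly_val c (Suc m) f = (f \<ominus> a) \<otimes> poly_val d m f"
          using eq[rule_format, OF f(1)] a(2) P f(1) aR by (simp del: poly_val.simps)
        then have "f \<ominus> a \<in> Q \<or> poly_val d m f \<in> Q"
          using Suc.prems(2) Q.I_prime[of "f \<ominus> a" "poly_val d m f"] P f(1) aR by simp
        then show ?thesis
        proof
          assume dm: "poly_val d m f \<in> Q"
          have "\<exists>i<m. d i \<notin> Q"
          proof (rule ccontr)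
            assume "\<not> ?thesis"
            then have "c m \<in> Q" using dQ QI Suc by blast
            then show False using k_inter_prime[OF Q] Suc.prems(1) top by blast
          qed
          then show ?thesis using Suc.IH[OF d dm] by blast
        qed (use a in blast)
      qed
    qed
  qed simp
qed

lemma factorially_closedD:
  "\<lbrakk>factorially_closed A B; a \<in> B; b \<in> B; a \<otimes> b \<in> A; a \<otimes> b \<noteq> \<zero>\<rbrakk> \<Longrightarrow> a \<in> A \<and> b \<in> A"
  unfolding factorially_closed_def by blast

lemma PIdl_iff: "y \<in> PIdl p \<longleftrightarrow> (\<exists>r\<in>carrier R. y = r \<otimes> p)"
  unfolding cgenideal_def by blast

text \<open>Modulo \<open>p\<close> the ring has transcendence degree at most one. If \<open>f\<close> were not constant modulo \<open>p\<close>, it would be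
transcendental over \<open>k\<close>, and so would \<open>g\<close> be over \<open>k[f]\<close>, since the induced derivation kills \<open>f\<close> but
not \<open>g\<close>. Then \<open>f, g, p\<close> would be a tower of length three.\<close>
lemma residue_constant:
  assumes A: "subalg A" "factorially_closed A (carrier R)" and D: "lnd_on k A D"
    and p: "p \<in> A" "p \<noteq> \<zero>" "D p = \<zero>" "primeideal (PIdl p) R"
    and short: "\<And>xs. \<lbrakk>set xs \<subseteq> A; tower {\<zero>} k xs\<rbrakk> \<Longrightarrow> length xs \<le> 2"
    and f: "f \<in> A" "D f \<in> PIdl p" and g: "g \<in> A" "D g \<notin> PIdl p"
  shows "\<exists>a\<in>k. f \<ominus> a \<in> PIdl p"
proof (rule ccontr)
  let ?Q = "PIdl p"
  assume no: "\<not> (\<exists>a\<in>k. f \<ominus> a \<in> ?Q)"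
  note sA = subalgD[OF A(1)]
  have dD: "derivation_on k A D" using D by (simp add: lnd_on_def)
  note DD = derivD[OF A(1) dD]
  have pR: "p \<in> carrier R" using p sA by auto
  interpret Q: primeideal ?Q R by (rule p(4))
  note QI = Q.ideal_axioms
  have fR: "f \<in> carrier R" "g \<in> carrier R" using f g sA by auto
  have tf: "transc_mod ?Q k f"
    using algebraic_mod_constant[OF p(4) fR(1)] no by blast
  have stable: "D a \<in> ?Q" if a: "a \<in> A" "a \<in> ?Q" for a
  proof (cases "a = \<zero>")
    case True
    then show ?thesis using deriv_zero[OF A(1) dD] Q.zero_closed by simp
  next
    case False
    obtain b where b: "b \<in> carrier R" "a = b \<otimes> p" using a(2) PIdl_iff by auto
    then have bA: "b \<in> A" using factorially_closedD[OF A(2) b(1) pR] a False by auto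
    have "D a = D b \<otimes> p" using DD(3)[OF bA p(1)] b p(3) DD(1)[OF bA] sA(3) pR by simp
    then show ?thesis using DD(1)[OF bA] sA(3) PIdl_iff by blast
  qed
  let ?B = "adjoin k f"
  have B: "subalg ?B" "?B \<subseteq> A"
    using adjoin_subring[OF k_subring fR(1)] subring_adjoin_base[OF k_subring fR(1)]
      adjoin_least[OF sA(1,2) f(1)] by (auto simp: subalg_def)
  have "subring {a \<in> A. D a \<in> ?Q} R"
  proof (rule subringI)
    show "\<one> \<in> {a \<in> A. D a \<in> ?Q}" using subringE(3)[OF sA(1)] deriv_one[OF A(1) dD] Q.zero_closed by simp
    fix a assume a: "a \<in> {a \<in> A. D a \<in> ?Q}"
    then show "\<ominus> a \<in> {a \<in> A. D a \<in> ?Q}"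
      using subringE(5)[OF sA(1)] deriv_minus[OF A(1) dD] Q.a_inv_closed by auto
    fix b assume b: "b \<in> {a \<in> A. D a \<in> ?Q}"
    show "a \<oplus> b \<in> {a \<in> A. D a \<in> ?Q}"
      using a b subringE(7)[OF sA(1)] DD(2) Q.a_closed by auto
    show "a \<otimes> b \<in> {a \<in> A. D a \<in> ?Q}"
      using a b subringE(6)[OF sA(1), of a b] DD(3)[of a b] sA(3)[of a] sA(3)[of b]
        Q.a_closed[OF Q.I_r_closed[of "D a" b] Q.I_l_closed[of "D b" a]] by simp
  qed (use sA(3) in auto)
  moreover have "k \<subseteq> {a \<in> A. D a \<in> ?Q}"
  proof
    fix c assume "c \<in> k"
    then show "c \<in> {a \<in> A. D a \<in> ?Q}" using sA(2) DD(4)[of c] Q.zero_closed by auto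
  qed
  ultimately have "?B \<subseteq> {a \<in> A. D a \<in> ?Q}" using f by (intro adjoin_least) auto
  then have BQ: "D b \<in> ?Q" if "b \<in> ?B" for b using that by blast
  have "transc_mod ?Q ?B g"
    by (rule transc_mod_of_derivation[OF A(1) dD p(4) stable B BQ g])
  then have "tower ?Q k [f, g]" using tf fR by simp
  moreover have "p \<in> ?Q" by (rule cgenideal_self[OF pR])
  ultimately have "tower {\<zero>} k ([f, g] @ [p])"
    using tower_add_prime[OF k_subring k_inter_prime[OF p(4)] QI _ p(2)] by blast
  then show False using short[of "[f, g] @ [p]"] f g p by simp
qed

section \<open>Locally nilpotent derivations on factorial rings\<close>

lemma prime_divisor:
  assumes "factorial_domain R" "y \<in> carrier R" "y \<noteq> \<zero>" "y \<notin> Units R"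
  obtains p z where "p \<in> carrier R" "p \<noteq> \<zero>" "p \<notin> Units R" "primeideal (PIdl p) R"
    "z \<in> carrier R" "y = p \<otimes> z"
proof -
  interpret M: factorial_monoid "mult_of R" by (rule factorial_domain.axioms(2)[OF assms(1)])
  obtain fs where fs: "set fs \<subseteq> carrier (mult_of R)" "factors (mult_of R) fs y"
    using M.factors_exist[of y] assms by auto
  have "fs \<noteq> []"
  proof
    assume "fs = []"
    then have "y = \<one>" using fs(2) by (simp add: factors_def)
    then show False using assms(4) by simp
  qed
  then obtain p ps where ps: "fs = p # ps" by (cases fs) auto
  have p: "p \<in> carrier R" "p \<noteq> \<zero>" "irreducible (mult_of R) p" using fs ps by (auto simp: factors_def)
  have pr: "prime (mult_of R) p" using M.irreducible_prime[OF p(3)] p by simp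
  then have "ring_prime p" using p prime_eq_prime_mult by (simp add: ring_prime_def)
  then have "primeideal (PIdl p) R" using primeideal_iff_prime p by simp
  moreover have "p \<notin> Units R" using p(3) by (simp add: irreducible_def)
  moreover have "y = p \<otimes> foldr (\<otimes>) ps \<one>" using fs(2) ps by (simp add: factors_def)
  moreover have "set qs \<subseteq> carrier R \<Longrightarrow> foldr (\<otimes>) qs \<one> \<in> carrier R" for qs by (induction qs) auto
  then have "foldr (\<otimes>) ps \<one> \<in> carrier R" using fs(1) ps by auto
  ultimately show ?thesis using that p by blast
qed

text \<open>Since \<open>p\<close> is in the kernel, the iterates of the quotient are those of \<open>D\<close> divided by powers of \<open>p\<close>.\<close>
lemma divide_lnd:
  assumes A: "subalg A" "factorially_closed A (carrier R)" and D: "lnd_on k A D"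
    and p: "p \<in> A" "p \<noteq> \<zero>" "D p = \<zero>" and div: "\<And>a. a \<in> A \<Longrightarrow> D a \<in> PIdl p"
  shows "\<exists>F. lnd_on k A F \<and> (\<forall>a\<in>A. D a = p \<otimes> F a)"
proof -
  note sA = subalgD[OF A(1)]
  have dD: "derivation_on k A D" using D by (simp add: lnd_on_def)
  note DD = derivD[OF A(1) dD]
  have pR: "p \<in> carrier R" using p sA by auto
  have "\<forall>a\<in>A. \<exists>q\<in>A. D a = p \<otimes> q"
  proof
    fix a assume a: "a \<in> A"
    obtain q where q: "q \<in> carrier R" "D a = p \<otimes> q" using div[OF a] PIdl_iff pR m_comm by auto
    have "q \<in> A"
    proof (cases "D a = \<zero>")
      case True
      then have "q = \<zero>" using q pR p(2) integral_iff by auto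
      then show ?thesis using subringE(2)[OF sA(1)] by simp
    next
      case False
      then show ?thesis using factorially_closedD[OF A(2) pR q(1)] q(2) DD(1)[OF a] by auto
    qed
    then show "\<exists>q\<in>A. D a = p \<otimes> q" using q by blast
  qed
  then obtain F where F: "\<forall>a\<in>A. F a \<in> A \<and> D a = p \<otimes> F a" by metis
  have FA: "F a \<in> A" "F a \<in> carrier R" "D a = p \<otimes> F a" if "a \<in> A" for a using F that sA(3) by auto
  have cancel: "y = z" if "p \<otimes> y = p \<otimes> z" "y \<in> carrier R" "z \<in> carrier R" for y z
    using that m_lcancel[OF p(2) pR] by simp
  have "derivation_on k A F"
    unfolding derivation_on_def
  proof (intro conjI ballI)
    fix a b assume ab: "a \<in> A" "b \<in> A"
    have abR: "a \<in> carrier R" "b \<in> carrier R" using ab sA by auto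
    show "F (a \<oplus> b) = F a \<oplus> F b"
    proof (rule cancel)
      show "p \<otimes> F (a \<oplus> b) = p \<otimes> (F a \<oplus> F b)"
        using DD(2)[OF ab] FA(3)[OF subringE(7)[OF sA(1) ab]] FA[OF ab(1)] FA[OF ab(2)] pR
        by (simp add: r_distr)
    qed (use FA ab subringE(7)[OF sA(1)] in auto)
    show "F (a \<otimes> b) = F a \<otimes> b \<oplus> a \<otimes> F b"
    proof (rule cancel)
      show "p \<otimes> F (a \<otimes> b) = p \<otimes> (F a \<otimes> b \<oplus> a \<otimes> F b)"
        using DD(3)[OF ab] FA(3)[OF subringE(6)[OF sA(1) ab]] FA[OF ab(1)] FA[OF ab(2)] pR abR
        by (simp add: r_distr m_ac)
    qed (use FA ab abR subringE(6)[OF sA(1)] in auto)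
  next
    fix c assume c: "c \<in> k"
    then have "c \<in> A" using sA by auto
    then show "F c = \<zero>" using FA[of c] DD(4)[OF c] integral_iff[OF pR, of "F c"] p(2) by simp
  qed (use FA in auto)
  moreover have "\<exists>n. (F ^^ n) a = \<zero>" if a: "a \<in> A" for a
  proof -
    have Fn: "(F ^^ n) a \<in> A" for n by (induction n) (use a FA in auto)
    have eq: "(D ^^ n) a = p [^] n \<otimes> (F ^^ n) a" for n
    proof (induction n)
      case (Suc n)
      have pn: "p [^] n \<in> {a \<in> A. D a = \<zero>}"
        using p by (intro pow_in_subring[OF subalgD(1)[OF kernel_subalg[OF A(1) dD]]]) auto
      have "(D ^^ Suc n) a = D (p [^] n \<otimes> (F ^^ n) a)" using Suc by simp
      also have "\<dots> = p [^] n \<otimes> (p \<otimes> (F ^^ Suc n) a)"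
        using deriv_const_mult[OF A(1) dD _ _ Fn[of n]] pn FA(3)[OF Fn[of n]] by simp
      finally show ?case using pR Fn[of "Suc n"] sA(3) by (simp add: m_assoc)
    qed (use a sA in simp)
    obtain n where "(D ^^ n) a = \<zero>" using D a by (auto simp: lnd_on_def)
    then have "p [^] n = \<zero> \<or> (F ^^ n) a = \<zero>"
      using eq[of n] integral_iff[of "p [^] n" "(F ^^ n) a"] pR sA(3)[OF Fn[of n]] by auto
    moreover have "p [^] m \<noteq> \<zero>" for m :: nat
      by (induction m) (use p(2) pR integral_iff in auto)
    ultimately show ?thesis by blast
  qed
  ultimately have "lnd_on k A F" by (simp add: lnd_on_def)
  then show ?thesis using FA by blast
qed

text \<open>Among all values \<open>y = E x \<noteq> 0\<close> that lie in the kernel, for all \<open>E\<close>, choose one that is minimal for proper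
divisibility. A prime factor \<open>p\<close> of \<open>y\<close> would allow passing to \<open>y / p\<close>: divide \<open>E\<close> by \<open>p\<close> if its image
is contained in the ideal of \<open>p\<close>, and otherwise divide \<open>x - a\<close>, where \<open>a\<close> is the residue of \<open>x\<close>. So
\<open>y\<close> is a unit, and \<open>x / y\<close> is a slice.\<close>
theorem slice_exists:
  assumes fact: "factorial_domain R" and A: "subalg A" "factorially_closed A (carrier R)"
    and E0: "lnd_on k A E0" "a0 \<in> A" "E0 a0 \<noteq> \<zero>"
    and short: "\<And>xs. \<lbrakk>set xs \<subseteq> A; tower {\<zero>} k xs\<rbrakk> \<Longrightarrow> length xs \<le> 2"
  shows "\<exists>E s. lnd_on k A E \<and> s \<in> A \<and> E s = \<one>"
proof -
  interpret M: factorial_monoid "mult_of R" by (rule factorial_domain.axioms(2)[OF fact])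
  note sA = subalgD[OF A(1)]
  let ?r = "{(x, y). x \<in> carrier (mult_of R) \<and> y \<in> carrier (mult_of R) \<and> properfactor (mult_of R) x y}"
  let ?Y = "{y. \<exists>E x. lnd_on k A E \<and> x \<in> A \<and> E x = y \<and> E y = \<zero> \<and> y \<noteq> \<zero>}"
  have wf: "wf ?r" using M.division_wellfounded by simp
  have "\<exists>y. y \<in> ?Y"
  proof -
    have a0: "a0 \<noteq> \<zero>" using E0 deriv_zero[OF A(1)] by (auto simp: lnd_on_def)
    note l = lnd_degree_props[OF A(1) E0(1,2) a0]
    obtain n where n: "lnd_degree E0 a0 = Suc n"
      using lnd_degree_eq_0_iff[OF A(1) E0(1,2) a0] E0(3) by (cases "lnd_degree E0 a0") auto
    have "(E0 ^^ n) a0 \<in> A" using deriv_iter_closed[OF A(1)] E0 by (auto simp: lnd_on_def)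
    moreover have "E0 ((E0 ^^ n) a0) \<noteq> \<zero>" "E0 (E0 ((E0 ^^ n) a0)) = \<zero>" using l unfolding n by auto
    ultimately show ?thesis using E0(1) by blast
  qed
  then obtain y0 where "y0 \<in> ?Y" ..
  then obtain y where y: "y \<in> ?Y" and min: "\<And>z. (z, y) \<in> ?r \<Longrightarrow> z \<notin> ?Y"
    by (rule wfE_min[OF wf, of y0 ?Y]) blast
  obtain E x where E: "lnd_on k A E" "x \<in> A" "E x = y" "E y = \<zero>" "y \<noteq> \<zero>" using y by blast
  have dE: "derivation_on k A E" using E by (simp add: lnd_on_def)
  note DE = derivD[OF A(1) dE]
  have yA: "y \<in> A" "y \<in> carrier R" using E DE(1) sA by auto
  have "y \<in> Units R"
  proof (rule ccontr)
    assume "y \<notin> Units R"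
    then obtain p z where p: "p \<in> carrier R" "p \<noteq> \<zero>" "p \<notin> Units R" "primeideal (PIdl p) R"
      "z \<in> carrier R" "y = p \<otimes> z"
      by (rule prime_divisor[OF fact yA(2) E(5)])
    have pz: "p \<in> A" "z \<in> A" using factorially_closedD[OF A(2) p(1,5)] p(6) yA E(5) by auto
    have Epz: "E p = \<zero>" "E z = \<zero>"
      using factorially_closedD[OF kernel_factorially_closed[OF A(1) E(1)] pz] p(6) E(4,5) yA by auto
    have z0: "z \<noteq> \<zero>" using p E(5) by auto
    have "properfactor (mult_of R) z y"
      by (rule mult_of.properfactorI3[of _ _ p]) (use p z0 m_comm in auto)
    then have smaller: "z \<notin> ?Y" using min[of z] p z0 yA E(5) by auto
    show False
    proof (cases "\<forall>g\<in>A. E g \<in> PIdl p")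
      case True
      then obtain F where F: "lnd_on k A F" "\<forall>a\<in>A. E a = p \<otimes> F a"
        using divide_lnd[OF A E(1) pz(1) p(2) Epz(1)] by blast
      have FA: "F a \<in> carrier R" if "a \<in> A" for a
        using F(1) that sA by (auto simp: lnd_on_def derivation_on_def)
      have "p \<otimes> F x = p \<otimes> z" using F(2) E(2,3) p(6) by simp
      then have "F x = z" using m_lcancel[OF p(2,1)] FA[OF E(2)] p(5) by simp
      moreover have "p \<otimes> F z = \<zero>" using F(2) pz(2) Epz(2) by simp
      then have "F z = \<zero>" using integral_iff[OF p(1) FA[OF pz(2)]] p(2) by simp
      ultimately show False using smaller F(1) E(2) z0 by blast
    next
      case False
      then obtain g where g: "g \<in> A" "E g \<notin> PIdl p" by blast
      have "E x \<in> PIdl p" unfolding PIdl_iff using p E(3) m_comm by auto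
      from residue_constant[OF A E(1) pz(1) p(2) Epz(1) p(4) short E(2) this g]
      obtain a where a: "a \<in> k" "x \<ominus> a \<in> PIdl p" by blast
      obtain x' where x': "x' \<in> carrier R" "x \<ominus> a = x' \<otimes> p" using a(2) PIdl_iff by auto
      have aA: "a \<in> A" using a sA by auto
      have xa: "x \<ominus> a \<in> A" by (rule minus_in_subring[OF sA(1) E(2) aA])
      have Exa: "E (x \<ominus> a) = y"
        using deriv_diff[OF A(1) dE E(2) aA] DE(4)[OF a(1)] E(3) yA by (simp add: a_minus_def)
      then have "x \<ominus> a \<noteq> \<zero>" using deriv_zero[OF A(1) dE] E(5) by auto
      then have x'A: "x' \<in> A" using factorially_closedD[OF A(2) x'(1) p(1)] x'(2) xa by auto
      have "E (p \<otimes> x') = p \<otimes> E x'" by (rule deriv_const_mult[OF A(1) dE pz(1) Epz(1) x'A])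
      then have "p \<otimes> E x' = p \<otimes> z" using Exa x' p m_comm by simp
      then have "E x' = z" using m_lcancel[OF p(2,1)] DE(1)[OF x'A] sA(3) p(5) by simp
      then show False using smaller E(1) x'A Epz(2) z0 by blast
    qed
  qed
  then have u: "inv y \<in> carrier R" "y \<otimes> inv y = \<one>" by auto
  then have uA: "inv y \<in> A"
    using factorially_closedD[OF A(2) yA(2) u(1)] subringE(3)[OF sA(1)] by auto
  have "E (inv y) = \<zero>"
    using factorially_closedD[OF kernel_factorially_closed[OF A(1) E(1)] yA(1) uA] u
      deriv_one[OF A(1) dE] subringE(3)[OF sA(1)] by auto
  then have "E (inv y \<otimes> x) = \<one>"
    using deriv_const_mult[OF A(1) dE uA _ E(2)] E(3) u yA m_comm by simp
  moreover have "inv y \<otimes> x \<in> A" by (rule subringE(6)[OF sA(1) uA E(2)])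
  ultimately show ?thesis using E(1) by blast
qed

text \<open>The elements of degree zero in \<open>A\<close> are the constants, because an element of \<open>ker D\<close> outside \<open>k\<close> would form
a tower with \<open>a0\<close>. An element \<open>r\<close> of least positive degree is irreducible since degrees add up, hence prime.
The residues modulo \<open>r\<close> are constant, as a residue that is transcendental over \<open>k\<close> would form a tower with
\<open>r\<close>. Division by \<open>r\<close> lowers the degree, so \<open>r\<close> generates \<open>A\<close>.\<close>
theorem line_of_moving_lnd:
  assumes fact: "factorial_domain R" and A: "subalg A" "factorially_closed A (carrier R)"
    and D: "lnd_on k (carrier R) D" and a0: "a0 \<in> A" "D a0 \<noteq> \<zero>"
    and short: "\<And>xs. \<lbrakk>set xs \<subseteq> A; tower {\<zero>} k xs\<rbrakk> \<Longrightarrow> length xs \<le> 1"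
  shows "\<exists>r\<in>A. A = adjoin k r \<and> transc_mod {\<zero>} k r \<and> {a \<in> A. D a = \<zero>} \<subseteq> k"
proof -
  interpret M: factorial_monoid "mult_of R" by (rule factorial_domain.axioms(2)[OF fact])
  note sA = subalgD[OF A(1)] and R = subalg_carrier
  have dD: "derivation_on k (carrier R) D" using D by (simp add: lnd_on_def)
  note DD = derivD[OF R dD]
  have kR: "a \<in> k \<Longrightarrow> a \<in> carrier R" for a using subringE(1)[OF k_subring] by auto
  have kernel_in_k: "f \<in> k" if f: "f \<in> A" "D f = \<zero>" for f
  proof (rule ccontr)
    assume "f \<notin> k"
    have fR: "f \<in> carrier R" using f sA by auto
    have "transc_mod {\<zero>} k f"
    proof (rule ccontr)
      assume "\<not> ?thesis"
      then obtain a where "a \<in> k" "f \<ominus> a = \<zero>"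
        using algebraic_mod_constant[OF zeroprimeideal fR] by blast
      then show False using \<open>f \<notin> k\<close> fR kR r_right_minus_eq by auto
    qed
    moreover have "transc_mod {\<zero>} (adjoin k f) a0"
    proof (rule transc_mod_of_derivation[OF R dD zeroprimeideal])
      note K = kernel_subalg[OF R dD]
      have K': "adjoin k f \<subseteq> {a \<in> carrier R. D a = \<zero>}"
        by (rule adjoin_least[OF subalgD(1,2)[OF K]]) (use f fR in simp)
      then show "D b \<in> {\<zero>}" if "b \<in> adjoin k f" for b using that by blast
      show "adjoin k f \<subseteq> carrier R" using K' by blast
      show "subalg (adjoin k f)"
        using adjoin_subring[OF k_subring fR] subring_adjoin_base[OF k_subring fR] by (simp add: subalg_def)
      show "D a \<in> {\<zero>}" if "a \<in> {\<zero>}" for a using that deriv_zero[OF R dD] by simp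
      show "a0 \<in> carrier R" "D a0 \<notin> {\<zero>}" using a0 sA by auto
    qed
    ultimately have "tower {\<zero>} k [f, a0]" using fR a0 sA by simp
    then show False using short[of "[f, a0]"] f a0 by simp
  qed
  define d where "d = (LEAST n. \<exists>a\<in>A. D a \<noteq> \<zero> \<and> lnd_degree D a = n)"
  have "\<exists>n. \<exists>a\<in>A. D a \<noteq> \<zero> \<and> lnd_degree D a = n" using a0 by blast
  from LeastI_ex[OF this] obtain r where r: "r \<in> A" "D r \<noteq> \<zero>" "lnd_degree D r = d"
    unfolding d_def by blast
  have min: "d \<le> lnd_degree D a" if "a \<in> A" "D a \<noteq> \<zero>" for a
    unfolding d_def using that by (intro Least_le) blast
  have rR: "r \<in> carrier R" using r sA by auto
  have r0: "r \<noteq> \<zero>" using r deriv_zero[OF R dD] by auto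
  have dpos: "0 < d" using lnd_degree_eq_0_iff[OF R D rR r0] r by auto
  have Units: "a \<in> Units R" if a: "a \<in> k" "a \<noteq> \<zero>" for a
    using subfield_m_inv[OF subfield_k, of a] a kR by (auto simp: Units_def)
  have "ring_irreducible r"
  proof (rule ring_irreducibleI)
    show "r \<in> carrier R - {\<zero>}" using rR r0 by simp
    show "r \<notin> Units R"
    proof
      assume "r \<in> Units R"
      then have i: "inv r \<in> carrier R" "r \<otimes> inv r = \<one>" by auto
      then have "inv r \<noteq> \<zero>" using rR by auto
      then have "lnd_degree D \<one> = d + lnd_degree D (inv r)" using lnd_degree_mult[OF R D rR i(1) r0] i(2) r(3) by simp
      then show False using dpos lnd_degree_eq_0_iff[OF R D one_closed one_not_zero] deriv_one[OF R dD] by simp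
    qed
    fix a b assume ab: "a \<in> carrier R" "b \<in> carrier R" "r = a \<otimes> b"
    have n: "a \<noteq> \<zero>" "b \<noteq> \<zero>" using ab r0 by auto
    have abA: "a \<in> A" "b \<in> A" using factorially_closedD[OF A(2) ab(1,2)] ab(3) r r0 by auto
    have "d = lnd_degree D a + lnd_degree D b" using lnd_degree_mult[OF R D ab(1,2) n] ab(3) r(3) by simp
    then have "lnd_degree D a < d \<or> lnd_degree D b < d" using dpos by linarith
    then have "D a = \<zero> \<or> D b = \<zero>" using min abA by (meson not_le)
    then show "a \<in> Units R \<or> b \<in> Units R"
      using kernel_in_k abA Units n by blast
  qed
  then have "irreducible (mult_of R) r" using ring_irreducibleE(3)[OF rR] by simp
  then have "prime (mult_of R) r" using M.irreducible_prime rR r0 by simp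
  then have "ring_prime r" using prime_eq_prime_mult[OF rR] r0 by (simp add: ring_prime_def)
  then have Q: "primeideal (PIdl r) R" using primeideal_iff_prime rR r0 by simp
  interpret Q: primeideal "PIdl r" R by (rule Q)
  have rQ: "r \<in> PIdl r" by (rule cgenideal_self[OF rR])
  have residue: "\<exists>a\<in>k. f \<ominus> a \<in> PIdl r" if f: "f \<in> A" for f
  proof (rule ccontr)
    assume no: "\<not> ?thesis"
    have fR: "f \<in> carrier R" using f sA by auto
    have "transc_mod (PIdl r) k f" using algebraic_mod_constant[OF Q fR] no by blast
    then have "tower {\<zero>} k ([f] @ [r])"
      using fR by (intro tower_add_prime[OF k_subring k_inter_prime[OF Q] Q.ideal_axioms rQ r0]) simp
    then show False using short[of "[f] @ [r]"] f r by simp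
  qed
  note S = adjoin_subring[OF k_subring rR]
  have kS: "k \<subseteq> adjoin k r" by (rule subring_adjoin_base[OF k_subring rR])
  have gen: "f \<in> adjoin k r" if "f \<in> A" for f
    using that
  proof (induction "lnd_degree D f" arbitrary: f rule: less_induct)
    case less
    show ?case
    proof (cases "D f = \<zero>")
      case True
      then show ?thesis using kernel_in_k less.prems kS by blast
    next
      case False
      have fR: "f \<in> carrier R" using less.prems sA by auto
      obtain a where a: "a \<in> k" "f \<ominus> a \<in> PIdl r" using residue[OF less.prems] by blast
      obtain g where g: "g \<in> carrier R" "f \<ominus> a = g \<otimes> r" using a(2) PIdl_iff by auto
      have aR: "a \<in> carrier R" and aA: "a \<in> A" using a kR sA by auto
      have Dfa: "D (f \<ominus> a) = D f"
        using deriv_diff[OF R dD fR aR] DD(4)[OF a(1)] DD(1)[OF fR] by (simp add: a_minus_def)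
      have fa0: "f \<ominus> a \<noteq> \<zero>" using Dfa False deriv_zero[OF R dD] by auto
      have f0: "f \<noteq> \<zero>" using False deriv_zero[OF R dD] by auto
      have "(D ^^ Suc n) (f \<ominus> a) = (D ^^ Suc n) f" for n
        using Dfa by (simp add: funpow_Suc_right del: funpow.simps)
      then have "lnd_degree D (f \<ominus> a) = lnd_degree D f" by (simp add: lnd_degree_def del: funpow.simps)
      moreover have g0: "g \<noteq> \<zero>" using fa0 g rR by auto
      ultimately have "lnd_degree D f = lnd_degree D g + d"
        using lnd_degree_mult[OF R D g(1) rR g0 r0] g(2) r(3) by simp
      then have "lnd_degree D g < lnd_degree D f" using dpos by simp
      moreover have "g \<in> A"
        using factorially_closedD[OF A(2) g(1) rR] g(2) fa0 minus_in_subring[OF sA(1) less.prems aA] by auto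
      ultimately have "g \<in> adjoin k r" by (rule less.hyps)
      then have "g \<otimes> r \<oplus> a \<in> adjoin k r"
        using adjoin_gen[OF k_subring rR] a(1) kS by (intro subringE(7)[OF S] subringE(6)[OF S]) auto
      moreover have "f = (f \<ominus> a) \<oplus> a" using fR aR by algebra
      ultimately show ?thesis using g(2) by simp
    qed
  qed
  have "transc_mod {\<zero>} k r"
  proof (rule ccontr)
    assume "\<not> ?thesis"
    then obtain a where a: "a \<in> k" "r \<ominus> a = \<zero>" using algebraic_mod_constant[OF zeroprimeideal rR] by blast
    then have "r = a" using rR kR r_right_minus_eq by auto
    then show False using a r DD(4) by auto
  qed
  moreover have "A = adjoin k r" using gen adjoin_least[OF sA(1,2) r(1)] by blast
  ultimately show ?thesis using r kernel_in_k by blast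
qed

text \<open>\<open>C\<close> is a set of representatives for the residues of \<open>A = C[s]\<close> modulo \<open>s\<close>, so the representatives of
generators of \<open>A\<close> generate it.\<close>
lemma slice_kernel_finitely_generated:
  assumes A: "subalg A" and E: "lnd_on k A E" and s: "s \<in> A" "E s = \<one>"
    and gs: "adjoins k gs = A" "set gs \<subseteq> carrier R"
  shows "\<exists>hs. set hs \<subseteq> {a \<in> A. E a = \<zero>} \<and> adjoins k hs = {a \<in> A. E a = \<zero>}"
proof -
  let ?C = "{a \<in> A. E a = \<zero>}"
  have dE: "derivation_on k A E" using E by (simp add: lnd_on_def)
  note sA = subalgD[OF A]
  note sC = subalgD[OF kernel_subalg[OF A dE]]
  have sR: "s \<in> carrier R" using s sA by auto
  \<comment> \<open>the constant coefficient \<open>a\<close> of \<open>b\<close> as a polynomial in \<open>s\<close>\<close>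
  have split: "\<exists>a\<in>?C. \<exists>z\<in>A. b = a \<oplus> s \<otimes> z" if b: "b \<in> A" for b
  proof -
    have "b \<in> adjoin ?C s" using slice_generates[OF A E s] b by simp
    then obtain c n where c: "\<forall>i. c i \<in> ?C" "b = poly_val c n s" unfolding adjoin_def by blast
    show ?thesis
    proof (cases n)
      case 0
      then show ?thesis using c subringE(2)[OF sC(1)] subringE(2)[OF sA(1)] sR
        by (intro bexI[of _ \<zero>]) auto
    next
      case (Suc m)
      have "poly_val (\<lambda>i. c (Suc i)) m s \<in> A" using c s by (intro poly_val_in_subring[OF sA(1)]) auto
      then show ?thesis using c Suc by (intro bexI[of _ "c 0"] bexI[of _ "poly_val (\<lambda>i. c (Suc i)) m s"]) auto
    qed
  qed
  have gA: "set gs \<subseteq> A" using adjoins_gens[OF k_subring gs(2)] gs(1) by simp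
  then have "\<forall>g\<in>set gs. \<exists>a. a \<in> ?C \<and> (\<exists>z\<in>A. g = a \<oplus> s \<otimes> z)" using split by blast
  then obtain h where h: "\<forall>g\<in>set gs. h g \<in> ?C \<and> (\<exists>z\<in>A. g = h g \<oplus> s \<otimes> z)" by metis
  let ?hs = "map h gs"
  have hsC: "set ?hs \<subseteq> ?C" using h by auto
  have hsR: "set ?hs \<subseteq> carrier R" using hsC sC(3) by blast
  let ?B = "adjoins k ?hs"
  note B = adjoins_subring[OF k_subring hsR]
  have BC: "?B \<subseteq> ?C" by (rule adjoins_least[OF sC(1,2) hsC])
  have BR: "?B \<subseteq> carrier R" using BC sC(3) by blast
  \<comment> \<open>elements whose residue modulo \<open>s\<close> lies in the ring generated by the residues of the generators\<close>
  let ?W = "{y \<in> A. \<exists>a\<in>?B. \<exists>z\<in>A. y = a \<oplus> s \<otimes> z}"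
  have W: "y \<in> ?W" if "a \<in> ?B" "z \<in> A" "y = a \<oplus> s \<otimes> z" for y a z
  proof -
    have "a \<in> A" using that(1) BC by blast
    then have "y \<in> A" unfolding that(3) by (intro subringE(7)[OF sA(1)] subringE(6)[OF sA(1)] s that)
    then show ?thesis using that by blast
  qed
  have "subring ?W R"
  proof (rule subringI)
    show "?W \<subseteq> carrier R" using sA(3) by blast
    show "\<one> \<in> ?W" by (rule W[of \<one> \<zero>]) (use subringE(3)[OF B(1)] subringE(2)[OF sA(1)] sR in auto)
    fix y assume "y \<in> ?W"
    then obtain a z where y: "a \<in> ?B" "z \<in> A" "y = a \<oplus> s \<otimes> z" by blast
    have yR: "a \<in> carrier R" "z \<in> carrier R" using y BR sA by auto
    show "\<ominus> y \<in> ?W"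
    proof (rule W)
      show "\<ominus> a \<in> ?B" "\<ominus> z \<in> A" using subringE(5)[OF B(1) y(1)] subringE(5)[OF sA(1) y(2)] by auto
      show "\<ominus> y = \<ominus> a \<oplus> s \<otimes> (\<ominus> z)" unfolding y(3) using yR sR by algebra
    qed
    fix y' assume "y' \<in> ?W"
    then obtain a' z' where y': "a' \<in> ?B" "z' \<in> A" "y' = a' \<oplus> s \<otimes> z'" by blast
    have yR': "a' \<in> carrier R" "z' \<in> carrier R" using y' BR sA by auto
    show "y \<oplus> y' \<in> ?W"
    proof (rule W)
      show "a \<oplus> a' \<in> ?B" "z \<oplus> z' \<in> A"
        using subringE(7)[OF B(1) y(1) y'(1)] subringE(7)[OF sA(1) y(2) y'(2)] by auto
      show "y \<oplus> y' = (a \<oplus> a') \<oplus> s \<otimes> (z \<oplus> z')" unfolding y(3) y'(3) using yR yR' sR by algebra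
    qed
    show "y \<otimes> y' \<in> ?W"
    proof (rule W)
      show "a \<otimes> a' \<in> ?B" using subringE(6)[OF B(1) y(1) y'(1)] .
      have "a \<in> A" "a' \<in> A" using y(1) y'(1) BC by auto
      then show "a \<otimes> z' \<oplus> (z \<otimes> a' \<oplus> s \<otimes> (z \<otimes> z')) \<in> A"
        using y(2) y'(2) s(1) by (intro subringE(7)[OF sA(1)] subringE(6)[OF sA(1)])
      show "y \<otimes> y' = (a \<otimes> a') \<oplus> s \<otimes> (a \<otimes> z' \<oplus> (z \<otimes> a' \<oplus> s \<otimes> (z \<otimes> z')))"
        unfolding y(3) y'(3) using yR yR' sR by algebra
    qed
  qed
  moreover have "k \<subseteq> ?W"
  proof
    fix c assume "c \<in> k"
    then show "c \<in> ?W" using B(2) BR sR subringE(2)[OF sA(1)] by (intro W[of c \<zero>]) auto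
  qed
  moreover have "set gs \<subseteq> ?W"
  proof
    fix g assume g: "g \<in> set gs"
    then obtain z where z: "z \<in> A" "g = h g \<oplus> s \<otimes> z" using h by blast
    have "h g \<in> ?B" using adjoins_gens[OF k_subring hsR] g by auto
    then show "g \<in> ?W" using z by (intro W)
  qed
  ultimately have AW: "A \<subseteq> ?W" using adjoins_least gs(1) by blast
  have "?C \<subseteq> ?B"
  proof
    fix c assume c: "c \<in> ?C"
    then obtain a z where az: "a \<in> ?B" "z \<in> A" "c = a \<oplus> s \<otimes> z" using AW by blast
    have aC: "a \<in> ?C" using az BC by blast
    have cR: "a \<in> carrier R" "z \<in> carrier R" using aC az sA by auto
    have "c \<ominus> a = s \<otimes> z" unfolding az(3) using cR sR by algebra
    moreover have "c \<ominus> a \<in> ?C" by (rule minus_in_subring[OF sC(1) c aC])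
    ultimately have "s \<otimes> z \<in> ?C" by metis
    then have "s \<otimes> z = \<zero>" by (rule slice_kernel_not_factor[OF A E s _ az(2) refl])
    then show "c \<in> ?B" using az cR by simp
  qed
  then show ?thesis using BC hsC by blast
qed

end

section \<open>The Makar-Limanov invariant of a factorial threefold with a slice\<close>

text \<open>Divisibility, units and irreducible elements of \<open>C\<close> are those of \<open>R\<close>, so the divisor chain condition and
the primeness of irreducible elements descend.\<close>
lemma (in domain) factorial_domain_factorially_closed:
  assumes fact: "factorial_domain R" and C: "subring C R"
    and fc: "\<And>a b. \<lbrakk>a \<in> carrier R; b \<in> carrier R; a \<otimes> b \<in> C; a \<otimes> b \<noteq> \<zero>\<rbrakk> \<Longrightarrow> a \<in> C \<and> b \<in> C"
  shows "factorial_domain (R\<lparr>carrier := C\<rparr>)"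
proof -
  let ?S = "R\<lparr>carrier := C\<rparr>"
  let ?G = "mult_of R" and ?H = "mult_of ?S"
  interpret M: factorial_monoid ?G by (rule factorial_domain.axioms(2)[OF fact])
  interpret S: domain ?S by (rule subring_is_domain[OF C])
  have CR: "a \<in> C \<Longrightarrow> a \<in> carrier R" for a using subringE(1)[OF C] by auto
  have div: "a divides\<^bsub>?H\<^esub> b \<longleftrightarrow> a divides\<^bsub>?G\<^esub> b" if ab: "a \<in> C" "b \<in> C" "a \<noteq> \<zero>" "b \<noteq> \<zero>" for a b
  proof
    assume "a divides\<^bsub>?H\<^esub> b"
    then obtain c where "c \<in> C" "c \<noteq> \<zero>" "b = a \<otimes> c" by (auto simp: factor_def)
    then show "a divides\<^bsub>?G\<^esub> b" using CR[of c] by (auto simp: factor_def)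
  next
    assume "a divides\<^bsub>?G\<^esub> b"
    then obtain c where c: "c \<in> carrier R" "c \<noteq> \<zero>" "b = a \<otimes> c" by (auto simp: factor_def)
    then have "c \<in> C" using fc[of a c] ab CR[of a] by blast
    then show "a divides\<^bsub>?H\<^esub> b" using c by (auto simp: factor_def)
  qed
  have proper: "properfactor ?H a b \<longleftrightarrow> properfactor ?G a b"
    if "a \<in> C" "b \<in> C" "a \<noteq> \<zero>" "b \<noteq> \<zero>" for a b
    using that div by (simp add: properfactor_def)
  have units: "a \<in> Units ?H \<longleftrightarrow> a \<in> Units ?G" if a: "a \<in> C" "a \<noteq> \<zero>" for a
  proof
    assume "a \<in> Units ?H"
    then obtain b where "b \<in> C" "b \<noteq> \<zero>" "b \<otimes> a = \<one>" "a \<otimes> b = \<one>" by (auto simp: Units_def)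
    then show "a \<in> Units ?G" using CR[of a] CR[of b] a by (auto simp: Units_def)
  next
    assume "a \<in> Units ?G"
    then obtain b where b: "b \<in> carrier R" "b \<noteq> \<zero>" "b \<otimes> a = \<one>" "a \<otimes> b = \<one>" by (auto simp: Units_def)
    then have "b \<in> C" using fc[of a b] a CR[of a] subringE(3)[OF C] one_not_zero by simp
    then show "a \<in> Units ?H" using a b by (auto simp: Units_def)
  qed
  have "divisor_chain_condition_monoid ?H"
  proof (intro divisor_chain_condition_monoid.intro divisor_chain_condition_monoid_axioms.intro)
    show "comm_monoid_cancel ?H" by (rule S.mult_of.comm_monoid_cancel_axioms)
    have "{(x, y). x \<in> carrier ?H \<and> y \<in> carrier ?H \<and> properfactor ?H x y}
        \<subseteq> {(x, y). x \<in> carrier ?G \<and> y \<in> carrier ?G \<and> properfactor ?G x y}"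
      using proper CR by auto
    then show "wf {(x, y). x \<in> carrier ?H \<and> y \<in> carrier ?H \<and> properfactor ?H x y}"
      by (rule wf_subset[OF M.division_wellfounded])
  qed
  moreover have "primeness_condition_monoid ?H"
  proof (intro primeness_condition_monoid.intro primeness_condition_monoid_axioms.intro)
    show "comm_monoid_cancel ?H" by (rule S.mult_of.comm_monoid_cancel_axioms)
    fix a assume a: "a \<in> carrier ?H" "irreducible ?H a"
    then have aC: "a \<in> C" "a \<noteq> \<zero>" "a \<in> carrier R" using CR by auto
    have "irreducible ?G a"
    proof (rule irreducibleI)
      show "a \<notin> Units ?G" using a(2) units aC by (auto simp: irreducible_def)
      fix b assume b: "b \<in> carrier ?G" "properfactor ?G b a"
      obtain c where "c \<in> carrier R" "a = b \<otimes> c" using b by (auto simp: properfactor_def factor_def)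
      then have bC: "b \<in> C" "b \<noteq> \<zero>" using fc[of b c] b aC by auto
      then have "b \<in> Units ?H" using a(2) b proper[of b a] aC by (auto simp: irreducible_def)
      then show "b \<in> Units ?G" using units bC by blast
    qed
    then have "prime ?G a" using M.irreducible_prime aC by simp
    then have pr: "a \<notin> Units ?G" "\<And>x y. \<lbrakk>x \<in> carrier ?G; y \<in> carrier ?G; a divides\<^bsub>?G\<^esub> (x \<otimes> y)\<rbrakk>
        \<Longrightarrow> a divides\<^bsub>?G\<^esub> x \<or> a divides\<^bsub>?G\<^esub> y"
      by (auto simp: prime_def)
    show "prime ?H a"
    proof (rule primeI)
      show "a \<notin> Units ?H" using units aC pr(1) by blast
      fix x y assume xy: "x \<in> carrier ?H" "y \<in> carrier ?H" "a divides\<^bsub>?H\<^esub> (x \<otimes>\<^bsub>?H\<^esub> y)"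
      then have n: "x \<in> C" "y \<in> C" "x \<noteq> \<zero>" "y \<noteq> \<zero>" "x \<in> carrier R" "y \<in> carrier R" using CR by auto
      have "x \<otimes> y \<in> C" "x \<otimes> y \<noteq> \<zero>" using n subringE(6)[OF C] integral_iff by auto
      then have "a divides\<^bsub>?G\<^esub> (x \<otimes> y)" using xy(3) div aC by simp
      then have "a divides\<^bsub>?G\<^esub> x \<or> a divides\<^bsub>?G\<^esub> y" using pr(2) n by simp
      then show "a divides\<^bsub>?H\<^esub> x \<or> a divides\<^bsub>?H\<^esub> y" using div n aC by blast
    qed
  qed
  ultimately have "factorial_monoid ?H" using factorial_condition_one by blast
  then show ?thesis using S.domain_axioms by (simp add: factorial_domain_def)
qed

context char0_domain
begin

definition ml_invariant :: "'a set"
  where "ml_invariant = {f \<in> carrier R. \<forall>D. lnd_on k (carrier R) D \<longrightarrow> D f = \<zero>}"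

lemma ml_invariant_subalg: "subalg ml_invariant"
proof -
  have R: "subring (carrier R) R" "k \<subseteq> carrier R" using subalgD(1,2)[OF subalg_carrier] by auto
  have K: "subalg {f \<in> carrier R. D f = \<zero>}" if "lnd_on k (carrier R) D" for D
    using kernel_subalg[OF subalg_carrier] that by (simp add: lnd_on_def)
  have eq: "ml_invariant = \<Inter>(insert (carrier R) {{f \<in> carrier R. D f = \<zero>} | D. lnd_on k (carrier R) D})"
    by (auto simp: ml_invariant_def)
  have "subring ml_invariant R"
    unfolding eq using R(1) subalgD(1)[OF K] by (intro subring_Inter) auto
  moreover have "k \<subseteq> ml_invariant" unfolding eq using R(2) subalgD(2)[OF K] by blast
  ultimately show ?thesis by (simp add: subalg_def)
qed

lemma ml_invariant_factorially_closed: "factorially_closed ml_invariant (carrier R)"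
  unfolding factorially_closed_def
proof (intro conjI ballI impI)
  show "ml_invariant \<subseteq> carrier R" by (auto simp: ml_invariant_def)
  fix a b assume ab: "a \<in> carrier R" "b \<in> carrier R" "a \<otimes> b \<in> ml_invariant" "a \<otimes> b \<noteq> \<zero>"
  have "D a = \<zero> \<and> D b = \<zero>" if D: "lnd_on k (carrier R) D" for D
    using kernel_factorially_closed[OF subalg_carrier D] ab D
    unfolding factorially_closed_def ml_invariant_def by blast
  then show "a \<in> ml_invariant" "b \<in> ml_invariant" using ab(1,2) unfolding ml_invariant_def by blast+
qed

end

context alg_closed_domain
begin

text \<open>The cases \<open>ML = C\<close>, \<open>ML = R0\<close> and \<open>ML = k\<close>, where \<open>ML\<close> is the invariant, \<open>C = ker E\<close>, and \<open>R0\<close> is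
the kernel of a derivation of \<open>C\<close> with a slice \<open>x\<close>. They give the towers \<open>[s]\<close>, \<open>[x, s]\<close> and \<open>[r, x, s]\<close>.\<close>
theorem structure_of_sliced_ufd:
  assumes fact: "factorial_domain R"
    and gs: "set gs \<subseteq> carrier R" "adjoins k gs = carrier R"
    and short: "\<And>xs. tower {\<zero>} k xs \<Longrightarrow> length xs \<le> 3"
    and E: "lnd_on k (carrier R) E" and s: "s \<in> carrier R" "E s = \<one>"
  shows "\<exists>xs. tower {\<zero>} ml_invariant xs \<and> adjoins ml_invariant xs = carrier R \<and>
    (\<forall>D. lnd_on k ml_invariant D \<longrightarrow> (\<forall>a\<in>ml_invariant. D a = \<zero>)) \<and> (\<exists>hs. set hs \<subseteq> ml_invariant \<and> adjoins k hs = ml_invariant)"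
proof -
  note R = subalg_carrier
  let ?C = "{a \<in> carrier R. E a = \<zero>}"
  have dE: "derivation_on k (carrier R) E" using E by (simp add: lnd_on_def)
  note C = kernel_subalg[OF R dE] and fcC = kernel_factorially_closed[OF R E]
  note gen_s = slice_generates[OF R E s] and transc_s = slice_transcendental[OF R E s]
  obtain cs where cs: "set cs \<subseteq> ?C" "adjoins k cs = ?C"
    using slice_kernel_finitely_generated[OF R E s gs(2,1)] by blast
  have csR: "set cs \<subseteq> carrier R" using cs(1) by blast
  have inv_C: "ml_invariant \<subseteq> ?C" using E by (auto simp: ml_invariant_def)
  show ?thesis
  proof (cases "?C \<subseteq> ml_invariant")
    case True
    then have eq: "ml_invariant = ?C" using inv_C by blast
    have "D a = \<zero>" if D: "lnd_on k ml_invariant D" "a \<in> ml_invariant" for D a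
    proof -
      obtain D' where D': "lnd_on k (carrier R) D'" "\<forall>a\<in>?C. D' a = D a"
        using extend_lnd[OF C s(1) transc_s, of D] D(1) unfolding eq gen_s by blast
      have "D' a = \<zero>" using D(2) D'(1) by (simp add: ml_invariant_def)
      then show ?thesis using D'(2) D(2) inv_C by auto
    qed
    moreover have "tower {\<zero>} ml_invariant [s]" "adjoins ml_invariant [s] = carrier R"
      unfolding eq using s transc_s gen_s by simp_all
    moreover have "set cs \<subseteq> ml_invariant \<and> adjoins k cs = ml_invariant" using cs eq by simp
    ultimately show ?thesis by blast
  next
    case False
    then obtain a0 D where D: "a0 \<in> carrier R" "E a0 = \<zero>" "lnd_on k (carrier R) D" "D a0 \<noteq> \<zero>"
      by (auto simp: ml_invariant_def)
    obtain F0 a1 where F0: "lnd_on k ?C F0" "a1 \<in> ?C" "F0 a1 \<noteq> \<zero>"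
      using homogenize_on_kernel[OF R E s D(3,1,2,4) cs(2) csR] by blast
    have short2: "length xs \<le> 2" if xs: "set xs \<subseteq> ?C" "tower {\<zero>} k xs" for xs
    proof -
      have "adjoins k xs \<subseteq> ?C" by (rule adjoins_least[OF subalgD(1,2)[OF C] xs(1)])
      then have "transc_mod {\<zero>} (adjoins k xs) s" by (rule transc_mod_antimono[OF transc_s])
      then have "tower {\<zero>} k (xs @ [s])" using xs(2) s(1) by (simp add: tower_append)
      from short[OF this] show ?thesis by simp
    qed
    obtain F x where F: "lnd_on k ?C F" "x \<in> ?C" "F x = \<one>"
      using slice_exists[OF fact C fcC F0 short2] by blast
    have dF: "derivation_on k ?C F" using F by (simp add: lnd_on_def)
    let ?R0 = "{a \<in> ?C. F a = \<zero>}"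
    note R0 = kernel_subalg[OF C dF]
    have fcR0: "factorially_closed ?R0 (carrier R)"
      by (rule factorially_closed_trans[OF kernel_factorially_closed[OF C F(1)] fcC])
    note gen_x = slice_generates[OF C F] and transc_x = slice_transcendental[OF C F]
    have xR: "x \<in> carrier R" using F(2) by simp
    have tower_xs: "tower {\<zero>} ?R0 [x, s]" "adjoins ?R0 [x, s] = carrier R"
      using xR s(1) transc_x transc_s gen_x gen_s by simp_all
    have inv_R0: "ml_invariant \<subseteq> ?R0"
    proof
      fix f assume f: "f \<in> ml_invariant"
      obtain F' where F': "lnd_on k (carrier R) F'" "\<forall>a\<in>?C. F' a = F a"
        using extend_lnd[OF C s(1) transc_s F(1)] unfolding gen_s by blast
      have "F' f = \<zero>" using f F'(1) by (simp add: ml_invariant_def)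
      then show "f \<in> ?R0" using F'(2) f inv_C by auto
    qed
    show ?thesis
    proof (cases "?R0 \<subseteq> ml_invariant")
      case True
      then have eq: "ml_invariant = ?R0" using inv_R0 by blast
      have "D a = \<zero>" if D: "lnd_on k ml_invariant D" "a \<in> ml_invariant" for D a
      proof -
        obtain D' where D': "lnd_on k ?C D'" "\<forall>a\<in>?R0. D' a = D a"
          using extend_lnd[OF R0 xR transc_x, of D] D(1) unfolding eq gen_x by blast
        obtain D'' where D'': "lnd_on k (carrier R) D''" "\<forall>a\<in>?C. D'' a = D' a"
          using extend_lnd[OF C s(1) transc_s D'(1)] unfolding gen_s by blast
        have "D'' a = \<zero>" using D(2) D''(1) by (simp add: ml_invariant_def)
        moreover have "a \<in> ?R0" using D(2) inv_R0 by blast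
        ultimately show ?thesis using D'(2) D''(2) by simp
      qed
      moreover obtain hs where "set hs \<subseteq> ?R0" "adjoins k hs = ?R0"
        using slice_kernel_finitely_generated[OF C F cs(2) csR] by blast
      ultimately show ?thesis using tower_xs unfolding eq[symmetric] by blast
    next
      case False
      then obtain r0 D where D: "r0 \<in> ?R0" "lnd_on k (carrier R) D" "D r0 \<noteq> \<zero>"
        by (auto simp: ml_invariant_def)
      have short1: "length xs \<le> 1" if xs: "set xs \<subseteq> ?R0" "tower {\<zero>} k xs" for xs
      proof -
        have "adjoins k xs \<subseteq> ?R0" by (rule adjoins_least[OF subalgD(1,2)[OF R0] xs(1)])
        then have "transc_mod {\<zero>} (adjoins k xs) x" by (rule transc_mod_antimono[OF transc_x])
        then have "tower {\<zero>} k (xs @ [x])" using xs(2) xR by (simp add: tower_append)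
        moreover have "set (xs @ [x]) \<subseteq> ?C" using xs(1) F(2) by auto
        ultimately have "length (xs @ [x]) \<le> 2" using short2 by blast
        then show ?thesis by simp
      qed
      obtain r where r: "r \<in> ?R0" "?R0 = adjoin k r" "transc_mod {\<zero>} k r" "{a \<in> ?R0. D a = \<zero>} \<subseteq> k"
        using line_of_moving_lnd[OF fact R0 fcR0 D(2,1,3) short1] by blast
      have rR: "r \<in> carrier R" using r(1) by simp
      have "ml_invariant \<subseteq> {a \<in> ?R0. D a = \<zero>}" using inv_R0 D(2) by (auto simp: ml_invariant_def)
      then have eq: "ml_invariant = k" using r(4) subalgD(2)[OF ml_invariant_subalg] by blast
      have "tower {\<zero>} k ([r] @ [x, s])" "adjoins k ([r] @ [x, s]) = carrier R"
        using tower_xs r(2,3) rR by (simp_all only: tower_append adjoins_simps tower.simps)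
      moreover have "D a = \<zero>" if "lnd_on k k D" "a \<in> k" for D a
        using that by (simp add: lnd_on_def derivation_on_def)
      moreover have "set [] \<subseteq> k \<and> adjoins k [] = k" by simp
      ultimately show ?thesis unfolding eq by blast
    qed
  qed
qed

end

section \<open>Towers and polynomial rings in several variables\<close>

primrec (in ring) monom_val :: "(nat \<Rightarrow> 'a) \<Rightarrow> nat \<Rightarrow> nat multiset \<Rightarrow> 'a"
  where "monom_val x 0 m = \<one>"
  | "monom_val x (Suc n) m = monom_val x n m \<otimes> x n [^] count m n"

definition (in ring) mpoly_val :: "(nat \<Rightarrow> 'a) \<Rightarrow> nat \<Rightarrow> (nat multiset \<Rightarrow> 'a) \<Rightarrow> 'a"
  where "mpoly_val x n P = (\<Oplus>m\<in>{m. P m \<noteq> \<zero>}. P m \<otimes> monom_val x n m)"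

context cring
begin

text \<open>Finite sums are defined relative to the carrier, so this is not a matter of unfolding.\<close>
lemma finsum_subring:
  assumes "subring A R" "finite F" "\<And>i. i \<in> F \<Longrightarrow> f i \<in> A"
  shows "finsum (R\<lparr>carrier := A\<rparr>) f F = finsum R f F"
proof -
  interpret S: cring "R\<lparr>carrier := A\<rparr>" by (rule sub_cring[OF assms(1)])
  have A_carrier: "a \<in> A \<Longrightarrow> a \<in> carrier R" for a using subringE(1)[OF assms(1)] by auto
  show ?thesis using assms(2,3)
  proof (induction F)
    case (insert i F)
    have "finsum (R\<lparr>carrier := A\<rparr>) f (insert i F) = f i \<oplus> finsum (R\<lparr>carrier := A\<rparr>) f F"
      using insert by (subst S.finsum_insert) auto
    moreover have "finsum R f (insert i F) = f i \<oplus> finsum R f F"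
      using insert A_carrier by (subst finsum_insert) auto
    ultimately show ?case using insert by simp
  qed simp
qed

context
  fixes A x
  assumes A: "subring A R" and range_x: "range (x :: nat \<Rightarrow> 'a) \<subseteq> carrier R"
begin

private lemma x: "x i \<in> carrier R" using range_x by auto

private abbreviation "S \<equiv> R\<lparr>carrier := A\<rparr>"
private abbreviation "pset n \<equiv> ring.indexed_pset S {..<n} A"
private abbreviation "const \<equiv> ring.indexed_const S"
private abbreviation "padd \<equiv> ring.indexed_padd S"
private abbreviation "pmult \<equiv> ring.indexed_pmult S"

private lemma S_ring: "ring S" by (rule subring_is_ring[OF A])
private lemma A_carrier: "a \<in> A \<Longrightarrow> a \<in> carrier R" using subringE(1)[OF A] by auto

private lemma const_apply: "const a m = (if m = {#} then a else \<zero>)"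
  by (simp add: ring.indexed_const_def[OF S_ring])
private lemma padd_apply: "padd P Q m = P m \<oplus> Q m"
  by (simp add: ring.indexed_padd_def[OF S_ring])
private lemma pmult_apply: "pmult P i m = (if i \<in># m then P (m - {#i#}) else \<zero>)"
  by (simp add: ring.indexed_pmult_def[OF S_ring])

private lemma pset_intros:
  "a \<in> A \<Longrightarrow> const a \<in> pset n" "\<lbrakk>P \<in> pset n; Q \<in> pset n\<rbrakk> \<Longrightarrow> padd P Q \<in> pset n"
  "\<lbrakk>P \<in> pset n; i < n\<rbrakk> \<Longrightarrow> pmult P i \<in> pset n"
  by (auto intro: ring.indexed_pset.intros[OF S_ring])

private lemma pset_induct [consumes 1, case_names const add var]:
  assumes "P \<in> pset n"
    and "\<And>a. a \<in> A \<Longrightarrow> \<Phi> (const a)"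
    and "\<And>P Q. \<lbrakk>P \<in> pset n; \<Phi> P; Q \<in> pset n; \<Phi> Q\<rbrakk> \<Longrightarrow> \<Phi> (padd P Q)"
    and "\<And>P i. \<lbrakk>P \<in> pset n; \<Phi> P; i < n\<rbrakk> \<Longrightarrow> \<Phi> (pmult P i)"
  shows "\<Phi> P"
  using assms(2-4) by (intro ring.indexed_pset.induct[OF S_ring assms(1), of \<Phi>]) auto

private lemma pset_coeff: assumes "P \<in> pset n" shows "P m \<in> A"
  using assms
  by (induct arbitrary: m rule: pset_induct)
    (auto simp: const_apply padd_apply pmult_apply subringE[OF A])

private lemma pset_finite: assumes "P \<in> pset n" shows "finite {m. P m \<noteq> \<zero>}"
  using assms
proof (induct rule: pset_induct)
  case (const a)
  have "{m. const a m \<noteq> \<zero>} \<subseteq> {{#}}" by (auto simp: const_apply)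
  then show ?case using finite_subset by blast
next
  case (add P Q)
  have "{m. padd P Q m \<noteq> \<zero>} \<subseteq> {m. P m \<noteq> \<zero>} \<union> {m. Q m \<noteq> \<zero>}" by (auto simp: padd_apply)
  then show ?case using add finite_subset by blast
next
  case (var P i)
  have "{m. pmult P i m \<noteq> \<zero>} \<subseteq> add_mset i ` {m. P m \<noteq> \<zero>}"
  proof
    fix m assume "m \<in> {m. pmult P i m \<noteq> \<zero>}"
    then have "i \<in># m" "P (m - {#i#}) \<noteq> \<zero>" by (auto simp: pmult_apply split: if_splits)
    then show "m \<in> add_mset i ` {m. P m \<noteq> \<zero>}" by (intro image_eqI[of _ _ "m - {#i#}"]) auto
  qed
  then show ?case using var finite_subset by blast
qed

lemma monom_val_closed [simp, intro]: "monom_val x n m \<in> carrier R"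
  using x by (induction n) auto

private lemma monom_val_empty: "monom_val x n {#} = \<one>"
  using x by (induction n) auto

private lemma monom_val_add: "i < n \<Longrightarrow> monom_val x n (add_mset i m) = monom_val x n m \<otimes> x i"
proof (induction n)
  case (Suc n)
  have *: "monom_val x n (add_mset n m) = monom_val x n m"
  proof -
    have "j \<le> n \<Longrightarrow> monom_val x j (add_mset n m) = monom_val x j m" for j by (induction j) auto
    then show ?thesis by simp
  qed
  show ?case
  proof (cases "i = n")
    case True
    then show ?thesis using * x by (simp add: m_assoc)
  next
    case False
    then show ?thesis using Suc x by (simp add: m_ac)
  qed
qed simp

private lemma mpoly_val_superset:
  assumes "P \<in> pset l" "finite F" "{m. P m \<noteq> \<zero>} \<subseteq> F"
  shows "mpoly_val x n P = (\<Oplus>m\<in>F. P m \<otimes> monom_val x n m)"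
  unfolding mpoly_val_def
proof (rule add.finprod_mono_neutral_cong_left)
  show "(\<lambda>m. P m \<otimes> monom_val x n m) \<in> F \<rightarrow> carrier R"
    using pset_coeff[OF assms(1)] A_carrier by auto
qed (use assms in auto)

private lemma mpoly_val_closed: assumes "P \<in> pset l" shows "mpoly_val x n P \<in> carrier R"
  unfolding mpoly_val_def using pset_coeff[OF assms] A_carrier by (intro finsum_closed) auto

private lemma mpoly_val_const:
  assumes "a \<in> A" shows "mpoly_val x n (const a) = a"
proof -
  have "mpoly_val x n (const a) = (\<Oplus>m\<in>{{#}}. const a m \<otimes> monom_val x n m)"
    using assms pset_intros(1) by (intro mpoly_val_superset) (auto simp: const_apply)
  then show ?thesis using assms A_carrier by (simp add: const_apply monom_val_empty)
qed

private lemma mpoly_val_add: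
  assumes "P \<in> pset n" "Q \<in> pset n"
  shows "mpoly_val x n (padd P Q) = mpoly_val x n P \<oplus> mpoly_val x n Q"
proof -
  let ?F = "{m. P m \<noteq> \<zero>} \<union> {m. Q m \<noteq> \<zero>}"
  have F: "finite ?F" using pset_finite assms by auto
  have c: "P m \<in> carrier R" "Q m \<in> carrier R" for m using pset_coeff assms A_carrier by auto
  have "mpoly_val x n (padd P Q) = (\<Oplus>m\<in>?F. padd P Q m \<otimes> monom_val x n m)"
    using assms pset_intros(2) F by (intro mpoly_val_superset) (auto simp: padd_apply)
  also have "\<dots> = (\<Oplus>m\<in>?F. P m \<otimes> monom_val x n m \<oplus> Q m \<otimes> monom_val x n m)"
    using c by (simp add: padd_apply l_distr)
  also have "\<dots> = (\<Oplus>m\<in>?F. P m \<otimes> monom_val x n m) \<oplus> (\<Oplus>m\<in>?F. Q m \<otimes> monom_val x n m)"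
    using c by (intro finsum_addf) auto
  also have "(\<Oplus>m\<in>?F. P m \<otimes> monom_val x n m) = mpoly_val x n P"
    using assms F by (intro mpoly_val_superset[symmetric]) auto
  also have "(\<Oplus>m\<in>?F. Q m \<otimes> monom_val x n m) = mpoly_val x n Q"
    using assms F by (intro mpoly_val_superset[symmetric]) auto
  finally show ?thesis .
qed

private lemma mpoly_val_pmult:
  assumes P: "P \<in> pset l" "i < l" "i < n"
  shows "mpoly_val x n (pmult P i) = mpoly_val x n P \<otimes> x i"
proof -
  let ?F = "{m. P m \<noteq> \<zero>}"
  have F: "finite ?F" using pset_finite P by auto
  have c: "P m \<in> carrier R" for m using pset_coeff[OF P(1)] A_carrier by auto
  have "mpoly_val x n (pmult P i) = (\<Oplus>m\<in>add_mset i ` ?F. pmult P i m \<otimes> monom_val x n m)"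
  proof (rule mpoly_val_superset[OF pset_intros(3)[OF P(1,2)]])
    show "{m. pmult P i m \<noteq> \<zero>} \<subseteq> add_mset i ` ?F"
    proof
      fix m assume "m \<in> {m. pmult P i m \<noteq> \<zero>}"
      then have "i \<in># m" "P (m - {#i#}) \<noteq> \<zero>" by (auto simp: pmult_apply split: if_splits)
      then show "m \<in> add_mset i ` ?F" by (intro image_eqI[of _ _ "m - {#i#}"]) auto
    qed
  qed (use F in simp)
  also have "\<dots> = (\<Oplus>m\<in>?F. pmult P i (add_mset i m) \<otimes> monom_val x n (add_mset i m))"
    using c by (intro finsum_reindex) (auto simp: inj_on_def pmult_apply)
  also have "\<dots> = (\<Oplus>m\<in>?F. (P m \<otimes> monom_val x n m) \<otimes> x i)"
    using c x P(3) by (intro finsum_cong') (auto simp: pmult_apply monom_val_add m_assoc)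
  also have "\<dots> = (\<Oplus>m\<in>?F. P m \<otimes> monom_val x n m) \<otimes> x i"
    using c x F by (intro finsum_ldistr[symmetric]) auto
  finally show ?thesis by (simp add: mpoly_val_def)
qed

text \<open>The polynomial is built up from constants by sums and by multiplication with variables, and all
three commute with scalar multiples.\<close>
private lemma smult_pset:
  assumes a: "a \<in> A" and Q: "Q \<in> pset n"
  shows "(\<lambda>m. a \<otimes> Q m) \<in> pset n \<and> mpoly_val x n (\<lambda>m. a \<otimes> Q m) = a \<otimes> mpoly_val x n Q"
  using Q
proof (induct rule: pset_induct)
  case (const b)
  have eq: "(\<lambda>m. a \<otimes> const b m) = const (a \<otimes> b)" using a A_carrier by (auto simp: const_apply)
  have ab: "a \<otimes> b \<in> A" using a const subringE(6)[OF A] by auto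
  show ?case unfolding eq using pset_intros(1)[OF ab] mpoly_val_const[OF ab] mpoly_val_const[OF const]
    by simp
next
  case (add P Q)
  have c: "P m \<in> carrier R" "Q m \<in> carrier R" for m using add pset_coeff A_carrier by auto
  have "(\<lambda>m. a \<otimes> padd P Q m) = padd (\<lambda>m. a \<otimes> P m) (\<lambda>m. a \<otimes> Q m)"
    using a A_carrier c by (auto simp: padd_apply r_distr)
  then show ?case using add a A_carrier by (simp add: pset_intros mpoly_val_add r_distr mpoly_val_closed)
next
  case (var P i)
  have "(\<lambda>m. a \<otimes> pmult P i m) = pmult (\<lambda>m. a \<otimes> P m) i"
    using a A_carrier by (auto simp: pmult_apply)
  then show ?case
    using var a A_carrier x mpoly_val_pmult[of _ n i n] by (simp add: pset_intros m_assoc mpoly_val_closed)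
qed

text \<open>The product of \<open>mpoly_ring\<close>, formed with the operations of the ambient ring.\<close>
definition convolution :: "(nat multiset \<Rightarrow> 'a) \<Rightarrow> (nat multiset \<Rightarrow> 'a) \<Rightarrow> nat multiset \<Rightarrow> 'a"
  where "convolution P Q m = (\<Oplus>u\<in>{u. u \<subseteq># m}. P u \<otimes> Q (m - u))"

private lemma finite_submultisets: "finite {u. u \<subseteq># (m :: nat multiset)}"
proof (rule finite_subset)
  show "{u. u \<subseteq># m} \<subseteq> (\<Union>n\<le>size m. multisets_of_size (set_mset m) n)"
    using size_mset_mono set_mset_mono by (fastforce simp: multisets_of_size_def)
  show "finite (\<Union>n\<le>size m. multisets_of_size (set_mset m) n)"
    by (intro finite_UN_I finite_atMost finite_multisets_of_size) simp
qed

private lemma convolution_const: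
  assumes "a \<in> A" "\<And>m. Q m \<in> A" shows "convolution (const a) Q m = a \<otimes> Q m"
proof -
  have "convolution (const a) Q m = (\<Oplus>u\<in>{{#}}. const a u \<otimes> Q (m - u))"
    unfolding convolution_def using assms A_carrier finite_submultisets
    by (intro add.finprod_mono_neutral_cong_left[symmetric]) (auto simp: const_apply)
  then show ?thesis using assms A_carrier by (simp add: const_apply)
qed

private lemma convolution_padd:
  assumes "\<And>m. P m \<in> A" "\<And>m. P' m \<in> A" "\<And>m. Q m \<in> A"
  shows "convolution (padd P P') Q = padd (convolution P Q) (convolution P' Q)"
proof
  fix m
  have c: "P m \<in> carrier R" "P' m \<in> carrier R" "Q m \<in> carrier R" for m using assms A_carrier by auto
  have "convolution (padd P P') Q m = (\<Oplus>u\<in>{u. u \<subseteq># m}. P u \<otimes> Q (m - u) \<oplus> P' u \<otimes> Q (m - u))"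
    unfolding convolution_def using c by (simp add: padd_apply l_distr)
  also have "\<dots> = convolution P Q m \<oplus> convolution P' Q m"
    unfolding convolution_def using c by (intro finsum_addf) auto
  finally show "convolution (padd P P') Q m = padd (convolution P Q) (convolution P' Q) m" by (simp add: padd_apply)
qed

private lemma convolution_pmult:
  assumes "\<And>m. P m \<in> A" "\<And>m. Q m \<in> A"
  shows "convolution (pmult P i) Q = pmult (convolution P Q) i"
proof
  fix m
  have c: "P m \<in> carrier R" "Q m \<in> carrier R" for m using assms A_carrier by auto
  have c': "pmult P i m \<in> carrier R" for m using c by (simp add: pmult_apply)
  show "convolution (pmult P i) Q m = pmult (convolution P Q) i m"
  proof (cases "i \<in># m")
    case False
    have "convolution (pmult P i) Q m = (\<Oplus>u\<in>{u. u \<subseteq># m}. \<zero>)"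
      unfolding convolution_def
    proof (rule finsum_cong')
      fix u assume "u \<in> {u. u \<subseteq># m}"
      then have "i \<notin># u" using False mset_subset_eqD[of u m i] by auto
      then show "pmult P i u \<otimes> Q (m - u) = \<zero>" using c by (simp add: pmult_apply)
    qed auto
    then show ?thesis using False by (simp add: pmult_apply)
  next
    case True
    let ?U = "{v. v \<subseteq># m - {#i#}}"
    have "convolution (pmult P i) Q m = (\<Oplus>u\<in>add_mset i ` ?U. pmult P i u \<otimes> Q (m - u))"
      unfolding convolution_def
    proof (rule add.finprod_mono_neutral_cong_left[symmetric])
      show "add_mset i ` ?U \<subseteq> {u. u \<subseteq># m}"
        using True by (auto simp: insert_subset_eq_iff)
      fix u assume u: "u \<in> {u. u \<subseteq># m} - add_mset i ` ?U"
      have "i \<notin># u"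
      proof
        assume i: "i \<in># u"
        have eq: "add_mset i (u - {#i#}) = u" using i by simp
        have "add_mset i (u - {#i#}) \<subseteq># m" using u unfolding eq by simp
        then have "u - {#i#} \<in> ?U" unfolding insert_subset_eq_iff by simp
        then have "add_mset i (u - {#i#}) \<in> add_mset i ` ?U" by (rule imageI)
        then show False using u unfolding eq by simp
      qed
      then show "pmult P i u \<otimes> Q (m - u) = \<zero>" using c by (simp add: pmult_apply)
    qed (use c' c finite_submultisets in auto)
    also have "\<dots> = (\<Oplus>v\<in>?U. pmult P i (add_mset i v) \<otimes> Q (m - add_mset i v))"
      using c c' by (intro finsum_reindex) (auto simp: inj_on_def)
    also have "\<dots> = convolution P Q (m - {#i#})"
      unfolding convolution_def using c by (intro finsum_cong') (auto simp: pmult_apply)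
    finally show ?thesis using True by (simp add: pmult_apply)
  qed
qed

text \<open>Induction on the first factor: convolution is bilinear and commutes with multiplication by a variable,
so it is determined by its effect on constants.\<close>
private lemma convolution_pset:
  assumes P: "P \<in> pset n" and Q: "Q \<in> pset n"
  shows "convolution P Q \<in> pset n \<and> mpoly_val x n (convolution P Q) = mpoly_val x n P \<otimes> mpoly_val x n Q"
  using P
proof (induct rule: pset_induct)
  case (const a)
  have "convolution (const a) Q = (\<lambda>m. a \<otimes> Q m)" using convolution_const[OF const] pset_coeff[OF Q] by auto
  then show ?case using smult_pset[OF const Q] mpoly_val_const[OF const] by simp
next
  case (add P P')
  have "convolution (padd P P') Q = padd (convolution P Q) (convolution P' Q)"
    using pset_coeff add Q by (intro convolution_padd) auto
  then show ?case using add Q by (simp add: pset_intros mpoly_val_add l_distr mpoly_val_closed)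
next
  case (var P i)
  have "convolution (pmult P i) Q = pmult (convolution P Q) i"
    using pset_coeff var Q by (intro convolution_pmult) auto
  then show ?case using var Q x mpoly_val_pmult[of _ n i n] 
    by (simp add: pset_intros m_ac mpoly_val_closed)
qed

private lemma mpoly_mult:
  assumes "P \<in> pset n" "Q \<in> pset n" shows "P \<otimes>\<^bsub>ring.mpoly_ring S n\<^esub> Q = convolution P Q"
  unfolding ring.mpoly_ring_def[OF S_ring] convolution_def fun_eq_iff
  using pset_coeff[OF assms(1)] pset_coeff[OF assms(2)] subringE(6)[OF A]
  by (auto intro!: finsum_subring[OF A finite_submultisets])

lemma mpoly_val_hom: "mpoly_val x n \<in> ring_hom (ring.mpoly_ring S n) R"
proof (rule ring_hom_memI)
  have carr: "carrier (ring.mpoly_ring S n) = pset n"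
    by (simp add: ring.mpoly_ring_def[OF S_ring])
  fix P assume P: "P \<in> carrier (ring.mpoly_ring S n)"
  then show "mpoly_val x n P \<in> carrier R" using carr mpoly_val_closed by auto
  fix Q assume Q: "Q \<in> carrier (ring.mpoly_ring S n)"
  show "mpoly_val x n (P \<otimes>\<^bsub>ring.mpoly_ring S n\<^esub> Q) = mpoly_val x n P \<otimes> mpoly_val x n Q"
    using convolution_pset P Q mpoly_mult carr by simp
  show "mpoly_val x n (P \<oplus>\<^bsub>ring.mpoly_ring S n\<^esub> Q) = mpoly_val x n P \<oplus> mpoly_val x n Q"
    using mpoly_val_add P Q carr by (simp add: ring.mpoly_ring_def[OF S_ring])
next
  show "mpoly_val x n \<one>\<^bsub>ring.mpoly_ring S n\<^esub> = \<one>"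
    using mpoly_val_const[OF subringE(3)[OF A]] by (simp add: ring.mpoly_ring_def[OF S_ring])
qed

private lemma mpoly_val_image_subring: "subring (mpoly_val x n ` pset n) R"
proof (rule subringI)
  show "mpoly_val x n ` pset n \<subseteq> carrier R" using mpoly_val_closed by auto
  show "\<one> \<in> mpoly_val x n ` pset n"
    using mpoly_val_const[OF subringE(3)[OF A], of n] pset_intros(1)[OF subringE(3)[OF A]] by (metis imageI)
  fix y assume "y \<in> mpoly_val x n ` pset n"
  then obtain P where P: "P \<in> pset n" "y = mpoly_val x n P" by auto
  have "\<ominus> \<one> \<in> A" by (rule subringE(5)[OF A subringE(3)[OF A]])
  from smult_pset[OF this P(1)] show "\<ominus> y \<in> mpoly_val x n ` pset n"
    using mpoly_val_closed[OF P(1)] P(2) a_inv_as_mult by (metis imageI)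
  fix z assume "z \<in> mpoly_val x n ` pset n"
  then obtain Q where Q: "Q \<in> pset n" "z = mpoly_val x n Q" by auto
  show "y \<otimes> z \<in> mpoly_val x n ` pset n" using convolution_pset[OF P(1) Q(1)] P Q by (metis imageI)
  show "y \<oplus> z \<in> mpoly_val x n ` pset n"
    using mpoly_val_add[OF P(1) Q(1)] pset_intros(2)[OF P(1) Q(1)] P Q by (metis imageI)
qed

private lemma var_in_image: assumes "i < n" shows "x i \<in> mpoly_val x n ` pset n"
proof -
  have one: "\<one> \<in> A" by (rule subringE(3)[OF A])
  have "mpoly_val x n (pmult (const \<one>) i) = x i"
    using mpoly_val_pmult[OF pset_intros(1)[OF one] assms assms] mpoly_val_const[OF one] x by simp
  then show ?thesis using pset_intros(3)[OF pset_intros(1)[OF one] assms] by (metis imageI)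
qed

private lemma base_in_image: "A \<subseteq> mpoly_val x n ` pset n"
proof
  fix a assume "a \<in> A"
  then show "a \<in> mpoly_val x n ` pset n"
    using mpoly_val_const[of a n] pset_intros(1)[of a n] by (metis imageI)
qed

lemma mpoly_val_image: "mpoly_val x n ` pset n = adjoins A (map x [0..<n])"
proof
  let ?A = "adjoins A (map x [0..<n])"
  have xs: "set (map x [0..<n]) \<subseteq> carrier R" using x by auto
  note B = adjoins_subring[OF A xs]
  have "mpoly_val x n P \<in> ?A" if "P \<in> pset n" for P
    using that
  proof (induct rule: pset_induct)
    case (const a) then show ?case using mpoly_val_const B by auto
  next
    case (add P Q) then show ?case using mpoly_val_add subringE(7)[OF B(1)] by simp
  next
    case (var P i)
    have "x i \<in> ?A" using adjoins_gens[OF A xs] var(3) by auto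
    then show ?case using mpoly_val_pmult[of P n i n] var subringE(6)[OF B(1)] by simp
  qed
  then show "mpoly_val x n ` pset n \<subseteq> ?A" by auto
  show "?A \<subseteq> mpoly_val x n ` pset n"
    using var_in_image by (intro adjoins_least[OF mpoly_val_image_subring base_in_image]) auto
qed

text \<open>A polynomial in \<open>n + 1\<close> variables is a polynomial in the last one; \<open>c j\<close> collects the monomials in which
the variable \<open>n\<close> has exponent \<open>j\<close>.\<close>
private lemma last_variable:
  assumes "P \<in> pset (Suc n)"
  shows "\<exists>c d. (\<forall>j. c j \<in> pset n) \<and> (\<forall>j\<ge>d. c j = const \<zero>) \<and>
    mpoly_val x (Suc n) P = poly_val (\<lambda>j. mpoly_val x n (c j)) d (x n) \<and>
    (\<forall>m. P m = c (count m n) (filter_mset (\<lambda>i. i \<noteq> n) m))"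
  using assms
proof (induct rule: pset_induct)
  case (const a)
  have z: "\<zero> \<in> A" by (rule subringE(2)[OF A])
  let ?c = "case_nat (const a) (\<lambda>_. const \<zero>)"
  show ?case
  proof (intro exI[of _ ?c] exI[of _ "Suc 0"] conjI allI impI)
    show "?c j \<in> pset n" for j using const z pset_intros(1) by (auto split: nat.split)
    show "?c j = const \<zero>" if "Suc 0 \<le> j" for j using that by (cases j) auto
    show "mpoly_val x (Suc n) (const a) = poly_val (\<lambda>j. mpoly_val x n (?c j)) (Suc 0) (x n)"
      using const x A_carrier by (simp add: mpoly_val_const)
    show "const a m = ?c (count m n) (filter_mset (\<lambda>i. i \<noteq> n) m)" for m
    proof (cases "count m n")
      case 0
      then have "filter_mset (\<lambda>i. i \<noteq> n) m = m"
        by (intro multiset_eqI) auto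
      then show ?thesis using 0 by simp
    next
      case (Suc j)
      then have "m \<noteq> {#}" by auto
      then show ?thesis using Suc by (simp add: const_apply)
    qed
  qed
next
  case (add P Q)
  obtain c d where c: "\<forall>j. c j \<in> pset n" "\<forall>j\<ge>d. c j = const \<zero>"
    "mpoly_val x (Suc n) P = poly_val (\<lambda>j. mpoly_val x n (c j)) d (x n)"
    "\<forall>m. P m = c (count m n) (filter_mset (\<lambda>i. i \<noteq> n) m)" using add(2) by blast
  obtain c' d' where c': "\<forall>j. c' j \<in> pset n" "\<forall>j\<ge>d'. c' j = const \<zero>"
    "mpoly_val x (Suc n) Q = poly_val (\<lambda>j. mpoly_val x n (c' j)) d' (x n)"
    "\<forall>m. Q m = c' (count m n) (filter_mset (\<lambda>i. i \<noteq> n) m)" using add(4) by blast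
  have z: "\<zero> \<in> A" by (rule subringE(2)[OF A])
  have cl: "mpoly_val x n (c j) \<in> carrier R" "mpoly_val x n (c' j) \<in> carrier R" for j
    using c(1) c'(1) mpoly_val_closed by blast+
  let ?D = "max d d'"
  have 1: "poly_val (\<lambda>j. mpoly_val x n (c j)) ?D (x n) = mpoly_val x (Suc n) P"
    unfolding c(3) using cl x c(2) z by (intro poly_val_extend) (auto simp: mpoly_val_const)
  have 2: "poly_val (\<lambda>j. mpoly_val x n (c' j)) ?D (x n) = mpoly_val x (Suc n) Q"
    unfolding c'(3) using cl x c'(2) z by (intro poly_val_extend) (auto simp: mpoly_val_const)
  show ?case
  proof (intro exI[of _ "\<lambda>j. padd (c j) (c' j)"] exI[of _ ?D] conjI allI impI)
    show "padd (c j) (c' j) \<in> pset n" for j using c(1) c'(1) pset_intros(2) by blast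
    show "padd (c j) (c' j) = const \<zero>" if "?D \<le> j" for j
      using that c(2) c'(2) by (auto simp: fun_eq_iff padd_apply const_apply)
    have "(\<lambda>j. mpoly_val x n (padd (c j) (c' j))) = (\<lambda>j. mpoly_val x n (c j) \<oplus> mpoly_val x n (c' j))"
      using c(1) c'(1) mpoly_val_add by blast
    then show "mpoly_val x (Suc n) (padd P Q) = poly_val (\<lambda>j. mpoly_val x n (padd (c j) (c' j))) ?D (x n)"
      using mpoly_val_add[OF add(1,3)] poly_val_add[of "\<lambda>j. mpoly_val x n (c j)" "\<lambda>j. mpoly_val x n (c' j)" "x n" ?D] 1 2 cl x
      by simp
    show "padd P Q m = padd (c (count m n)) (c' (count m n)) (filter_mset (\<lambda>i. i \<noteq> n) m)" for m
      using c(4) c'(4) by (simp add: padd_apply)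
  qed
next
  case (var P i)
  obtain c d where c: "\<forall>j. c j \<in> pset n" "\<forall>j\<ge>d. c j = const \<zero>"
    "mpoly_val x (Suc n) P = poly_val (\<lambda>j. mpoly_val x n (c j)) d (x n)"
    "\<forall>m. P m = c (count m n) (filter_mset (\<lambda>i. i \<noteq> n) m)" using var(2) by blast
  have z: "\<zero> \<in> A" by (rule subringE(2)[OF A])
  have cl: "mpoly_val x n (c j) \<in> carrier R" for j
    using c(1) mpoly_val_closed by blast
  have val: "mpoly_val x (Suc n) (pmult P i) = x i \<otimes> poly_val (\<lambda>j. mpoly_val x n (c j)) d (x n)"
    using mpoly_val_pmult[OF var(1,3,3)] c(3) cl x by (simp add: m_comm poly_val_closed)
  show ?case
  proof (cases "i = n")
    case False
    then have i: "i < n" using var(3) by simp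
    show ?thesis
    proof (intro exI[of _ "\<lambda>j. pmult (c j) i"] exI[of _ d] conjI allI impI)
      show "pmult (c j) i \<in> pset n" for j using c(1) pset_intros(3) i by blast
      show "pmult (c j) i = const \<zero>" if "d \<le> j" for j
        using that c(2) by (auto simp: fun_eq_iff pmult_apply const_apply)
      have "mpoly_val x n (pmult (c j) i) = x i \<otimes> mpoly_val x n (c j)" for j
        using mpoly_val_pmult[of "c j" n i n] c(1) i cl x by (simp add: m_comm)
      then show "mpoly_val x (Suc n) (pmult P i) = poly_val (\<lambda>j. mpoly_val x n (pmult (c j) i)) d (x n)"
        unfolding val using cl x by (simp add: poly_val_smult)
      show "pmult P i m = pmult (c (count m n)) i (filter_mset (\<lambda>i. i \<noteq> n) m)" for m
        using c(4) i by (simp add: pmult_apply)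
    qed
  next
    case True
    let ?c = "case_nat (const \<zero>) c"
    show ?thesis
    proof (intro exI[of _ ?c] exI[of _ "Suc d"] conjI allI impI)
      show "?c j \<in> pset n" for j using c(1) z pset_intros(1) by (auto split: nat.split)
      show "?c j = const \<zero>" if "Suc d \<le> j" for j using that c(2) by (cases j) auto
      show "mpoly_val x (Suc n) (pmult P i) = poly_val (\<lambda>j. mpoly_val x n (?c j)) (Suc d) (x n)"
        unfolding val using True cl x z by (simp add: mpoly_val_const poly_val_closed)
      show "pmult P i m = ?c (count m n) (filter_mset (\<lambda>i. i \<noteq> n) m)" for m
      proof (cases "count m n")
        case 0
        then have "n \<notin># m" by (simp add: not_in_iff)
        then show ?thesis unfolding 0 using True by (simp add: pmult_apply const_apply)
      next
        case (Suc j)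
        then have "n \<in># m" by (metis count_greater_zero_iff zero_less_Suc)
        then show ?thesis using True Suc c(4) by (simp add: pmult_apply)
      qed
    qed
  qed
qed

text \<open>The last member of the tower is transcendental over the image of the polynomials in the others, so all
coefficients with respect to the last variable evaluate to zero.\<close>
private lemma mpoly_val_zero_imp:
  assumes "tower {\<zero>} A (map x [0..<n])" "P \<in> pset n" "mpoly_val x n P = \<zero>"
  shows "P = const \<zero>"
  using assms
proof (induction n arbitrary: P)
  case 0
  have "\<exists>a\<in>A. P = const a"
    using 0(2)
  proof (induct rule: pset_induct)
    case (add P Q)
    then obtain a b where ab: "a \<in> A" "b \<in> A" "P = const a" "Q = const b" by blast
    then have "padd P Q = const (a \<oplus> b)" by (auto simp: fun_eq_iff padd_apply const_apply)
    then show ?case using subringE(7)[OF A ab(1,2)] by blast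
  qed auto
  then show ?case using 0(3) mpoly_val_const by auto
next
  case (Suc n)
  obtain c d where c: "\<forall>j. c j \<in> pset n" "\<forall>j\<ge>d. c j = const \<zero>"
    "mpoly_val x (Suc n) P = poly_val (\<lambda>j. mpoly_val x n (c j)) d (x n)"
    "\<forall>m. P m = c (count m n) (filter_mset (\<lambda>i. i \<noteq> n) m)"
    using last_variable[OF Suc.prems(2)] by blast
  have t: "tower {\<zero>} A (map x [0..<n])" "transc_mod {\<zero>} (adjoins A (map x [0..<n])) (x n)"
    using Suc.prems(1) by (simp_all add: tower_append)
  have "mpoly_val x n (c j) = \<zero>" if "j < d" for j
  proof -
    have "mpoly_val x n (c i) \<in> adjoins A (map x [0..<n])" for i
      using c(1) mpoly_val_image[of n] by blast
    then show ?thesis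
      using transc_modD[OF t(2), of "\<lambda>j. mpoly_val x n (c j)" d j] c(3) Suc.prems(3) that by simp
  qed
  then have "c j = const \<zero>" for j
    using Suc.IH[OF t(1)] c(1,2) by (metis not_le)
  then show ?case using c(4) by (auto simp: fun_eq_iff const_apply)
qed

lemma mpoly_val_iso:
  assumes "tower {\<zero>} A (map x [0..<n])" "adjoins A (map x [0..<n]) = carrier R"
  shows "mpoly_val x n \<in> ring_iso (ring.mpoly_ring S n) R"
    and "\<forall>a\<in>A. mpoly_val x n (const a) = a"
proof -
  have carr: "carrier (ring.mpoly_ring S n) = pset n"
    by (simp add: ring.mpoly_ring_def[OF S_ring])
  have "inj_on (mpoly_val x n) (pset n)"
  proof (rule inj_onI)
    fix P Q assume PQ: "P \<in> pset n" "Q \<in> pset n" "mpoly_val x n P = mpoly_val x n Q"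
    have m: "\<ominus> \<one> \<in> A" by (rule subringE(5)[OF A subringE(3)[OF A]])
    let ?D = "padd P (\<lambda>m. \<ominus> \<one> \<otimes> Q m)"
    note sQ = smult_pset[OF m PQ(2)]
    have "mpoly_val x n ?D = \<zero>"
      using mpoly_val_add[OF PQ(1) conjunct1[OF sQ]] sQ PQ mpoly_val_closed
      by (simp add: a_inv_as_mult r_neg)
    then have D: "?D = const \<zero>"
      using mpoly_val_zero_imp[OF assms(1)] pset_intros(2)[OF PQ(1) conjunct1[OF sQ]] by blast
    show "P = Q"
    proof
      fix m
      have c: "P m \<in> carrier R" "Q m \<in> carrier R" using pset_coeff PQ A_carrier by auto
      have "P m \<oplus> \<ominus> Q m = \<zero>"
        using fun_cong[OF D, of m] c by (simp add: padd_apply const_apply a_inv_as_mult)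
      then show "P m = Q m" using r_right_minus_eq[OF c] by (simp add: a_minus_def)
    qed
  qed
  moreover have "mpoly_val x n ` pset n = carrier R" using mpoly_val_image assms(2) by simp
  ultimately show "mpoly_val x n \<in> ring_iso (ring.mpoly_ring S n) R"
    using mpoly_val_hom by (simp add: ring_iso_def bij_betw_def carr)
  show "\<forall>a\<in>A. mpoly_val x n (const a) = a" using mpoly_val_const by blast
qed

end

lemma polynomial_ring_over_of_tower:
  assumes A: "subring A R" and t: "tower {\<zero>} A xs" "adjoins A xs = carrier R"
  shows "polynomial_ring_over A R"
proof -
  define x where "x i = (if i < length xs then xs ! i else \<zero>)" for i
  have map: "map x [0..<length xs] = xs" by (rule nth_equalityI) (auto simp: x_def)
  have x: "range x \<subseteq> carrier R" using tower_carrier[OF t(1)] by (auto simp: x_def)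
  show ?thesis
    unfolding polynomial_ring_over_def
    using mpoly_val_iso[OF A x, where n = "length xs"] t unfolding map
    by (intro exI[of _ "length xs"] bexI[of _ "mpoly_val x (length xs)"]) auto
qed

end

section \<open>Affine domains and their field of scalars\<close>

context affine_domain
begin

definition scalars :: "'c set"
  where "scalars = (\<lambda>c. c \<odot>\<^bsub>B\<^esub> \<one>\<^bsub>B\<^esub>) ` carrier K"

lemma scalar_hom: "ring_hom_ring K B (\<lambda>c. c \<odot>\<^bsub>B\<^esub> \<one>\<^bsub>B\<^esub>)"
proof (rule ring_hom_ringI2)
  show "(\<lambda>c. c \<odot>\<^bsub>B\<^esub> \<one>\<^bsub>B\<^esub>) \<in> ring_hom K B"
  proof (rule ring_hom_memI)
    fix x y assume xy: "x \<in> carrier K" "y \<in> carrier K"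
    have "(x \<odot>\<^bsub>B\<^esub> \<one>\<^bsub>B\<^esub>) \<otimes>\<^bsub>B\<^esub> (y \<odot>\<^bsub>B\<^esub> \<one>\<^bsub>B\<^esub>) = x \<odot>\<^bsub>B\<^esub> (\<one>\<^bsub>B\<^esub> \<otimes>\<^bsub>B\<^esub> (y \<odot>\<^bsub>B\<^esub> \<one>\<^bsub>B\<^esub>))"
      using xy by (intro smult_assoc2) auto
    then show "(x \<otimes> y) \<odot>\<^bsub>B\<^esub> \<one>\<^bsub>B\<^esub> = (x \<odot>\<^bsub>B\<^esub> \<one>\<^bsub>B\<^esub>) \<otimes>\<^bsub>B\<^esub> (y \<odot>\<^bsub>B\<^esub> \<one>\<^bsub>B\<^esub>)"
      using xy by (simp add: smult_assoc1)
    show "(x \<oplus> y) \<odot>\<^bsub>B\<^esub> \<one>\<^bsub>B\<^esub> = (x \<odot>\<^bsub>B\<^esub> \<one>\<^bsub>B\<^esub>) \<oplus>\<^bsub>B\<^esub> (y \<odot>\<^bsub>B\<^esub> \<one>\<^bsub>B\<^esub>)"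
      using xy by (simp add: smult_l_distr)
  qed auto
qed (rule K.ring_axioms, rule B.ring_axioms)

lemma smult_eq: "\<lbrakk>c \<in> carrier K; b \<in> carrier B\<rbrakk> \<Longrightarrow> c \<odot>\<^bsub>B\<^esub> b = (c \<odot>\<^bsub>B\<^esub> \<one>\<^bsub>B\<^esub>) \<otimes>\<^bsub>B\<^esub> b"
  by (simp add: smult_assoc2)

lemma subfield_scalars: "subfield scalars B"
  and inj_scalars: "inj_on (\<lambda>c. c \<odot>\<^bsub>B\<^esub> \<one>\<^bsub>B\<^esub>) (carrier K)"
proof -
  interpret h: ring_hom_ring K B "\<lambda>c. c \<odot>\<^bsub>B\<^esub> \<one>\<^bsub>B\<^esub>" by (rule scalar_hom)
  have "\<one>\<^bsub>B\<^esub> \<noteq> \<zero>\<^bsub>B\<^esub>" by (rule domain.one_not_zero[OF B.domain_axioms])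
  from h.img_is_subfield[OF K.carrier_is_subfield this]
  show "subfield scalars B" "inj_on (\<lambda>c. c \<odot>\<^bsub>B\<^esub> \<one>\<^bsub>B\<^esub>) (carrier K)"
    by (simp_all add: scalars_def)
qed

lemma char0_domain_scalars:
  assumes "char_zero K" shows "char0_domain B scalars"
proof (intro char0_domain.intro char0_domain_axioms.intro)
  interpret h: ring_hom_ring K B "\<lambda>c. c \<odot>\<^bsub>B\<^esub> \<one>\<^bsub>B\<^esub>" by (rule scalar_hom)
  fix n :: nat assume n: "0 < n"
  have "([n] \<cdot>\<^bsub>K\<^esub> \<one>\<^bsub>K\<^esub>) \<odot>\<^bsub>B\<^esub> \<one>\<^bsub>B\<^esub> = [n] \<cdot>\<^bsub>B\<^esub> \<one>\<^bsub>B\<^esub>"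
    by (induction n) (auto simp: smult_l_distr)
  moreover have "[n] \<cdot>\<^bsub>K\<^esub> \<one>\<^bsub>K\<^esub> \<noteq> \<zero>\<^bsub>K\<^esub>" using assms n by (simp add: char_zero_def)
  moreover have "[n] \<cdot>\<^bsub>K\<^esub> \<one>\<^bsub>K\<^esub> \<in> carrier K" by simp
  ultimately show "[n] \<cdot>\<^bsub>B\<^esub> \<one>\<^bsub>B\<^esub> \<noteq> \<zero>\<^bsub>B\<^esub>"
    using inj_onD[OF inj_scalars, of "[n] \<cdot>\<^bsub>K\<^esub> \<one>\<^bsub>K\<^esub>" "\<zero>\<^bsub>K\<^esub>"] h.hom_zero by auto
qed (rule B.domain_axioms, rule subfield_scalars)

text \<open>Univariate polynomials are lists with the leading coefficient first; \<open>p m\<close> is such a list for the first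
\<open>m\<close> coefficients.\<close>
lemma alg_closed_domain_scalars:
  assumes "algebraically_closed K" "char_zero K" shows "alg_closed_domain B scalars"
proof (intro alg_closed_domain.intro alg_closed_domain_axioms.intro)
  show "char0_domain B scalars" by (rule char0_domain_scalars[OF assms(2)])
  interpret A: algebraically_closed K by (rule assms(1))
  interpret h: ring_hom_ring K B "\<lambda>c. c \<odot>\<^bsub>B\<^esub> \<one>\<^bsub>B\<^esub>" by (rule scalar_hom)
  fix c and n :: nat assume c: "\<And>i. c i \<in> scalars" "c (Suc n) \<noteq> \<zero>\<^bsub>B\<^esub>"
  have "\<forall>i. \<exists>a. a \<in> carrier K \<and> c i = a \<odot>\<^bsub>B\<^esub> \<one>\<^bsub>B\<^esub>" using c(1) by (auto simp: scalars_def)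
  then obtain a where a: "\<And>i. a i \<in> carrier K" "\<And>i. c i = a i \<odot>\<^bsub>B\<^esub> \<one>\<^bsub>B\<^esub>" by metis
  define p where "p m = map a (rev [0..<m])" for m
  have p_Suc: "p (Suc m) = a m # p m" and len: "length (p m) = m" for m by (simp_all add: p_def)
  have "a (Suc n) \<noteq> \<zero>\<^bsub>K\<^esub>" using c(2) a(2) h.hom_zero by metis
  then have "polynomial\<^bsub>K\<^esub> (carrier K) (p (Suc (Suc n)))"
    using a(1) unfolding polynomial_def p_Suc[of "Suc n"] by (auto simp: p_def)
  then have P: "p (Suc (Suc n)) \<in> carrier (poly_ring K)" by (simp add: univ_poly_carrier)
  then have "size (K.roots (p (Suc (Suc n)))) = Suc n"
    using A.roots_over_carrier len by (simp add: K.splitted_def)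
  then have "K.roots (p (Suc (Suc n))) \<noteq> {#}" by auto
  then obtain r where "r \<in># K.roots (p (Suc (Suc n)))" by blast
  then have r: "r \<in> carrier K" "K.eval (p (Suc (Suc n))) r = \<zero>\<^bsub>K\<^esub>"
    using K.roots_mem_iff_is_root[OF P] by (auto simp: K.is_root_def)
  have "B.poly_val c m (r \<odot>\<^bsub>B\<^esub> \<one>\<^bsub>B\<^esub>) = K.eval (p m) r \<odot>\<^bsub>B\<^esub> \<one>\<^bsub>B\<^esub> \<and> K.eval (p m) r \<in> carrier K" for m
  proof (induction m)
    case 0
    then show ?case using h.hom_zero by (simp add: p_def)
  next
    case (Suc m)
    have "B.poly_val c (Suc m) (r \<odot>\<^bsub>B\<^esub> \<one>\<^bsub>B\<^esub>)
        = B.poly_val c m (r \<odot>\<^bsub>B\<^esub> \<one>\<^bsub>B\<^esub>) \<oplus>\<^bsub>B\<^esub> c m \<otimes>\<^bsub>B\<^esub> (r \<odot>\<^bsub>B\<^esub> \<one>\<^bsub>B\<^esub>) [^]\<^bsub>B\<^esub> m"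
      using a r(1) by (intro B.poly_val_Suc_top) auto
    also have "\<dots> = (K.eval (p m) r \<oplus>\<^bsub>K\<^esub> a m \<otimes>\<^bsub>K\<^esub> r [^]\<^bsub>K\<^esub> m) \<odot>\<^bsub>B\<^esub> \<one>\<^bsub>B\<^esub>"
      using Suc a(1) a(2)[of m] r(1) h.hom_add h.hom_mult h.hom_nat_pow by simp
    finally show ?case
      using Suc a(1) r(1) by (simp add: p_Suc len K.a_comm)
  qed
  then have "B.poly_val c (Suc (Suc n)) (r \<odot>\<^bsub>B\<^esub> \<one>\<^bsub>B\<^esub>) = \<zero>\<^bsub>B\<^esub>"
    using r(2) h.hom_zero by metis
  then show "\<exists>x\<in>scalars. B.poly_val c (Suc (Suc n)) x = \<zero>\<^bsub>B\<^esub>"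
    using r(1) by (auto simp: scalars_def)
qed

text \<open>By the Leibniz rule, linearity over the scalars means that scalars are mapped to zero.\<close>
lemma LND_iff_lnd_on:
  assumes A: "subring A B" "scalars \<subseteq> A"
  shows "D \<in> LND K (B\<lparr>carrier := A\<rparr>) \<longleftrightarrow> B.lnd_on scalars A D"
proof -
  have AB: "a \<in> A \<Longrightarrow> a \<in> carrier B" for a using subringE(1)[OF A(1)] by auto
  have sA: "c \<odot>\<^bsub>B\<^esub> \<one>\<^bsub>B\<^esub> \<in> A" if "c \<in> carrier K" for c using A(2) that by (auto simp: scalars_def)
  have one: "\<one>\<^bsub>B\<^esub> \<in> A" by (rule subringE(3)[OF A(1)])
  let ?leib = "\<forall>a\<in>A. \<forall>b\<in>A. D (a \<otimes>\<^bsub>B\<^esub> b) = D a \<otimes>\<^bsub>B\<^esub> b \<oplus>\<^bsub>B\<^esub> a \<otimes>\<^bsub>B\<^esub> D b"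
  have lin: "(\<forall>c\<in>carrier K. \<forall>b\<in>A. D (c \<odot>\<^bsub>B\<^esub> b) = c \<odot>\<^bsub>B\<^esub> D b) \<longleftrightarrow> (\<forall>c\<in>scalars. D c = \<zero>\<^bsub>B\<^esub>)"
    if D: "\<forall>a\<in>A. D a \<in> A" "?leib"
  proof
    assume l: "\<forall>c\<in>carrier K. \<forall>b\<in>A. D (c \<odot>\<^bsub>B\<^esub> b) = c \<odot>\<^bsub>B\<^esub> D b"
    have d1: "D \<one>\<^bsub>B\<^esub> \<in> carrier B" using D(1) one AB by auto
    have "D (\<one>\<^bsub>B\<^esub> \<otimes>\<^bsub>B\<^esub> \<one>\<^bsub>B\<^esub>) = D \<one>\<^bsub>B\<^esub> \<otimes>\<^bsub>B\<^esub> \<one>\<^bsub>B\<^esub> \<oplus>\<^bsub>B\<^esub> \<one>\<^bsub>B\<^esub> \<otimes>\<^bsub>B\<^esub> D \<one>\<^bsub>B\<^esub>"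
      using D(2) one by blast
    then have "D \<one>\<^bsub>B\<^esub> = D \<one>\<^bsub>B\<^esub> \<oplus>\<^bsub>B\<^esub> D \<one>\<^bsub>B\<^esub>" using d1 by simp
    then have "D \<one>\<^bsub>B\<^esub> = \<zero>\<^bsub>B\<^esub>" using B.add_minus_cancel[OF d1 d1] B.r_right_minus_eq[OF d1 d1] by metis
    then show "\<forall>c\<in>scalars. D c = \<zero>\<^bsub>B\<^esub>" using l one by (auto simp: scalars_def smult_r_null)
  next
    assume z: "\<forall>c\<in>scalars. D c = \<zero>\<^bsub>B\<^esub>"
    show "\<forall>c\<in>carrier K. \<forall>b\<in>A. D (c \<odot>\<^bsub>B\<^esub> b) = c \<odot>\<^bsub>B\<^esub> D b"
    proof (intro ballI)
      fix c b assume cb: "c \<in> carrier K" "b \<in> A"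
      have "D (c \<odot>\<^bsub>B\<^esub> b) = D ((c \<odot>\<^bsub>B\<^esub> \<one>\<^bsub>B\<^esub>) \<otimes>\<^bsub>B\<^esub> b)" 
        using smult_eq[OF cb(1) AB[OF cb(2)]] by simp
      also have "\<dots> = D (c \<odot>\<^bsub>B\<^esub> \<one>\<^bsub>B\<^esub>) \<otimes>\<^bsub>B\<^esub> b \<oplus>\<^bsub>B\<^esub> (c \<odot>\<^bsub>B\<^esub> \<one>\<^bsub>B\<^esub>) \<otimes>\<^bsub>B\<^esub> D b"
        by (rule D(2)[rule_format, OF sA[OF cb(1)] cb(2)])
      also have "D (c \<odot>\<^bsub>B\<^esub> \<one>\<^bsub>B\<^esub>) = \<zero>\<^bsub>B\<^esub>" using z cb by (auto simp: scalars_def)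
      finally show "D (c \<odot>\<^bsub>B\<^esub> b) = c \<odot>\<^bsub>B\<^esub> D b"
        using cb D(1) AB smult_eq[of c "D b"] by simp
    qed
  qed
  have der: "D \<in> derivations K (B\<lparr>carrier := A\<rparr>) \<longleftrightarrow> B.derivation_on scalars A D"
    using lin by (auto simp: derivations_def B.derivation_on_def)
  have nil: "(\<exists>m\<ge>1. (D ^^ m) b = \<zero>\<^bsub>B\<^esub>) \<longleftrightarrow> (\<exists>m. (D ^^ m) b = \<zero>\<^bsub>B\<^esub>)"
    if D: "D \<in> derivations K (B\<lparr>carrier := A\<rparr>)" for b
  proof
    assume "\<exists>m. (D ^^ m) b = \<zero>\<^bsub>B\<^esub>"
    then obtain m where m: "(D ^^ m) b = \<zero>\<^bsub>B\<^esub>" by blast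
    interpret h: ring_hom_ring K B "\<lambda>c. c \<odot>\<^bsub>B\<^esub> \<one>\<^bsub>B\<^esub>" by (rule scalar_hom)
    have "\<zero>\<^bsub>B\<^esub> \<in> scalars" unfolding scalars_def using h.hom_zero by force
    then have "D \<zero>\<^bsub>B\<^esub> = \<zero>\<^bsub>B\<^esub>" using D der by (simp add: B.derivation_on_def)
    then show "\<exists>m\<ge>1. (D ^^ m) b = \<zero>\<^bsub>B\<^esub>" using m by (intro exI[of _ "Suc m"]) simp
  qed blast
  show ?thesis using der nil by (auto simp: LND_def B.lnd_on_def)
qed

lemma generating_list:
  obtains gs where "set gs \<subseteq> carrier B" "B.adjoins scalars gs = carrier B"
proof -
  obtain S where S: "finite S" "S \<subseteq> carrier B" "generate_ring B (scalars \<union> S) = carrier B"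
    using finitely_generated unfolding scalars_def by blast
  obtain gs where gs: "set gs = S" using finite_list[OF S(1)] by blast
  have s: "subring scalars B" by (rule subfieldE(1)[OF subfield_scalars])
  have A: "subring (B.adjoins scalars gs) B" "scalars \<subseteq> B.adjoins scalars gs"
    "set gs \<subseteq> B.adjoins scalars gs"
    using B.adjoins_subring[OF s, of gs] B.adjoins_gens[OF s, of gs] S gs by simp_all
  have "scalars \<union> S \<subseteq> carrier B" using subringE(1)[OF s] S(2) by simp
  from B.generate_ring_min_subring1[OF this A(1)]
  have "carrier B \<subseteq> B.adjoins scalars gs" using A(2,3) gs unfolding S(3) by simp
  then have "B.adjoins scalars gs = carrier B" using subringE(1)[OF A(1)] by (rule equalityI[rotated])
  then show ?thesis using that[of gs] S(2) gs by simp
qed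

text \<open>The generated ring is formed in the subring, with its own additive inverse; it is closed under the inverse
of \<open>B\<close> because \<open>-1\<close> is a scalar.\<close>
lemma affine_subdomain:
  assumes A: "subring A B" "scalars \<subseteq> A" and hs: "set hs \<subseteq> A" "B.adjoins scalars hs = A"
  shows "affine_domain K (B\<lparr>carrier := A\<rparr>)"
proof (intro affine_domain.intro affine_domain_axioms.intro)
  let ?A = "B\<lparr>carrier := A\<rparr>"
  have AB: "a \<in> A \<Longrightarrow> a \<in> carrier B" for a using subringE(1)[OF A(1)] by auto
  show "field K" by (rule K.field_axioms)
  show dom: "domain ?A" by (rule B.subring_is_domain[OF A(1)])
  have sA: "c \<odot>\<^bsub>B\<^esub> b \<in> A" if "c \<in> carrier K" "b \<in> A" for c b
    using smult_eq[OF that(1) AB[OF that(2)]] A that subringE(6)[OF A(1)] by (auto simp: scalars_def)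
  show "algebra K ?A"
    using AB sA dom
    by (intro algebraI)
      (auto simp: K.is_cring domain.axioms smult_l_distr smult_r_distr smult_assoc1 smult_assoc2)
  let ?G = "generate_ring ?A ((\<lambda>c. c \<odot>\<^bsub>?A\<^esub> \<one>\<^bsub>?A\<^esub>) ` carrier K \<union> set hs)"
  have H: "scalars \<union> set hs \<subseteq> carrier ?A" using A hs by auto
  interpret A: domain ?A by (rule dom)
  have G: "subring ?G ?A"
    using A.generate_ring_is_subring[OF H] by (simp add: scalars_def)
  have sG: "scalars \<union> set hs \<subseteq> ?G"
    using generate_ring.incl[of _ "scalars \<union> set hs" ?A] by (auto simp: scalars_def)
  have GA: "?G \<subseteq> A" using subringE(1)[OF G] by simp
  have "subring ?G B"
  proof (rule B.subringI)
    show "?G \<subseteq> carrier B" using GA AB by auto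
    show "\<one>\<^bsub>B\<^esub> \<in> ?G" using subringE(3)[OF G] by simp
    fix a assume a: "a \<in> ?G"
    have "\<ominus>\<^bsub>B\<^esub> \<one>\<^bsub>B\<^esub> \<in> scalars"
      using subfieldE(1)[OF subfield_scalars] by (intro subringE(5) subringE(3))
    then have "\<ominus>\<^bsub>B\<^esub> \<one>\<^bsub>B\<^esub> \<otimes>\<^bsub>B\<^esub> a \<in> ?G" using sG subringE(6)[OF G, of "\<ominus>\<^bsub>B\<^esub> \<one>\<^bsub>B\<^esub>" a] a by auto
    moreover have "a \<in> carrier B" using a GA AB by blast
    ultimately show "\<ominus>\<^bsub>B\<^esub> a \<in> ?G" using B.a_inv_as_mult by simp
    fix b assume b: "b \<in> ?G"
    show "a \<otimes>\<^bsub>B\<^esub> b \<in> ?G" using subringE(6)[OF G a b] by simp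
    show "a \<oplus>\<^bsub>B\<^esub> b \<in> ?G" using subringE(7)[OF G a b] by simp
  qed
  then have "B.adjoins scalars hs \<subseteq> ?G" using sG by (intro B.adjoins_least) auto
  then have "?G = carrier ?A" using GA hs(2) by auto
  then show "\<exists>S. finite S \<and> S \<subseteq> carrier ?A \<and>
      generate_ring ?A ((\<lambda>c. c \<odot>\<^bsub>?A\<^esub> \<one>\<^bsub>?A\<^esub>) ` carrier K \<union> S) = carrier ?A"
    using hs(1) by (intro exI[of _ "set hs"]) simp
qed

end

theorem proposition4p3:
  fixes K :: "('k, 'n) ring_scheme" and B :: "('k, 'b, 'm) module_scheme"
  assumes "algebraically_closed K" and "char_zero K"
    and "affine_domain K B" and "krull_dim B = 3" and "factorial_domain B"
    and "makar_limanov K B = makar_limanov_star K B"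
  shows "rigid K (B\<lparr>carrier := makar_limanov K B\<rparr>) \<and> factorial_domain (B\<lparr>carrier := makar_limanov K B\<rparr>) \<and>
    polynomial_ring_over (makar_limanov K B) B"
proof -
  interpret affine_domain K B by (rule assms(3))
  interpret C: alg_closed_domain B scalars by (rule alg_closed_domain_scalars[OF assms(1,2)])
  have LND_B: "D \<in> LND K B \<longleftrightarrow> B.lnd_on scalars (carrier B) D" for D
    using LND_iff_lnd_on[of "carrier B" D] C.subalg_carrier by (simp add: C.subalg_def)
  have ml: "makar_limanov K B = C.ml_invariant"
  proof -
    have "LND K B \<noteq> {}"
    proof -
      have "(\<lambda>_. \<zero>\<^bsub>B\<^esub>) \<in> LND K B"
        unfolding LND_B B.lnd_on_def B.derivation_on_def by (auto intro: exI[of _ "Suc 0"])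
      then show ?thesis by blast
    qed
    then show ?thesis
      unfolding makar_limanov_def C.ml_invariant_def a_kernel_def' using LND_B by auto
  qed
  let ?M = "C.ml_invariant"
  have M: "subring ?M B" "scalars \<subseteq> ?M" using C.ml_invariant_subalg by (auto simp: C.subalg_def)
  have ufd: "factorial_domain (B\<lparr>carrier := ?M\<rparr>)"
    using B.factorial_domain_factorially_closed[OF assms(5) M(1)]
      C.factorially_closedD[OF C.ml_invariant_factorially_closed] by blast
  obtain gs where gs: "set gs \<subseteq> carrier B" "B.adjoins scalars gs = carrier B" by (rule generating_list)
  have short: "length xs \<le> 3" if t: "B.tower {\<zero>\<^bsub>B\<^esub>} scalars xs" for xs
  proof (rule ccontr)
    assume "\<not> length xs \<le> 3"
    then obtain P where "\<forall>i\<le>4. primeideal (P i) B" "\<forall>i<4. P i \<subset> P (Suc i)"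
      using B.prime_chain_of_tower[OF B.zeroprimeideal subfield_scalars C.infinite_k gs t, of 4] by auto
    then have "enat 4 \<le> krull_dim B" unfolding krull_dim_def by (intro Sup_upper) blast
    then show False using assms(4) by (simp add: numeral_eq_enat)
  qed
  have "\<exists>xs. B.tower {\<zero>\<^bsub>B\<^esub>} ?M xs \<and> B.adjoins ?M xs = carrier B \<and>
    (\<forall>D. B.lnd_on scalars ?M D \<longrightarrow> (\<forall>a\<in>?M. D a = \<zero>\<^bsub>B\<^esub>)) \<and> (\<exists>hs. set hs \<subseteq> ?M \<and> B.adjoins scalars hs = ?M)"
  proof (cases "LND_star K B = {}")
    case True
    then have "?M = carrier B" using assms(6) ml by (simp add: makar_limanov_star_def)
    then show ?thesis using gs by (intro exI[of _ "[]"]) (auto simp: C.ml_invariant_def)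
  next
    case False
    then obtain E t where E: "B.lnd_on scalars (carrier B) E" "t \<in> carrier B" "E t = \<one>\<^bsub>B\<^esub>"
      by (auto simp: LND_star_def LND_B)
    show ?thesis by (rule C.structure_of_sliced_ufd[OF assms(5) gs short E])
  qed
  then obtain xs hs where xs: "B.tower {\<zero>\<^bsub>B\<^esub>} ?M xs" "B.adjoins ?M xs = carrier B"
    "\<forall>D. B.lnd_on scalars ?M D \<longrightarrow> (\<forall>a\<in>?M. D a = \<zero>\<^bsub>B\<^esub>)" "set hs \<subseteq> ?M" "B.adjoins scalars hs = ?M"
    by blast
  have "rigid K (B\<lparr>carrier := ?M\<rparr>)"
    using affine_subdomain[OF M xs(4,5)] xs(3) LND_iff_lnd_on[OF M] by (simp add: rigid_def)
  moreover have "polynomial_ring_over ?M B" by (rule B.polynomial_ring_over_of_tower[OF M(1) xs(1,2)])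
  ultimately show ?thesis using ufd unfolding ml by blast
qed

end
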